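(* Let $((\rho_{\alpha,0})_{\alpha},\boldsymbol v_0,\chi_0,\chi_1,\varphi_0,(R_{\alpha,0})_{\alpha},(R_{\alpha,1})_{\alpha},\boldsymbol V_0,X_0,X_1,\Phi_0,\Phi_1)$ be a matching solution of the coupled regime (as defined in the context). Then the following equations are satisfied in the bulk regions $\Omega^\pm$: $$\chi_0=\pm1,\qquad\chi_1=0,$$ $$0=\partial_t\rho_{\alpha,0}+\operatorname{div}(\rho_{\alpha,0}\boldsymbol v_0)-\operatorname{div}\Big(\sum_{\beta=1}^{N-1}M_{\alpha\beta}\nabla\Big(\mu_{\beta,0}-\mu_{N,0}+\Big(\frac{z_\beta}{m_\beta}-\frac{z_N}{m_N}\Big)\varphi_0\Big)\Big)-\sum_{i=1}^{N_R}m_\alpha\gamma_\alpha^iM_{\mathrm r}^i\Big(1-\exp\Big(\sum_{\beta=1}^Nm_\beta\gamma^i_\beta\mu_{\beta,0}\Big)\Big)$$ for $\alpha=1,\dots,N-1$, $$0=\partial_t\rho_0+\operatorname{div}(\rho_0\boldsymbol v_0),$$ $$0=\partial_t(\rho_0\boldsymbol v_0)+\operatorname{div}(\rho_0\boldsymbol v_0\otimes\boldsymbol v_0)+\nabla\Big(\sum_{\alpha=1}^N\rho_{\alpha,0}\mu_{\alpha,0}-\rho f_0\Big),$$ $$0=\sum_{\alpha=1}^N\frac{z_\alpha}{m_\alpha}\rho_{\alpha,0}.$$ Moreover, with $j_0:=\rho_0^\pm(\boldsymbol v_0^\pm\cdot\boldsymbol\nu-w_{\boldsymbol\nu})$, the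 following conditions are fulfilled at the interface: $$0=[\![\mu_{\alpha,0}-\mu_{N,0}]\!]\quad(\alpha=1,\dots,N-1),$$ $$0=[\![\rho_0(\boldsymbol v_0\cdot\boldsymbol\nu-w_{\boldsymbol\nu})]\!],$$ $$0=[\![\rho_{\alpha,0}(\boldsymbol v_0\cdot\boldsymbol\nu-w_{\boldsymbol\nu})]\!]-\Big[\!\Big[\sum_{\beta=1}^{N-1}M_{\alpha\beta}\nabla\Big(\mu_{\beta,0}-\mu_{N,0}+\Big(\frac{z_\beta}{m_\beta}-\frac{z_N}{m_N}\Big)\varphi_0\Big)\cdot\boldsymbol\nu\Big]\!\Big]\quad(\alpha=1,\dots,N-1),$$ $$0=\Big[\!\Big[j_0\boldsymbol v_0+\Big(\sum_{\alpha=1}^N\rho_{\alpha,0}\mu_{\alpha,0}-\rho f_0\Big)\boldsymbol\nu\Big]\!\Big]-\gamma\kappa\boldsymbol\nu\int_{-\infty}^\infty(X_{0,z})^2\,dz,$$ $$0=\Big[\!\Big[\frac{j_0^2}{2\rho_0^2}+\mu_{N,0}\Big]\!\Big]+\frac{j_0}{\tau}\int_{-\infty}^\infty\frac1{R_0}(X_{0,z})^2\,dz,$$ $$0=[\![(1+s(\chi_0))\nabla\varphi_0\cdot\boldsymbol\nu]\!]-\int_{-\infty}^\infty\Big(\sum_{\alpha=1}^N\frac{z_\alpha}{m_\alpha}R_{\alpha,0}(z)\Big)dz,$$ $$0=[\![\varphi_0]\!].$$ Moreover, $[\![\varphi_0]\!]=0$ implies $[\![\nabla\varphi_0-(\nab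la\varphi_0\cdot\boldsymbol\nu)\boldsymbol\nu]\!]=0$.
   Context: **Data (nondimensional).** $N$ constituents, $N_R$ reactions; masses $m_\alpha>0$, charges $z_\alpha$, stoichiometric coefficients $\gamma^i_\alpha$, reaction mobilities $M^i_{\mathrm r}$; constants $\gamma,\tau,\varepsilon_0>0$; diffusion mobilities $(M_{\alpha\beta})_{\alpha,\beta=1}^{N-1}$ forming a symmetric positive definite matrix. $W(\chi)=(\chi-1)^2(\chi+1)^2$. $h:\mathbb R\to[0,1]$ is smooth with $h(z)=1$ for $z\ge1$, $h(z)=0$ for $z\le-1$, $h'(z)=0$ for $|z|\ge1$. $s(\chi)=h(\chi)s_L+(1-h(\chi))s_V\ge 0$, where $s_L,s_V$ are the susceptibilities of the pure phases. $(\rho f)(\rho_1,\dots,\rho_N,\chi)=h(\chi)\,\rho\psi_L(\rho_1,\dots,\rho_N)+(1-h(\chi))\,\rho\psi_V(\rho_1,\dots,\rho_N)$, where, with $n_\alpha=\rho_\alpha/m_\alpha$, $n=\sum_\alpha n_\alpha$, $$\rho\psi_{L/V}=\sum_\alpha\rho_\alpha\psi^R_\alpha+(K_{L/V}-p^R)\Big(1-\frac n{n^R}\Big)+K_{L/V}\frac n{n^R}\ln\frac n{n^R}+kT\sum_\alpha n_\alpha\ln\frac{n_\alpha}n,$$ with bulk moduli $K_{L/V}$, reference number density $n^R$, reference pressure $p^R$, reference energies $\psi^R_\alpha$, Boltzmann constant $k$ and temperature $T$. Chemical potentials: $\mu_\alpha=\partial(\rho f)/\partial\rho_\alpha$. **Geometry.**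 $T_f>0$. For $t\in[0,T_f)$ the zeroth-order interface $\Gamma=\Gamma(t)\subset\mathbb R^3$ between the liquid and the vapor phase separates the two bulk regions $\Omega^+$ and $\Omega^-$. $\boldsymbol\nu$ is the unit normal to $\Gamma$ pointing into the liquid, i.e. from $\Omega^-$ into $\Omega^+$; $w_{\boldsymbol\nu}$ is the normal velocity and $\kappa$ the mean curvature of $\Gamma$, $\nabla_\Gamma$ the surface gradient. $f^\pm$ denote the one-sided traces on $\Gamma$ from $\Omega^\pm$ and $[\![f]\!]=f^+-f^-$. $U$ is a parameter domain of $\Gamma$; inner functions depend on $(t,\boldsymbol s,z)\in[0,T_f)\times U\times\mathbb R$, where $z$ is the stretched normal coordinate, and a subscript $z$ denotes $\partial_z$. **Outer solution.** A tuple $((\rho_{\alpha,0})_{\alpha=1}^N,\boldsymbol v_0,\chi_0,\chi_1,\varphi_0)$ with $\rho_{\alpha,0}\in C^0([0,T_f),C^2(\Omega^\pm,\mathbb R_+))\cap C^1([0,T_f),C^0(\Omega^\pm,\mathbb R_+))$, $\boldsymbol v_0\in C^0([0,T_f),C^1(\Omega^\pm,\mathbb R^3))\cap C^1([0,T_f),C^0(\Omega^\pm,\mathbb R^3))$, $\chi_0,\varphi_0\in C^0([0,T_f),C^2(\Omega^\pm,\mathbb R))$, $\chi_1\in C^0([0,T_f),C^1(\Omega^\pm,\mathbb R))$, is an outer solution of the coupled regime if, with $\rho_0=\sum_{\alpha=1}^N\rho_{\alpha,0}$, $\mu_{\alpha,0}=\mu_\alpha(\rho_{1,0},\dots,\rho_{N,0},\chi_0)$,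 $\rho f_0=\rho f(\rho_{1,0},\dots,\rho_{N,0},\chi_0)$, in $\Omega^\pm$: - for $\alpha=1,\dots,N-1$: $0=\partial_t\rho_{\alpha,0}+\operatorname{div}(\rho_{\alpha,0}\boldsymbol v_0)-\operatorname{div}\big(\sum_{\beta=1}^{N-1}M_{\alpha\beta}\nabla(\mu_{\beta,0}-\mu_{N,0}+(\frac{z_\beta}{m_\beta}-\frac{z_N}{m_N})\varphi_0)\big)-\sum_{i=1}^{N_R}m_\alpha\gamma^i_\alpha M^i_{\mathrm r}\big(1-\exp(\sum_{\beta=1}^Nm_\beta\gamma_\beta^i\mu_{\beta,0})\big)$; - $0=\partial_t\rho_0+\operatorname{div}(\rho_0\boldsymbol v_0)$; $\;0=W'(\chi_0)$; - $0=\partial_t(\rho_0\boldsymbol v_0)+\operatorname{div}(\rho_0\boldsymbol v_0\otimes\boldsymbol v_0)+\nabla(\sum_\alpha\rho_{\alpha,0}\mu_{\alpha,0}-\rho f_0)-\nabla(W'(\chi_0)\chi_1)$; - $0=W''(\chi_0)\chi_1+\frac{\partial\rho f}{\partial\chi}(\rho_{1,0},\dots,\rho_{N,0},\chi_0)$; - $0=\sum_{\alpha=1}^N\frac{z_\alpha}{m_\alpha}\rho_{\alpha,0}$. **Inner solution.** A tuple $((R_{\alpha,0})_{\alpha},(R_{\alpha,1})_{\alpha},\boldsymbol V_0,X_0,X_1,\Phi_0,\Phi_1)$ with $X_0\not\equiv0$, all components continuous in $(t,\boldsymbol s)$, with $R_{\alpha,0}$ (positive), $R_{\alpha,1},X_0,X_1,\Phi_0,\Phi_1$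 of class $C^2$ in $z$, $\boldsymbol V_0$ ($\mathbb R^3$-valued) of class $C^1$ in $z$, and $X_0$ also $C^1$ in $\boldsymbol s$, is an inner solution of the coupled regime with normal velocity $w_{\boldsymbol\nu}$ if, with $R_0=\sum_\alpha R_{\alpha,0}$, $\mathcal M_{\beta,0}=\mu_\beta(R_{1,0},\dots,R_{N,0},X_0)$, $RF_0=\rho f(R_{1,0},\dots,R_{N,0},X_0)$, $\frac{\partial RF_0}{\partial\chi}=\frac{\partial\rho f}{\partial\chi}(R_{1,0},\dots,R_{N,0},X_0)$, $j_0=R_0(\boldsymbol V_0\cdot\boldsymbol\nu-w_{\boldsymbol\nu})$, $\mathcal M_{\beta,1}=\sum_\alpha\frac{\partial\mu_\beta}{\partial\rho_\alpha}(R_{1,0},\dots,R_{N,0},X_0)R_{\alpha,1}+\frac{\partial\mu_\beta}{\partial\chi}(R_{1,0},\dots,R_{N,0},X_0)X_1$: - $0=(R_0(\boldsymbol V_0\cdot\boldsymbol\nu-w_{\boldsymbol\nu}))_z=(j_0)_z$; - $0=((1+s(X_0))\Phi_{0,z})_z$; - $0=\big(\sum_{\beta=1}^{N-1}M_{\alpha\beta}\big[(\mathcal M_{\beta,0}-\mathcal M_{N,0})_z+(\frac{z_\beta}{m_\beta}-\frac{z_N}{m_N})\Phi_{0,z}\big]\big)_z$, $\alpha=1,\dots,N-1$; - $0=\boldsymbol\nu\big(-W(X_0)+\frac\gamma2X_{0,z}^2-\frac{\varepsilon_0}2(1+s(X_0))(\Phi_{0,z})^2\big)_z$; - $0=W'(X_0)-\gamma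 X_{0,zz}-\frac{\varepsilon_0}2s'(X_0)(\Phi_{0,z})^2$; - $0=j_0\boldsymbol V_{0,z}+\boldsymbol\nu\big(\sum_\alpha R_{\alpha,0}\mathcal M_{\alpha,0}-RF_0-W'(X_0)X_1\big)_z+\gamma\boldsymbol\nu(X_{0,z}X_{1,zz}+X_{0,zz}X_{1,z}-\kappa X_{0,z}^2)-\nabla_\Gamma W(X_0)+\gamma X_{0,zz}\nabla_\Gamma X_0$; - $0=\frac{j_0}\tau X_{0,z}+W''(X_0)X_1-\gamma X_{1,zz}+\gamma\kappa X_{0,z}+\frac{\partial RF_0}{\partial\chi}$; - for $\alpha=1,\dots,N-1$: $0=(R_{\alpha,0}(\boldsymbol V_0\cdot\boldsymbol\nu-w_{\boldsymbol\nu}))_z-\sum_{\beta=1}^{N-1}M_{\alpha\beta}\big((\mathcal M_{\beta,1}-\mathcal M_{N,1})_{zz}-\kappa(\mathcal M_{\beta,0}-\mathcal M_{N,0})_z+(\frac{z_\beta}{m_\beta}-\frac{z_N}{m_N})\Phi_{1,zz}-\kappa(\frac{z_\beta}{m_\beta}-\frac{z_N}{m_N})\Phi_{0,z}\big)$; - $0=((1+s(X_0))\Phi_{1,z})_z+\sum_{\alpha=1}^N\frac{z_\alpha}{m_\alpha}R_{\alpha,0}$. (The equations from the sixth one on are already simplified using $\Phi_{0,z}=0$, which follows from the second one and the matching condition $\Phi_{0,z}\to0$ as $z\to\pm\infty$.) **Matching solution.** An outer and an inner solution together form a matching solution of the coupled regime if they are linked by the standard matching conditions of matched asymptotic expansions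 at each point of $\Gamma$ as $z\to\pm\infty$: $R_{\alpha,0}\to\rho_{\alpha,0}^\pm$, $\boldsymbol V_0\to\boldsymbol v_0^\pm$, $X_0\to\chi_0^\pm$, $\Phi_0\to\varphi_0^\pm$; the $z$-derivatives of $R_{\alpha,0},\boldsymbol V_0,X_0,\Phi_0,\mathcal M_{\beta,0}$ tend to $0$; $X_1-\chi_1^\pm-z(\nabla\chi_0)^\pm\cdot\boldsymbol\nu\to0$, $X_{1,z}\to(\nabla\chi_0)^\pm\cdot\boldsymbol\nu$; $R_{\alpha,1,z}\to(\nabla\rho_{\alpha,0})^\pm\cdot\boldsymbol\nu$; $\Phi_{1,z}\to(\nabla\varphi_0)^\pm\cdot\boldsymbol\nu$; $(\mathcal M_{\beta,1})_z\to(\nabla\mu_{\beta,0})^\pm\cdot\boldsymbol\nu$.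
   Formalization: In the jump condition for (1+s(χ0))∇φ0·ν the charge integral has a plus sign, as the inner potential equation forces, not the printed minus; χ0=±1 means +1 in Ω⁺ (liquid, χ0≥0 assumed) and −1 in Ω⁻ (χ0≤0 assumed), and the bulk regions Ω± are taken to be connected. *)

theory Defs
  imports "HOL-Analysis.Analysis"
begin

section \<open>Vector calculus\<close>

definition pdiff :: "'n::finite \<Rightarrow> (real^'n \<Rightarrow> 'b::real_normed_vector) \<Rightarrow> real^'n \<Rightarrow> 'b" where
  "pdiff i f x = frechet_derivative f (at x) (axis i 1)"

definition grad :: "(real^3 \<Rightarrow> real) \<Rightarrow> real^3 \<Rightarrow> real^3" where
  "grad f x = (\<chi> i. pdiff i f x)"

definition divg :: "(real^3 \<Rightarrow> real^3) \<Rightarrow> real^3 \<Rightarrow> real" where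
  "divg v x = (\<Sum>i\<in>UNIV. pdiff i v x $ i)"

definition div_tensor :: "(real^3 \<Rightarrow> real^3^3) \<Rightarrow> real^3 \<Rightarrow> real^3" where
  "div_tensor A x = (\<chi> i. divg (\<lambda>y. A y $ i) x)"

definition tensor_prod :: "real^3 \<Rightarrow> real^3 \<Rightarrow> real^3^3" where
  "tensor_prod v w = (\<chi> i j. v $ i * w $ j)"

definition smooth_real :: "(real \<Rightarrow> real) \<Rightarrow> bool" where
  "smooth_real f \<longleftrightarrow> (\<forall>n x. ((deriv ^^ n) f) field_differentiable (at x))"

definition C2_real :: "(real \<Rightarrow> real) \<Rightarrow> bool" where
  "C2_real f \<longleftrightarrow> f C1_differentiable_on UNIV \<and> deriv f C1_differentiable_on UNIV"

definition C1_on :: "(real^'n::finite) set \<Rightarrow> (real^'n \<Rightarrow> 'b::real_normed_vector) \<Rightarrow> bool" where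
  "C1_on A f \<longleftrightarrow> (\<forall>x\<in>A. f differentiable (at x)) \<and> (\<forall>i. continuous_on A (pdiff i f))"

section \<open>Constitutive data\<close>

text \<open>Constituents are indexed by \<open>1, \<dots>, species P\<close> and reactions by \<open>1, \<dots>, reactions P\<close>;
  values of the data at other indices are irrelevant. \<open>stoich P i \<alpha>\<close> is the coefficient of
  constituent \<open>\<alpha>\<close> in reaction \<open>i\<close>.\<close>

record mixture =
  species :: nat
  reactions :: nat
  mass :: "nat \<Rightarrow> real"
  charge :: "nat \<Rightarrow> real"
  stoich :: "nat \<Rightarrow> nat \<Rightarrow> real"
  react_mob :: "nat \<Rightarrow> real"
  diff_mob :: "nat \<Rightarrow> nat \<Rightarrow> real"
  gam :: real
  tau :: real
  eps0 :: real
  interp :: "real \<Rightarrow> real"  (* the function h *)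
  suscL :: real
  suscV :: real
  bulkL :: real
  bulkV :: real
  n_ref :: real
  p_ref :: real
  psi_ref :: "nat \<Rightarrow> real"
  boltz :: real
  temp :: real

definition W :: "real \<Rightarrow> real" where
  "W c = (c - 1)^2 * (c + 1)^2"

definition susc :: "mixture \<Rightarrow> real \<Rightarrow> real" where
  "susc P c = interp P c * suscL P + (1 - interp P c) * suscV P"

definition admissible :: "mixture \<Rightarrow> bool" where
  "admissible P \<longleftrightarrow>
     1 \<le> species P \<and>
     (\<forall>\<alpha>\<in>{1..species P}. 0 < mass P \<alpha>) \<and>
     0 < gam P \<and> 0 < tau P \<and> 0 < eps0 P \<and> 0 < n_ref P \<and>
     (\<forall>\<alpha>\<in>{1..species P - 1}. \<forall>\<beta>\<in>{1..species P - 1}. diff_mob P \<alpha> \<beta> = diff_mob P \<beta> \<alpha>) \<and>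
     (\<forall>\<xi>. (\<exists>\<alpha>\<in>{1..species P - 1}. \<xi> \<alpha> \<noteq> 0) \<longrightarrow>
        0 < (\<Sum>\<alpha>=1..species P - 1. \<Sum>\<beta>=1..species P - 1. \<xi> \<alpha> * diff_mob P \<alpha> \<beta> * \<xi> \<beta>)) \<and>
     smooth_real (interp P) \<and>
     (\<forall>c. 0 \<le> interp P c \<and> interp P c \<le> 1) \<and>
     (\<forall>c\<ge>1. interp P c = 1) \<and> (\<forall>c\<le>-1. interp P c = 0) \<and>
     (\<forall>c. 1 \<le> \<bar>c\<bar> \<longrightarrow> deriv (interp P) c = 0) \<and>
     (\<forall>c. 0 \<le> susc P c)"

text \<open>A composition is a function \<open>\<rho> :: nat \<Rightarrow> real\<close> of partial mass densities.\<close>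

definition rho_psi :: "mixture \<Rightarrow> real \<Rightarrow> (nat \<Rightarrow> real) \<Rightarrow> real" where
  "rho_psi P K \<rho> =
     (let na = (\<lambda>\<alpha>. \<rho> \<alpha> / mass P \<alpha>); n = (\<Sum>\<alpha>=1..species P. na \<alpha>) in
        (\<Sum>\<alpha>=1..species P. \<rho> \<alpha> * psi_ref P \<alpha>)
        + (K - p_ref P) * (1 - n / n_ref P)
        + K * (n / n_ref P) * ln (n / n_ref P)
        + boltz P * temp P * (\<Sum>\<alpha>=1..species P. na \<alpha> * ln (na \<alpha> / n)))"

definition rho_f :: "mixture \<Rightarrow> (nat \<Rightarrow> real) \<Rightarrow> real \<Rightarrow> real" where
  "rho_f P \<rho> c = interp P c * rho_psi P (bulkL P) \<rho> + (1 - interp P c) * rho_psi P (bulkV P) \<rho>"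

definition drf_dchi :: "mixture \<Rightarrow> (nat \<Rightarrow> real) \<Rightarrow> real \<Rightarrow> real" where
  "drf_dchi P \<rho> c = deriv (\<lambda>y. rho_f P \<rho> y) c"

definition mu :: "mixture \<Rightarrow> nat \<Rightarrow> (nat \<Rightarrow> real) \<Rightarrow> real \<Rightarrow> real" where
  "mu P \<alpha> \<rho> c = deriv (\<lambda>y. rho_f P (\<rho>(\<alpha> := y)) c) (\<rho> \<alpha>)"

definition dmu_drho :: "mixture \<Rightarrow> nat \<Rightarrow> nat \<Rightarrow> (nat \<Rightarrow> real) \<Rightarrow> real \<Rightarrow> real" where
  "dmu_drho P \<beta> \<alpha> \<rho> c = deriv (\<lambda>y. mu P \<beta> (\<rho>(\<alpha> := y)) c) (\<rho> \<alpha>)"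

definition dmu_dchi :: "mixture \<Rightarrow> nat \<Rightarrow> (nat \<Rightarrow> real) \<Rightarrow> real \<Rightarrow> real" where
  "dmu_dchi P \<beta> \<rho> c = deriv (\<lambda>y. mu P \<beta> \<rho> y) c"

text \<open>The coefficient of the electric potential in the diffusion fluxes.\<close>

definition zrel :: "mixture \<Rightarrow> nat \<Rightarrow> real" where
  "zrel P \<beta> = charge P \<beta> / mass P \<beta> - charge P (species P) / mass P (species P)"

section \<open>Geometry of the evolving interface\<close>

text \<open>\<open>Plus\<close> is the liquid side, \<open>Minus\<close> the vapour side.\<close>

datatype side = Plus | Minus

fun side_sign :: "side \<Rightarrow> real" where
  "side_sign Plus = 1"
| "side_sign Minus = -1"

fun far :: "side \<Rightarrow> real filter" where
  "far Plus = at_top"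
| "far Minus = at_bot"

text \<open>The interface at time \<open>t\<close> is the image of the parameter domain under \<open>param G t\<close>;
  \<open>normal\<close> is likewise a function of time and parameter.\<close>

record geometry =
  tfin :: real
  Om :: "side \<Rightarrow> real \<Rightarrow> (real^3) set"
  pdom :: "(real^2) set"
  param :: "real \<Rightarrow> real^2 \<Rightarrow> real^3"
  normal :: "real \<Rightarrow> real^2 \<Rightarrow> real^3"

definition spacetime :: "geometry \<Rightarrow> side \<Rightarrow> (real \<times> (real^3)) set" where
  "spacetime G \<sigma> = {(t, x). t \<in> {0..<tfin G} \<and> x \<in> Om G \<sigma> t}"

text \<open>The last clause says that \<open>normal\<close> points from \<open>Om G Minus\<close> into \<open>Om G Plus\<close>,
  locally uniformly along the interface.\<close>

definition interface_geometry :: "geometry \<Rightarrow> bool" where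
  "interface_geometry G \<longleftrightarrow>
     0 < tfin G \<and> open (pdom G) \<and>
     (\<forall>\<sigma>. openin (top_of_set ({0..<tfin G} \<times> UNIV)) (spacetime G \<sigma>)) \<and>
     (\<forall>t\<in>{0..<tfin G}.
        (\<forall>\<sigma>. connected (Om G \<sigma> t)) \<and>
        Om G Plus t \<inter> Om G Minus t = {} \<and>
        (\<forall>\<sigma>. param G t ` pdom G \<inter> Om G \<sigma> t = {}) \<and>
        C1_on (pdom G) (param G t) \<and>
        (\<forall>i. C1_on (pdom G) (pdiff i (param G t))) \<and>
        C1_on (pdom G) (normal G t) \<and>
        (\<forall>s\<in>pdom G.
           (\<lambda>r. param G r s) differentiable (at t within {0..<tfin G}) \<and>
           cross3 (pdiff 1 (param G t) s) (pdiff 2 (param G t) s) \<noteq> 0 \<and>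
           norm (normal G t s) = 1 \<and>
           (\<forall>i. pdiff i (param G t) s \<bullet> normal G t s = 0) \<and>
           (\<forall>\<^sub>F (d, q) in at_right 0 \<times>\<^sub>F nhds s.
              param G t q + d *\<^sub>R normal G t q \<in> Om G Plus t \<and>
              param G t q - d *\<^sub>R normal G t q \<in> Om G Minus t)))"

definition normal_velocity :: "geometry \<Rightarrow> real \<Rightarrow> real^2 \<Rightarrow> real" where
  "normal_velocity G t s =
     vector_derivative (\<lambda>r. param G r s) (at t within {0..<tfin G}) \<bullet> normal G t s"

definition first_form :: "geometry \<Rightarrow> real \<Rightarrow> real^2 \<Rightarrow> real^2^2" where
  "first_form G t s = (\<chi> i j. pdiff i (param G t) s \<bullet> pdiff j (param G t) s)"

definition surf_grad :: "geometry \<Rightarrow> real \<Rightarrow> (real^2 \<Rightarrow> real) \<Rightarrow> real^2 \<Rightarrow> real^3" where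
  "surf_grad G t f s =
     (\<Sum>i\<in>UNIV. \<Sum>j\<in>UNIV.
        (matrix_inv (first_form G t s) $ i $ j * pdiff j f s) *\<^sub>R pdiff i (param G t) s)"

text \<open>The mean curvature is minus the surface divergence of the normal, i.e. the sum (not the
  average) of the principal curvatures. This is the convention for which the Laplacian has the
  expansion \<open>\<partial>\<^sub>z\<^sub>z / \<epsilon>\<^sup>2 - \<kappa> \<partial>\<^sub>z / \<epsilon> + \<dots>\<close> in stretched normal coordinates.\<close>

definition mean_curvature :: "geometry \<Rightarrow> real \<Rightarrow> real^2 \<Rightarrow> real" where
  "mean_curvature G t s =
     - (\<Sum>i\<in>UNIV. \<Sum>j\<in>UNIV.
          matrix_inv (first_form G t s) $ i $ j
          * (pdiff i (param G t) s \<bullet> pdiff j (normal G t) s))"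

text \<open>One-sided traces and jumps of a function on the bulk regions at time \<open>t\<close>, in the
  interface point with parameter \<open>s\<close>.\<close>

definition has_trace :: "geometry \<Rightarrow> side \<Rightarrow> real \<Rightarrow> real^2 \<Rightarrow> (real^3 \<Rightarrow> 'b::t2_space) \<Rightarrow> bool" where
  "has_trace G \<sigma> t s f \<longleftrightarrow> (\<exists>l. (f \<longlongrightarrow> l) (at (param G t s) within Om G \<sigma> t))"

definition tr :: "geometry \<Rightarrow> side \<Rightarrow> real \<Rightarrow> real^2 \<Rightarrow> (real^3 \<Rightarrow> 'b::t2_space) \<Rightarrow> 'b" where
  "tr G \<sigma> t s f = Lim (at (param G t s) within Om G \<sigma> t) f"

definition jump :: "geometry \<Rightarrow> real \<Rightarrow> real^2 \<Rightarrow> (real^3 \<Rightarrow> 'b::real_normed_vector) \<Rightarrow> 'b" where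
  "jump G t s f = tr G Plus t s f - tr G Minus t s f"

text \<open>Since the bulk regions move, \<open>C\<^sup>0([0,T), C\<^sup>k)\<close> and \<open>C\<^sup>1([0,T), C\<^sup>0)\<close> are rendered as
  existence and joint continuity of the respective derivatives on the space-time region.
  At \<open>t = 0\<close> the time derivative is one-sided.\<close>

definition dt :: "geometry \<Rightarrow> (real \<Rightarrow> real^3 \<Rightarrow> 'b::real_normed_vector) \<Rightarrow> real \<Rightarrow> real^3 \<Rightarrow> 'b" where
  "dt G f t x = vector_derivative (\<lambda>r. f r x) (at t within {0..<tfin G})"

definition C0C0 :: "geometry \<Rightarrow> side \<Rightarrow> (real \<Rightarrow> real^3 \<Rightarrow> 'b::real_normed_vector) \<Rightarrow> bool" where
  "C0C0 G \<sigma> f \<longleftrightarrow> continuous_on (spacetime G \<sigma>) (\<lambda>(t, x). f t x)"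

definition C0C1 :: "geometry \<Rightarrow> side \<Rightarrow> (real \<Rightarrow> real^3 \<Rightarrow> 'b::real_normed_vector) \<Rightarrow> bool" where
  "C0C1 G \<sigma> f \<longleftrightarrow> C0C0 G \<sigma> f \<and>
     (\<forall>(t, x)\<in>spacetime G \<sigma>. f t differentiable (at x)) \<and>
     (\<forall>i. C0C0 G \<sigma> (\<lambda>t. pdiff i (f t)))"

definition C0C2 :: "geometry \<Rightarrow> side \<Rightarrow> (real \<Rightarrow> real^3 \<Rightarrow> 'b::real_normed_vector) \<Rightarrow> bool" where
  "C0C2 G \<sigma> f \<longleftrightarrow> C0C1 G \<sigma> f \<and> (\<forall>i. C0C1 G \<sigma> (\<lambda>t. pdiff i (f t)))"

definition C1C0 :: "geometry \<Rightarrow> side \<Rightarrow> (real \<Rightarrow> real^3 \<Rightarrow> 'b::real_normed_vector) \<Rightarrow> bool" where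
  "C1C0 G \<sigma> f \<longleftrightarrow> C0C0 G \<sigma> f \<and>
     (\<forall>(t, x)\<in>spacetime G \<sigma>. (\<lambda>r. f r x) differentiable (at t within {0..<tfin G})) \<and>
     C0C0 G \<sigma> (dt G f)"

section \<open>Outer solutions\<close>

record outer =
  rho :: "nat \<Rightarrow> real \<Rightarrow> real^3 \<Rightarrow> real"
  vel :: "real \<Rightarrow> real^3 \<Rightarrow> real^3"
  chi0 :: "real \<Rightarrow> real^3 \<Rightarrow> real"
  chi1 :: "real \<Rightarrow> real^3 \<Rightarrow> real"
  phi0 :: "real \<Rightarrow> real^3 \<Rightarrow> real"

definition rho_tot :: "mixture \<Rightarrow> outer \<Rightarrow> real \<Rightarrow> real^3 \<Rightarrow> real" where
  "rho_tot P S t x = (\<Sum>\<alpha>=1..species P. rho S \<alpha> t x)"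

definition mu0 :: "mixture \<Rightarrow> outer \<Rightarrow> nat \<Rightarrow> real \<Rightarrow> real^3 \<Rightarrow> real" where
  "mu0 P S \<beta> t x = mu P \<beta> (\<lambda>\<alpha>. rho S \<alpha> t x) (chi0 S t x)"

text \<open>The quantity \<open>\<Sum>\<^sub>\<alpha> \<rho>\<^sub>\<alpha> \<mu>\<^sub>\<alpha> - \<rho>f\<close>.\<close>

definition press0 :: "mixture \<Rightarrow> outer \<Rightarrow> real \<Rightarrow> real^3 \<Rightarrow> real" where
  "press0 P S t x =
     (\<Sum>\<alpha>=1..species P. rho S \<alpha> t x * mu0 P S \<alpha> t x) - rho_f P (\<lambda>\<alpha>. rho S \<alpha> t x) (chi0 S t x)"

definition diff_flux :: "mixture \<Rightarrow> outer \<Rightarrow> nat \<Rightarrow> real \<Rightarrow> real^3 \<Rightarrow> real^3" where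
  "diff_flux P S \<alpha> t x =
     (\<Sum>\<beta>=1..species P - 1. diff_mob P \<alpha> \<beta> *\<^sub>R
        grad (\<lambda>y. mu0 P S \<beta> t y - mu0 P S (species P) t y + zrel P \<beta> * phi0 S t y) x)"

definition react_rate :: "mixture \<Rightarrow> outer \<Rightarrow> nat \<Rightarrow> real \<Rightarrow> real^3 \<Rightarrow> real" where
  "react_rate P S \<alpha> t x =
     (\<Sum>i=1..reactions P. mass P \<alpha> * stoich P i \<alpha> * react_mob P i *
        (1 - exp (\<Sum>\<beta>=1..species P. mass P \<beta> * stoich P i \<beta> * mu0 P S \<beta> t x)))"

definition outer_regular :: "mixture \<Rightarrow> geometry \<Rightarrow> outer \<Rightarrow> bool" where
  "outer_regular P G S \<longleftrightarrow> (\<forall>\<sigma>.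
     (\<forall>\<alpha>\<in>{1..species P}. C0C2 G \<sigma> (rho S \<alpha>) \<and> C1C0 G \<sigma> (rho S \<alpha>) \<and>
        (\<forall>(t, x)\<in>spacetime G \<sigma>. 0 < rho S \<alpha> t x)) \<and>
     C0C1 G \<sigma> (vel S) \<and> C1C0 G \<sigma> (vel S) \<and>
     C0C2 G \<sigma> (chi0 S) \<and> C0C2 G \<sigma> (phi0 S) \<and> C0C1 G \<sigma> (chi1 S))"

definition outer_solution :: "mixture \<Rightarrow> geometry \<Rightarrow> outer \<Rightarrow> bool" where
  "outer_solution P G S \<longleftrightarrow> outer_regular P G S \<and>
     (\<forall>\<sigma>. \<forall>(t, x)\<in>spacetime G \<sigma>.
        (\<forall>\<alpha>\<in>{1..species P - 1}.
           0 = dt G (rho S \<alpha>) t x + divg (\<lambda>y. rho S \<alpha> t y *\<^sub>R vel S t y) x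
               - divg (diff_flux P S \<alpha> t) x - react_rate P S \<alpha> t x) \<and>
        0 = dt G (rho_tot P S) t x + divg (\<lambda>y. rho_tot P S t y *\<^sub>R vel S t y) x \<and>
        0 = deriv W (chi0 S t x) \<and>
        0 = dt G (\<lambda>r y. rho_tot P S r y *\<^sub>R vel S r y) t x
            + div_tensor (\<lambda>y. rho_tot P S t y *\<^sub>R tensor_prod (vel S t y) (vel S t y)) x
            + grad (press0 P S t) x
            - grad (\<lambda>y. deriv W (chi0 S t y) * chi1 S t y) x \<and>
        0 = deriv (deriv W) (chi0 S t x) * chi1 S t x
            + drf_dchi P (\<lambda>\<alpha>. rho S \<alpha> t x) (chi0 S t x) \<and>
        0 = (\<Sum>\<alpha>=1..species P. charge P \<alpha> / mass P \<alpha> * rho S \<alpha> t x))"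

text \<open>\<open>Om G Plus\<close> is the liquid and \<open>Om G Minus\<close> the vapour region. As \<open>h\<close> equals one (liquid)
  for large and zero (vapour) for small values of the phase field, this fixes the sign of the
  phase field on either side. It is required only in the weak sense, so that the unstable state
  \<open>\<chi>\<^sub>0 = 0\<close> is not excluded a priori.\<close>

definition liquid_on_plus_side :: "geometry \<Rightarrow> outer \<Rightarrow> bool" where
  "liquid_on_plus_side G S \<longleftrightarrow> (\<forall>\<sigma>. \<forall>(t, x)\<in>spacetime G \<sigma>. 0 \<le> side_sign \<sigma> * chi0 S t x)"

section \<open>Inner solutions\<close>

text \<open>Inner functions take the arguments time, interface parameter and stretched normal
  coordinate, in this order.\<close>

record inner =
  R0 :: "nat \<Rightarrow> real \<Rightarrow> real^2 \<Rightarrow> real \<Rightarrow> real"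
  R1 :: "nat \<Rightarrow> real \<Rightarrow> real^2 \<Rightarrow> real \<Rightarrow> real"
  V0 :: "real \<Rightarrow> real^2 \<Rightarrow> real \<Rightarrow> real^3"
  X0 :: "real \<Rightarrow> real^2 \<Rightarrow> real \<Rightarrow> real"
  X1 :: "real \<Rightarrow> real^2 \<Rightarrow> real \<Rightarrow> real"
  Phi0 :: "real \<Rightarrow> real^2 \<Rightarrow> real \<Rightarrow> real"
  Phi1 :: "real \<Rightarrow> real^2 \<Rightarrow> real \<Rightarrow> real"

definition Rtot :: "mixture \<Rightarrow> inner \<Rightarrow> real \<Rightarrow> real^2 \<Rightarrow> real \<Rightarrow> real" where
  "Rtot P I t s z = (\<Sum>\<alpha>=1..species P. R0 I \<alpha> t s z)"

definition M0 :: "mixture \<Rightarrow> inner \<Rightarrow> nat \<Rightarrow> real \<Rightarrow> real^2 \<Rightarrow> real \<Rightarrow> real" where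
  "M0 P I \<beta> t s z = mu P \<beta> (\<lambda>\<alpha>. R0 I \<alpha> t s z) (X0 I t s z)"

definition M1 :: "mixture \<Rightarrow> inner \<Rightarrow> nat \<Rightarrow> real \<Rightarrow> real^2 \<Rightarrow> real \<Rightarrow> real" where
  "M1 P I \<beta> t s z =
     (\<Sum>\<alpha>=1..species P. dmu_drho P \<beta> \<alpha> (\<lambda>\<delta>. R0 I \<delta> t s z) (X0 I t s z) * R1 I \<alpha> t s z)
     + dmu_dchi P \<beta> (\<lambda>\<delta>. R0 I \<delta> t s z) (X0 I t s z) * X1 I t s z"

definition RF0 :: "mixture \<Rightarrow> inner \<Rightarrow> real \<Rightarrow> real^2 \<Rightarrow> real \<Rightarrow> real" where
  "RF0 P I t s z = rho_f P (\<lambda>\<alpha>. R0 I \<alpha> t s z) (X0 I t s z)"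

definition J0 :: "mixture \<Rightarrow> geometry \<Rightarrow> inner \<Rightarrow> real \<Rightarrow> real^2 \<Rightarrow> real \<Rightarrow> real" where
  "J0 P G I t s z = Rtot P I t s z * (V0 I t s z \<bullet> normal G t s - normal_velocity G t s)"

definition cont_ts :: "geometry \<Rightarrow> (real \<Rightarrow> real^2 \<Rightarrow> real \<Rightarrow> 'b::topological_space) \<Rightarrow> bool" where
  "cont_ts G f \<longleftrightarrow> (\<forall>z. continuous_on ({0..<tfin G} \<times> pdom G) (\<lambda>(t, s). f t s z))"

definition inner_regular :: "mixture \<Rightarrow> geometry \<Rightarrow> inner \<Rightarrow> bool" where
  "inner_regular P G I \<longleftrightarrow>
     (\<exists>t\<in>{0..<tfin G}. \<exists>s\<in>pdom G. \<exists>z. X0 I t s z \<noteq> 0) \<and>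
     (\<forall>\<alpha>\<in>{1..species P}. cont_ts G (R0 I \<alpha>) \<and> cont_ts G (R1 I \<alpha>)) \<and>
     cont_ts G (V0 I) \<and> cont_ts G (X0 I) \<and> cont_ts G (X1 I) \<and>
     cont_ts G (Phi0 I) \<and> cont_ts G (Phi1 I) \<and>
     (\<forall>t\<in>{0..<tfin G}. \<forall>s\<in>pdom G.
        (\<forall>\<alpha>\<in>{1..species P}.
           (\<forall>z. 0 < R0 I \<alpha> t s z) \<and> C2_real (R0 I \<alpha> t s) \<and> C2_real (R1 I \<alpha> t s)) \<and>
        V0 I t s C1_differentiable_on UNIV \<and>
        C2_real (X0 I t s) \<and> C2_real (X1 I t s) \<and>
        C2_real (Phi0 I t s) \<and> C2_real (Phi1 I t s)) \<and>
     (\<forall>t\<in>{0..<tfin G}. \<forall>z. C1_on (pdom G) (\<lambda>s. X0 I t s z))"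

definition inner_solution :: "mixture \<Rightarrow> geometry \<Rightarrow> inner \<Rightarrow> bool" where
  "inner_solution P G I \<longleftrightarrow> inner_regular P G I \<and>
     (\<forall>t\<in>{0..<tfin G}. \<forall>s\<in>pdom G. \<forall>z.
        (let N = species P; \<nu> = normal G t s; w = normal_velocity G t s;
             \<kappa> = mean_curvature G t s;
             x0 = X0 I t s; x0z = deriv x0; x0zz = deriv x0z;
             x1 = X1 I t s; x1z = deriv x1; x1zz = deriv x1z;
             p0z = deriv (Phi0 I t s); p1z = deriv (Phi1 I t s); p1zz = deriv p1z;
             R = (\<lambda>\<alpha>. R0 I \<alpha> t s z)
         in
          0 = deriv (J0 P G I t s) z \<and>
          0 = deriv (\<lambda>y. (1 + susc P (x0 y)) * p0z y) z \<and>
          (\<forall>\<alpha>\<in>{1..N - 1}.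
             0 = deriv (\<lambda>y. \<Sum>\<beta>=1..N - 1. diff_mob P \<alpha> \<beta> *
                   (deriv (\<lambda>y'. M0 P I \<beta> t s y' - M0 P I N t s y') y + zrel P \<beta> * p0z y)) z) \<and>
          0 = deriv (\<lambda>y. - W (x0 y) + gam P / 2 * (x0z y)^2
                          - eps0 P / 2 * (1 + susc P (x0 y)) * (p0z y)^2) z *\<^sub>R \<nu> \<and>
          0 = deriv W (x0 z) - gam P * x0zz z
              - eps0 P / 2 * deriv (susc P) (x0 z) * (p0z z)^2 \<and>
          0 = J0 P G I t s z *\<^sub>R vector_derivative (V0 I t s) (at z)
              + deriv (\<lambda>y. (\<Sum>\<alpha>=1..N. R0 I \<alpha> t s y * M0 P I \<alpha> t s y) - RF0 P I t s y
                            - deriv W (x0 y) * x1 y) z *\<^sub>R \<nu>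
              + (gam P * (x0z z * x1zz z + x0zz z * x1z z - \<kappa> * (x0z z)^2)) *\<^sub>R \<nu>
              - surf_grad G t (\<lambda>q. W (X0 I t q z)) s
              + (gam P * x0zz z) *\<^sub>R surf_grad G t (\<lambda>q. X0 I t q z) s \<and>
          0 = J0 P G I t s z / tau P * x0z z + deriv (deriv W) (x0 z) * x1 z
              - gam P * x1zz z + gam P * \<kappa> * x0z z + drf_dchi P R (x0 z) \<and>
          (\<forall>\<alpha>\<in>{1..N - 1}.
             0 = deriv (\<lambda>y. R0 I \<alpha> t s y * (V0 I t s y \<bullet> \<nu> - w)) z
                 - (\<Sum>\<beta>=1..N - 1. diff_mob P \<alpha> \<beta> *
                     (deriv (deriv (\<lambda>y. M1 P I \<beta> t s y - M1 P I N t s y)) z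
                      - \<kappa> * deriv (\<lambda>y. M0 P I \<beta> t s y - M0 P I N t s y) z
                      + zrel P \<beta> * p1zz z - \<kappa> * zrel P \<beta> * p0z z))) \<and>
          0 = deriv (\<lambda>y. (1 + susc P (x0 y)) * p1z y) z
              + (\<Sum>\<alpha>=1..N. charge P \<alpha> / mass P \<alpha> * R \<alpha>)))"

section \<open>Matching\<close>

text \<open>The outer fields have one-sided traces, as do the first derivatives entering the matching
  conditions; the partial densities are positive up to the interface.\<close>

definition outer_traces :: "mixture \<Rightarrow> geometry \<Rightarrow> outer \<Rightarrow> bool" where
  "outer_traces P G S \<longleftrightarrow> (\<forall>\<sigma>. \<forall>t\<in>{0..<tfin G}. \<forall>s\<in>pdom G.
     (\<forall>\<alpha>\<in>{1..species P}. has_trace G \<sigma> t s (rho S \<alpha> t) \<and> has_trace G \<sigma> t s (grad (rho S \<alpha> t)) \<and>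
        0 < tr G \<sigma> t s (rho S \<alpha> t)) \<and>
     has_trace G \<sigma> t s (vel S t) \<and>
     has_trace G \<sigma> t s (chi0 S t) \<and> has_trace G \<sigma> t s (grad (chi0 S t)) \<and>
     has_trace G \<sigma> t s (chi1 S t) \<and>
     has_trace G \<sigma> t s (phi0 S t) \<and> has_trace G \<sigma> t s (grad (phi0 S t)))"

definition matching_conditions :: "mixture \<Rightarrow> geometry \<Rightarrow> outer \<Rightarrow> inner \<Rightarrow> bool" where
  "matching_conditions P G S I \<longleftrightarrow> (\<forall>\<sigma>. \<forall>t\<in>{0..<tfin G}. \<forall>s\<in>pdom G.
     (let \<nu> = normal G t s; F = far \<sigma> in
      (\<forall>\<alpha>\<in>{1..species P}. (R0 I \<alpha> t s \<longlongrightarrow> tr G \<sigma> t s (rho S \<alpha> t)) F) \<and>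
      (V0 I t s \<longlongrightarrow> tr G \<sigma> t s (vel S t)) F \<and>
      (X0 I t s \<longlongrightarrow> tr G \<sigma> t s (chi0 S t)) F \<and>
      (Phi0 I t s \<longlongrightarrow> tr G \<sigma> t s (phi0 S t)) F \<and>
      (\<forall>\<alpha>\<in>{1..species P}. (deriv (R0 I \<alpha> t s) \<longlongrightarrow> 0) F) \<and>
      ((\<lambda>z. vector_derivative (V0 I t s) (at z)) \<longlongrightarrow> 0) F \<and>
      (deriv (X0 I t s) \<longlongrightarrow> 0) F \<and>
      (deriv (Phi0 I t s) \<longlongrightarrow> 0) F \<and>
      (\<forall>\<beta>\<in>{1..species P}. (deriv (M0 P I \<beta> t s) \<longlongrightarrow> 0) F) \<and>
      ((\<lambda>z. X1 I t s z - tr G \<sigma> t s (chi1 S t) - z * (tr G \<sigma> t s (grad (chi0 S t)) \<bullet> \<nu>)) \<longlongrightarrow> 0) F \<and>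
      (deriv (X1 I t s) \<longlongrightarrow> tr G \<sigma> t s (grad (chi0 S t)) \<bullet> \<nu>) F \<and>
      (\<forall>\<alpha>\<in>{1..species P}. (deriv (R1 I \<alpha> t s) \<longlongrightarrow> tr G \<sigma> t s (grad (rho S \<alpha> t)) \<bullet> \<nu>) F) \<and>
      (deriv (Phi1 I t s) \<longlongrightarrow> tr G \<sigma> t s (grad (phi0 S t)) \<bullet> \<nu>) F \<and>
      (\<forall>\<beta>\<in>{1..species P}. (deriv (M1 P I \<beta> t s) \<longlongrightarrow> tr G \<sigma> t s (grad (mu0 P S \<beta> t)) \<bullet> \<nu>) F)))"

definition matching_solution :: "mixture \<Rightarrow> geometry \<Rightarrow> outer \<Rightarrow> inner \<Rightarrow> bool" where
  "matching_solution P G S I \<longleftrightarrow>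
     outer_solution P G S \<and> inner_solution P G I \<and> outer_traces P G S \<and> matching_conditions P G S I"

definition mass_flux :: "mixture \<Rightarrow> geometry \<Rightarrow> outer \<Rightarrow> side \<Rightarrow> real \<Rightarrow> real^2 \<Rightarrow> real" where
  "mass_flux P G S \<sigma> t s =
     tr G \<sigma> t s (rho_tot P S t) * (tr G \<sigma> t s (vel S t) \<bullet> normal G t s - normal_velocity G t s)"

end

theory Submission
  imports Defs
begin

text \<open>All jump conditions arise by integrating an inner equation over \<open>z\<close>: its \<open>z\<close>-derivative part
  contributes the difference of the limits at \<open>\<plusminus>\<infinity>\<close>, which matching turns into a jump of outer traces.
  Since \<open>\<Phi>\<^sub>0\<close> is constant in \<open>z\<close>, the energy \<open>\<gamma>/2 X\<^sub>0\<^sub>z\<^sup>2 - W(X\<^sub>0)\<close> is constant, so \<open>\<chi>\<^sub>0\<^sup>+\<close> and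
  \<open>\<chi>\<^sub>0\<^sup>-\<close> have equal double-well energy; both vanishing would force \<open>X\<^sub>0 = 0\<close> at that interface point.
  As \<open>X\<^sub>0\<close> does not vanish identically, \<open>\<chi>\<^sub>0 = \<plusminus>1\<close> somewhere, and continuity of \<open>\<chi>\<^sub>0\<close> spreads this to
  the whole space-time region. With \<open>\<chi>\<^sub>0\<close> constant in the bulk, \<open>\<chi>\<^sub>1 = 0\<close> and the outer chemical
  potentials have one-sided gradient traces by the chain rule. The condition for \<open>\<mu>\<^sub>N\<close> follows from the
  normal momentum balance, the phase-field equation times \<open>X\<^sub>0\<^sub>z\<close>, and the Gibbs-Duhem relation.\<close>

section \<open>Functions of one real variable\<close>

text \<open>\<open>deriv\<close>, \<open>Lim\<close> and \<open>integral\<close> are total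
  functions, so an equation written with them says something only where the derivative, trace or
  integral really exists; supplying this existence shapes most of the proof. \<open>mu\<close> is
  itself a \<open>deriv\<close>, and the first-order species equation differentiates
  \<open>M1\<close>, which is built from derivatives of \<open>mu\<close>, twice more. The way
  through is a closed formula for the potentials on positive compositions together with
  \<open>twice_diff\<close>: existence of two derivatives, without continuity of the second, which
  is stable under arithmetic and composition. As the formula needs positivity, limits are taken
  where the limiting densities are positive as well. Integrability of the squared profile slope is
  derived from the profile equation, using neither monotonicity of the profile nor an explicit
  solution; the charge integral exists because an antiderivative converges at both ends. The outer
  gradients live only in the open bulk, so tangential derivatives of traces are compared along
  curves pushed off the interface.\<close>

definition twice_diff :: "(real \<Rightarrow> real) \<Rightarrow> bool" where
  "twice_diff f \<longleftrightarrow> (\<forall>z. f differentiable at z) \<and> (\<forall>z. deriv f differentiable at z)"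

lemma twice_diffI:
  assumes "\<And>z. (f has_real_derivative f' z) (at z)" and "\<And>z. f' differentiable at z"
  shows "twice_diff f"
proof -
  have "deriv f = f'"
    using assms(1) by (auto intro: DERIV_imp_deriv)
  then show ?thesis
    using assms by (auto simp: twice_diff_def real_differentiable_def)
qed

lemma twice_diffD:
  assumes "twice_diff f"
  shows "(f has_real_derivative deriv f z) (at z)"
    and "(deriv f has_real_derivative deriv (deriv f) z) (at z)"
    and "f differentiable at z" and "deriv f differentiable at z"
  using assms by (auto simp: twice_diff_def DERIV_deriv_iff_real_differentiable)

lemma twice_diff_const [simp]: "twice_diff (\<lambda>z. c)"
  by (rule twice_diffI[where f' = "\<lambda>z. 0"]) auto

lemma twice_diff_add:
  assumes "twice_diff f" "twice_diff g"
  shows "twice_diff (\<lambda>z. f z + g z)"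
  by (rule twice_diffI[where f' = "\<lambda>z. deriv f z + deriv g z"])
     (use assms in \<open>auto intro!: DERIV_add differentiable_add dest: twice_diffD\<close>)

lemma twice_diff_mult:
  assumes "twice_diff f" "twice_diff g"
  shows "twice_diff (\<lambda>z. f z * g z)"
  by (rule twice_diffI[where f' = "\<lambda>z. deriv f z * g z + deriv g z * f z"])
     (use assms in \<open>auto intro!: DERIV_mult differentiable_add differentiable_mult intro: twice_diffD\<close>)

lemma twice_diff_diff:
  assumes "twice_diff f" "twice_diff g"
  shows "twice_diff (\<lambda>z. f z - g z)"
  using twice_diff_add[OF assms(1) twice_diff_mult[OF twice_diff_const[of "-1"] assms(2)]] by simp

lemma twice_diff_sum:
  assumes "\<And>a. a \<in> A \<Longrightarrow> twice_diff (f a)"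
  shows "twice_diff (\<lambda>z. \<Sum>a\<in>A. f a z)"
  using assms by (induction A rule: infinite_finite_induct) (auto intro: twice_diff_add)

lemma twice_diff_compose:
  assumes "twice_diff g" "twice_diff f"
  shows "twice_diff (\<lambda>z. g (f z))"
proof (rule twice_diffI[where f' = "\<lambda>z. deriv g (f z) * deriv f z"])
  fix z
  show "((\<lambda>z. g (f z)) has_real_derivative deriv g (f z) * deriv f z) (at z)"
    using DERIV_chain2 assms twice_diffD(1) by blast
  have "(\<lambda>z. deriv g (f z)) differentiable at z"
    using DERIV_chain2[OF twice_diffD(2)[OF assms(1)] twice_diffD(1)[OF assms(2)], of z]
    by (auto simp: real_differentiable_def)
  then show "(\<lambda>z. deriv g (f z) * deriv f z) differentiable at z"
    using assms by (auto intro!: differentiable_mult intro: twice_diffD)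
qed

lemma twice_diff_inverse:
  assumes f: "twice_diff f" and pos: "\<And>z. 0 < f z"
  shows "twice_diff (\<lambda>z. inverse (f z))"
proof (rule twice_diffI[where f' = "\<lambda>z. - (inverse (f z) * deriv f z * inverse (f z))"])
  fix z
  have [simp]: "f z \<noteq> 0" using pos[of z] by simp
  show D: "((\<lambda>z. inverse (f z)) has_real_derivative - (inverse (f z) * deriv f z * inverse (f z))) (at z)"
    using DERIV_inverse'[OF twice_diffD(1)[OF f]] by simp
  then have "(\<lambda>z. inverse (f z)) differentiable at z"
    by (auto simp: real_differentiable_def)
  then show "(\<lambda>z. - (inverse (f z) * deriv f z * inverse (f z))) differentiable at z"
    using f by (auto intro!: differentiable_mult differentiable_minus intro: twice_diffD)
qed

lemma twice_diff_divide:
  assumes "twice_diff f" "twice_diff g" "\<And>z. 0 < g z"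
  shows "twice_diff (\<lambda>z. f z / g z)"
  using twice_diff_mult[OF assms(1) twice_diff_inverse[OF assms(2,3)]] by (simp add: divide_inverse)

lemma twice_diff_ln:
  assumes f: "twice_diff f" and pos: "\<And>z. 0 < f z"
  shows "twice_diff (\<lambda>z. ln (f z))"
proof (rule twice_diffI[where f' = "\<lambda>z. inverse (f z) * deriv f z"])
  fix z
  show "((\<lambda>z. ln (f z)) has_real_derivative inverse (f z) * deriv f z) (at z)"
    using DERIV_chain2[OF DERIV_ln[OF pos] twice_diffD(1)[OF f]] .
  show "(\<lambda>z. inverse (f z) * deriv f z) differentiable at z"
    using f pos by (auto intro!: differentiable_mult intro: twice_diffD twice_diff_inverse)
qed

lemma C2_real_twice_diff:
  assumes "C2_real f"
  shows "twice_diff f"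
  using assms by (auto simp: C2_real_def C1_differentiable_on_eq twice_diff_def)

text \<open>The second part reaches the third derivative of \<open>h\<close>:
  \<open>dmu_dchi\<close> contains \<open>h'\<close>, and it enters \<open>M1\<close>, which has to
  be differentiated twice.\<close>

lemma smooth_real_twice_diff:
  assumes "smooth_real f"
  shows "twice_diff f" and "twice_diff (deriv f)"
proof -
  have D: "((deriv ^^ n) f) differentiable at x" for n x
    using assms unfolding smooth_real_def
    by (auto simp: field_differentiable_def real_differentiable_def)
  show "twice_diff f"
    using D[of 0] D[of 1] by (simp add: twice_diff_def)
  show "twice_diff (deriv f)"
    using D[of 1] D[of 2] by (simp add: twice_diff_def eval_nat_numeral)
qed

text \<open>The form in which first integrals are used: evaluated at one point and with both ends of
  the real line as \<open>F\<close>, it identifies the two limits of \<open>f\<close>, so a jump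
  vanishes.\<close>

lemma deriv_zero_imp_limit:
  fixes f :: "real \<Rightarrow> real"
  assumes "\<And>z. f differentiable at z" and "\<And>z. deriv f z = 0"
    and "(f \<longlongrightarrow> L) F" "F \<noteq> bot"
  shows "f z = L"
proof -
  have "f y = f z" for y
    by (rule DERIV_isconst_all) (use assms(1,2) DERIV_deriv_iff_real_differentiable in metis)
  then have "(f \<longlongrightarrow> f z) F"
    by (intro tendsto_eventually always_eventually) blast
  then show ?thesis
    using assms(3,4) tendsto_unique by blast
qed

text \<open>An improper fundamental theorem for the gauge integral. Convergence of \<open>F\<close>
  at both ends is enough; \<open>f\<close> need not be absolutely integrable and may be
  vector-valued, as the momentum balance requires.\<close>

lemma has_integral_UNIV_antiderivative:
  fixes F :: "real \<Rightarrow> 'a::banach"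
  assumes D: "\<And>x. (F has_vector_derivative f x) (at x)"
    and A: "(F \<longlongrightarrow> A) at_top" and B: "(F \<longlongrightarrow> B) at_bot"
  shows "(f has_integral (A - B)) UNIV"
  unfolding has_integral'[of f "A - B" UNIV]
proof (intro allI impI)
  fix e :: real assume e: "0 < e"
  obtain u where u: "\<And>b. b \<ge> u \<Longrightarrow> dist (F b) A < e / 2"
    using tendstoD[OF A, of "e/2"] e by (auto simp: eventually_at_top_linorder)
  obtain l where l: "\<And>a. a \<le> l \<Longrightarrow> dist (F a) B < e / 2"
    using tendstoD[OF B, of "e/2"] e by (auto simp: eventually_at_bot_linorder)
  \<comment> \<open>One is added because the ball is open: any interval containing it then reaches
    both \<open>max \<bar>u\<bar> \<bar>l\<bar>\<close> and its negative, hence passes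
    \<open>u\<close> and \<open>l\<close>.\<close>
  define R where "R = max 1 (max \<bar>u\<bar> \<bar>l\<bar> + 1)"
  show "\<exists>R>0. \<forall>a b. ball 0 R \<subseteq> cbox a b \<longrightarrow>
      (\<exists>z. ((\<lambda>x. if x \<in> UNIV then f x else 0) has_integral z) (cbox a b) \<and> norm (z - (A - B)) < e)"
  proof (intro exI[of _ R] conjI allI impI)
    fix a b :: real assume sub: "ball 0 R \<subseteq> cbox a b"
    have "max \<bar>u\<bar> \<bar>l\<bar> \<in> ball 0 R" "- max \<bar>u\<bar> \<bar>l\<bar> \<in> ball 0 R"
      by (auto simp: R_def)
    then have "a \<le> - max \<bar>u\<bar> \<bar>l\<bar>" "max \<bar>u\<bar> \<bar>l\<bar> \<le> b"
      using sub by (auto simp: subset_eq)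
    then have ab: "a \<le> l" "u \<le> b" "a \<le> b"
      by linarith+
    have "(f has_integral (F b - F a)) {a..b}"
      by (rule fundamental_theorem_of_calculus[OF ab(3)])
         (use D has_vector_derivative_at_within in blast)
    moreover have "norm ((F b - F a) - (A - B)) < e"
      using norm_triangle_ineq4[of "F b - A" "F a - B"] l[OF ab(1)] u[OF ab(2)]
      by (simp add: dist_norm algebra_simps)
    ultimately show "\<exists>z. ((\<lambda>x. if x \<in> UNIV then f x else 0) has_integral z) (cbox a b) \<and> norm (z - (A - B)) < e"
      by auto
  qed (simp add: R_def)
qed

section \<open>The chemical potentials\<close>

definition num_density :: "mixture \<Rightarrow> (nat \<Rightarrow> real) \<Rightarrow> real" where
  "num_density P \<rho> = (\<Sum>\<alpha>=1..species P. \<rho> \<alpha> / mass P \<alpha>)"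

text \<open>The partial derivative of \<open>rho_psi P K\<close> with respect to the density of
  constituent \<open>\<alpha>\<close>, with the factor \<open>1 / mass P \<alpha>\<close> of the
  inner derivative pulled out.\<close>

definition chem_pot :: "mixture \<Rightarrow> real \<Rightarrow> nat \<Rightarrow> (nat \<Rightarrow> real) \<Rightarrow> real" where
  "chem_pot P K \<alpha> \<rho> = psi_ref P \<alpha>
     + ((p_ref P - K) / n_ref P + K / n_ref P * (ln (num_density P \<rho> / n_ref P) + 1)
        + boltz P * temp P * ln (\<rho> \<alpha> / mass P \<alpha> / num_density P \<rho>)) / mass P \<alpha>"

text \<open>The Hessian entry of \<open>rho_psi P K\<close>: a rank-one part coming from the total
  number density and a diagonal part coming from the mixing entropy.\<close>

definition chem_pot_deriv :: "mixture \<Rightarrow> real \<Rightarrow> nat \<Rightarrow> nat \<Rightarrow> (nat \<Rightarrow> real) \<Rightarrow> real" where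
  "chem_pot_deriv P K \<beta> \<alpha> \<rho> =
     (K / n_ref P / mass P \<alpha> / num_density P \<rho>
      + boltz P * temp P * ((if \<alpha> = \<beta> then 1 / \<rho> \<alpha> else 0) - 1 / mass P \<alpha> / num_density P \<rho>)) / mass P \<beta>"

lemma num_density_pos:
  assumes "admissible P" "\<And>\<alpha>. \<alpha> \<in> {1..species P} \<Longrightarrow> 0 < \<rho> \<alpha>"
  shows "0 < num_density P \<rho>"
  unfolding num_density_def using assms by (intro sum_pos) (auto simp: admissible_def)

lemma num_density_has_derivative:
  assumes "\<And>\<alpha>. \<alpha> \<in> {1..species P} \<Longrightarrow> (r \<alpha> has_derivative r' \<alpha>) (at x)"
  shows "((\<lambda>y. num_density P (\<lambda>\<alpha>. r \<alpha> y)) has_derivative (\<lambda>h. num_density P (\<lambda>\<alpha>. r' \<alpha> h))) (at x)"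
  unfolding num_density_def divide_inverse
  by (intro has_derivative_sum has_derivative_mult_left assms)

text \<open>The densities are functions on an arbitrary normed space. The partial derivatives behind
  \<open>mu\<close> and the derivative along the inner coordinate are both instances; the analogous
  rule for \<open>chem_pot\<close> also yields the bulk gradients.\<close>

lemma rho_psi_has_derivative:
  assumes adm: "admissible P"
    and r: "\<And>\<alpha>. \<alpha> \<in> {1..species P} \<Longrightarrow> (r \<alpha> has_derivative r' \<alpha>) (at x)"
    and pos: "\<And>\<alpha>. \<alpha> \<in> {1..species P} \<Longrightarrow> 0 < r \<alpha> x"
  shows "((\<lambda>y. rho_psi P K (\<lambda>\<alpha>. r \<alpha> y)) has_derivative
    (\<lambda>h. \<Sum>\<alpha>=1..species P. chem_pot P K \<alpha> (\<lambda>\<alpha>. r \<alpha> x) * r' \<alpha> h)) (at x)"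
proof -
  let ?A = "{1..species P}"
  define n where "n = (\<lambda>y. num_density P (\<lambda>\<alpha>. r \<alpha> y))"
  define n' where "n' = (\<lambda>h. num_density P (\<lambda>\<alpha>. r' \<alpha> h))"
  have n: "(n has_derivative n') (at x)"
    unfolding n_def n'_def by (rule num_density_has_derivative[OF r])
  have npos: "0 < n x"
    unfolding n_def using num_density_pos[OF adm, of "\<lambda>\<alpha>. r \<alpha> x"] pos by simp
  have nx [simp]: "num_density P (\<lambda>\<alpha>. r \<alpha> x) = n x"
    by (simp add: n_def)
  have m: "0 < mass P \<alpha>" if "\<alpha> \<in> ?A" for \<alpha>
    using adm that by (auto simp: admissible_def)
  have nr: "0 < n_ref P" using adm by (simp add: admissible_def)
  have eq: "rho_psi P K (\<lambda>\<alpha>. r \<alpha> y) = (\<Sum>\<alpha>\<in>?A. r \<alpha> y * psi_ref P \<alpha>)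
        + (K - p_ref P) * (1 - n y / n_ref P) + K * (n y / n_ref P) * ln (n y / n_ref P)
        + boltz P * temp P * (\<Sum>\<alpha>\<in>?A. r \<alpha> y / mass P \<alpha> * ln (r \<alpha> y / mass P \<alpha> / n y))" for y
    by (simp add: rho_psi_def Let_def n_def num_density_def)
  have d1: "((\<lambda>y. \<Sum>\<alpha>\<in>?A. r \<alpha> y * psi_ref P \<alpha>) has_derivative (\<lambda>h. \<Sum>\<alpha>\<in>?A. r' \<alpha> h * psi_ref P \<alpha>)) (at x)"
    by (intro has_derivative_sum has_derivative_mult_left r)
  have d2: "((\<lambda>y. (K - p_ref P) * (1 - n y / n_ref P)) has_derivative
      (\<lambda>h. (p_ref P - K) / n_ref P * n' h)) (at x)"
    by (auto intro!: derivative_eq_intros n ext simp: field_simps nr[THEN less_imp_neq, symmetric])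
  have d3: "((\<lambda>y. K * (n y / n_ref P) * ln (n y / n_ref P)) has_derivative
      (\<lambda>h. K / n_ref P * (ln (n x / n_ref P) + 1) * n' h)) (at x)"
    using npos nr by (auto intro!: derivative_eq_intros n ext simp: field_simps)
  have d4: "((\<lambda>y. r \<alpha> y / mass P \<alpha> * ln (r \<alpha> y / mass P \<alpha> / n y)) has_derivative
      (\<lambda>h. r' \<alpha> h / mass P \<alpha> * ln (r \<alpha> x / mass P \<alpha> / n x)
         + (r' \<alpha> h / mass P \<alpha> - r \<alpha> x / mass P \<alpha> * (n' h / n x)))) (at x)" if a: "\<alpha> \<in> ?A" for \<alpha>
  proof -
    have "((\<lambda>y. r \<alpha> y / mass P \<alpha>) has_derivative (\<lambda>h. r' \<alpha> h / mass P \<alpha>)) (at x)"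
      using has_derivative_mult_left[OF r[OF a], of "inverse (mass P \<alpha>)"] by (simp add: divide_inverse)
    moreover have "((\<lambda>y. ln (r \<alpha> y / mass P \<alpha> / n y)) has_derivative
        (\<lambda>h. r' \<alpha> h / r \<alpha> x - n' h / n x)) (at x)"
      using npos pos[OF a] m[OF a]
      by (auto intro!: derivative_eq_intros n r[OF a] ext simp: field_simps)
    ultimately show ?thesis
      by (rule has_derivative_eq_rhs[OF has_derivative_mult])
         (use npos pos[OF a] m[OF a] in \<open>auto simp: field_simps\<close>)
  qed
  have "((\<lambda>y. rho_psi P K (\<lambda>\<alpha>. r \<alpha> y)) has_derivative
      (\<lambda>h. (\<Sum>\<alpha>\<in>?A. r' \<alpha> h * psi_ref P \<alpha>) + (p_ref P - K) / n_ref P * n' h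
        + K / n_ref P * (ln (n x / n_ref P) + 1) * n' h
        + boltz P * temp P * (\<Sum>\<alpha>\<in>?A. r' \<alpha> h / mass P \<alpha> * ln (r \<alpha> x / mass P \<alpha> / n x)
         + (r' \<alpha> h / mass P \<alpha> - r \<alpha> x / mass P \<alpha> * (n' h / n x))))) (at x)"
    unfolding eq by (intro has_derivative_add d1 d2 d3 has_derivative_mult_right has_derivative_sum d4)
  moreover have "(\<Sum>\<alpha>\<in>?A. r' \<alpha> h * psi_ref P \<alpha>) + (p_ref P - K) / n_ref P * n' h
        + K / n_ref P * (ln (n x / n_ref P) + 1) * n' h
        + boltz P * temp P * (\<Sum>\<alpha>\<in>?A. r' \<alpha> h / mass P \<alpha> * ln (r \<alpha> x / mass P \<alpha> / n x)
         + (r' \<alpha> h / mass P \<alpha> - r \<alpha> x / mass P \<alpha> * (n' h / n x)))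
     = (\<Sum>\<alpha>\<in>?A. chem_pot P K \<alpha> (\<lambda>\<alpha>. r \<alpha> x) * r' \<alpha> h)" for h
  proof -
    have n's: "n' h = (\<Sum>\<alpha>\<in>?A. r' \<alpha> h / mass P \<alpha>)" by (simp add: n'_def num_density_def)
    \<comment> \<open>Differentiating the mixing entropy leaves, besides the logarithms, the sum of
      \<open>n_a' - (n_a / n) n'\<close>. It vanishes because the number densities
      \<open>n_a\<close> add up to \<open>n\<close>.\<close>
    have "(\<Sum>\<alpha>\<in>?A. r \<alpha> x / mass P \<alpha> * (n' h / n x)) = n' h"
      unfolding sum_distrib_right[symmetric] using npos by (simp add: n_def num_density_def)
    then have "(\<Sum>\<alpha>\<in>?A. r' \<alpha> h / mass P \<alpha> - r \<alpha> x / mass P \<alpha> * (n' h / n x)) = 0"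
      by (simp add: sum_subtractf n's)
    then show ?thesis
      unfolding sum.distrib n's sum_distrib_left
      by (simp add: sum_distrib_left sum.distrib[symmetric] chem_pot_def)
         (simp add: divide_inverse algebra_simps)
  qed
  ultimately show ?thesis by simp
qed

lemma chem_pot_has_derivative:
  assumes adm: "admissible P"
    and r: "\<And>\<alpha>. \<alpha> \<in> {1..species P} \<Longrightarrow> (r \<alpha> has_derivative r' \<alpha>) (at x)"
    and pos: "\<And>\<alpha>. \<alpha> \<in> {1..species P} \<Longrightarrow> 0 < r \<alpha> x"
    and b: "\<beta> \<in> {1..species P}"
  shows "((\<lambda>y. chem_pot P K \<beta> (\<lambda>\<alpha>. r \<alpha> y)) has_derivative
    (\<lambda>h. \<Sum>\<alpha>=1..species P. chem_pot_deriv P K \<beta> \<alpha> (\<lambda>\<alpha>. r \<alpha> x) * r' \<alpha> h)) (at x)"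
proof -
  let ?A = "{1..species P}"
  define n where "n = (\<lambda>y. num_density P (\<lambda>\<alpha>. r \<alpha> y))"
  define n' where "n' = (\<lambda>h. num_density P (\<lambda>\<alpha>. r' \<alpha> h))"
  have n: "(n has_derivative n') (at x)"
    unfolding n_def n'_def by (rule num_density_has_derivative[OF r])
  have npos: "0 < n x"
    unfolding n_def using num_density_pos[OF adm, of "\<lambda>\<alpha>. r \<alpha> x"] pos by simp
  have nx [simp]: "num_density P (\<lambda>\<alpha>. r \<alpha> x) = n x"
    by (simp add: n_def)
  have m: "0 < mass P \<alpha>" if "\<alpha> \<in> ?A" for \<alpha>
    using adm that by (auto simp: admissible_def)
  have nr: "0 < n_ref P" using adm by (simp add: admissible_def)
  have "((\<lambda>y. ln (n y / n_ref P) + 1) has_derivative (\<lambda>h. n' h / n x)) (at x)"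
    using npos nr by (auto intro!: derivative_eq_intros n ext simp: field_simps)
  moreover have "((\<lambda>y. ln (r \<beta> y / mass P \<beta> / n y)) has_derivative
      (\<lambda>h. r' \<beta> h / r \<beta> x - n' h / n x)) (at x)"
    using npos pos[OF b] m[OF b]
    by (auto intro!: derivative_eq_intros n r[OF b] ext simp: field_simps)
  ultimately have "((\<lambda>y. (((p_ref P - K) / n_ref P + K / n_ref P * (ln (n y / n_ref P) + 1)
        + boltz P * temp P * ln (r \<beta> y / mass P \<beta> / n y)) * inverse (mass P \<beta>)) + psi_ref P \<beta>) has_derivative
      (\<lambda>h. ((0 + K / n_ref P * (n' h / n x)
        + boltz P * temp P * (r' \<beta> h / r \<beta> x - n' h / n x)) * inverse (mass P \<beta>)) + 0)) (at x)"
    by (intro has_derivative_add has_derivative_mult_left has_derivative_mult_right has_derivative_const)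
  moreover have "(0 + K / n_ref P * (n' h / n x)
        + boltz P * temp P * (r' \<beta> h / r \<beta> x - n' h / n x)) * inverse (mass P \<beta>) + 0
     = (\<Sum>\<alpha>\<in>?A. chem_pot_deriv P K \<beta> \<alpha> (\<lambda>\<alpha>. r \<alpha> x) * r' \<alpha> h)" for h
  proof -
    have n's: "(\<Sum>\<alpha>\<in>?A. 1 / mass P \<alpha> * r' \<alpha> h) = n' h" by (simp add: n'_def num_density_def)
    have "(\<Sum>\<alpha>\<in>?A. chem_pot_deriv P K \<beta> \<alpha> (\<lambda>\<alpha>. r \<alpha> x) * r' \<alpha> h)
      = (\<Sum>\<alpha>\<in>?A. (K / n_ref P - boltz P * temp P) / n x / mass P \<beta> * (1 / mass P \<alpha> * r' \<alpha> h)
           + (if \<alpha> = \<beta> then boltz P * temp P / mass P \<beta> * (r' \<alpha> h / r \<alpha> x) else 0))"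
      by (rule sum.cong) (auto simp: chem_pot_deriv_def divide_inverse algebra_simps)
    also have "\<dots> = (K / n_ref P - boltz P * temp P) / n x / mass P \<beta> * n' h
           + boltz P * temp P / mass P \<beta> * (r' \<beta> h / r \<beta> x)"
      unfolding sum.distrib sum_distrib_left[symmetric] n's using b by simp
    finally show ?thesis by (simp add: divide_inverse algebra_simps)
  qed
  moreover have "chem_pot P K \<beta> (\<lambda>\<alpha>. r \<alpha> y) = ((p_ref P - K) / n_ref P + K / n_ref P * (ln (n y / n_ref P) + 1)
        + boltz P * temp P * ln (r \<beta> y / mass P \<beta> / n y)) * inverse (mass P \<beta>) + psi_ref P \<beta>" for y
    by (simp add: chem_pot_def n_def divide_inverse[of _ "mass P \<beta>"])
  ultimately show ?thesis
    by (simp only:)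
qed

lemma interp_has_derivative:
  assumes "admissible P"
  shows "(interp P has_real_derivative deriv (interp P) c) (at c)"
  using assms smooth_real_twice_diff(1)[of "interp P"] by (auto simp: admissible_def intro: twice_diffD)

lemma fun_upd_has_derivative:
  "((\<lambda>y. (\<rho>(\<alpha> := y)) \<beta>) has_derivative (\<lambda>h. if \<beta> = \<alpha> then h else 0)) (at x)"
  for \<rho> :: "nat \<Rightarrow> real"
  by (cases "\<beta> = \<alpha>") auto

lemma rho_psi_partial:
  assumes adm: "admissible P" and pos: "\<And>\<beta>. \<beta> \<in> {1..species P} \<Longrightarrow> 0 < \<rho> \<beta>"
    and a: "\<alpha> \<in> {1..species P}"
  shows "((\<lambda>y. rho_psi P K (\<rho>(\<alpha> := y))) has_real_derivative chem_pot P K \<alpha> \<rho>) (at (\<rho> \<alpha>))"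
proof -
  have "(\<Sum>\<beta>=1..species P. chem_pot P K \<beta> \<rho> * (if \<beta> = \<alpha> then h else 0)) = chem_pot P K \<alpha> \<rho> * h" for h
    using a by (simp add: if_distrib[of "\<lambda>x. _ * x"] cong: if_cong)
  then show ?thesis
    using rho_psi_has_derivative[OF adm, of "\<lambda>\<beta> y. (\<rho>(\<alpha> := y)) \<beta>" "\<lambda>\<beta> h. if \<beta> = \<alpha> then h else 0" "\<rho> \<alpha>" K,
        OF fun_upd_has_derivative] pos
    by (simp add: has_field_derivative_def) (simp add: fun_upd_def)
qed

lemma chem_pot_partial:
  assumes adm: "admissible P" and pos: "\<And>\<beta>. \<beta> \<in> {1..species P} \<Longrightarrow> 0 < \<rho> \<beta>"
    and a: "\<alpha> \<in> {1..species P}" and b: "\<beta> \<in> {1..species P}"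
  shows "((\<lambda>y. chem_pot P K \<beta> (\<rho>(\<alpha> := y))) has_real_derivative chem_pot_deriv P K \<beta> \<alpha> \<rho>) (at (\<rho> \<alpha>))"
proof -
  have "(\<Sum>\<delta>=1..species P. chem_pot_deriv P K \<beta> \<delta> \<rho> * (if \<delta> = \<alpha> then h else 0)) = chem_pot_deriv P K \<beta> \<alpha> \<rho> * h" for h
    using a by (simp add: if_distrib[of "\<lambda>x. _ * x"] cong: if_cong)
  then show ?thesis
    using chem_pot_has_derivative[OF adm, of "\<lambda>\<beta> y. (\<rho>(\<alpha> := y)) \<beta>" "\<lambda>\<beta> h. if \<beta> = \<alpha> then h else 0" "\<rho> \<alpha>" \<beta> K,
        OF fun_upd_has_derivative] pos b
    by (simp add: has_field_derivative_def) (simp add: fun_upd_def)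
qed

lemma mu_eq:
  assumes adm: "admissible P" and pos: "\<And>\<beta>. \<beta> \<in> {1..species P} \<Longrightarrow> 0 < \<rho> \<beta>"
    and a: "\<alpha> \<in> {1..species P}"
  shows "mu P \<alpha> \<rho> c = interp P c * chem_pot P (bulkL P) \<alpha> \<rho> + (1 - interp P c) * chem_pot P (bulkV P) \<alpha> \<rho>"
  unfolding mu_def rho_f_def
  by (intro DERIV_imp_deriv DERIV_add DERIV_cmult rho_psi_partial assms)

text \<open>The closed form of \<open>mu\<close> holds only at positive compositions. The derivative
  is therefore computed on the open half-line of positive \<open>y\<close>, which contains
  \<open>\<rho> \<alpha>\<close>.\<close>

lemma dmu_drho_eq:
  assumes adm: "admissible P" and pos: "\<And>\<beta>. \<beta> \<in> {1..species P} \<Longrightarrow> 0 < \<rho> \<beta>"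
    and a: "\<alpha> \<in> {1..species P}" and b: "\<beta> \<in> {1..species P}"
  shows "dmu_drho P \<beta> \<alpha> \<rho> c =
    interp P c * chem_pot_deriv P (bulkL P) \<beta> \<alpha> \<rho> + (1 - interp P c) * chem_pot_deriv P (bulkV P) \<beta> \<alpha> \<rho>"
  unfolding dmu_drho_def
proof (intro DERIV_imp_deriv)
  show "((\<lambda>y. mu P \<beta> (\<rho>(\<alpha> := y)) c) has_real_derivative
     interp P c * chem_pot_deriv P (bulkL P) \<beta> \<alpha> \<rho> + (1 - interp P c) * chem_pot_deriv P (bulkV P) \<beta> \<alpha> \<rho>) (at (\<rho> \<alpha>))"
  proof (rule has_field_derivative_transform_within_open)
    show "((\<lambda>y. interp P c * chem_pot P (bulkL P) \<beta> (\<rho>(\<alpha> := y)) + (1 - interp P c) * chem_pot P (bulkV P) \<beta> (\<rho>(\<alpha> := y)))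
       has_real_derivative
       interp P c * chem_pot_deriv P (bulkL P) \<beta> \<alpha> \<rho> + (1 - interp P c) * chem_pot_deriv P (bulkV P) \<beta> \<alpha> \<rho>) (at (\<rho> \<alpha>))"
      by (intro DERIV_add DERIV_cmult chem_pot_partial assms)
  next
    fix y :: real assume "y \<in> {0<..}"
    then have "\<delta> \<in> {1..species P} \<Longrightarrow> 0 < (\<rho>(\<alpha> := y)) \<delta>" for \<delta>
      using pos by auto
    from mu_eq[of P "\<rho>(\<alpha> := y)", OF adm this b]
    show "interp P c * chem_pot P (bulkL P) \<beta> (\<rho>(\<alpha> := y)) + (1 - interp P c) * chem_pot P (bulkV P) \<beta> (\<rho>(\<alpha> := y))
       = mu P \<beta> (\<rho>(\<alpha> := y)) c" by simp
  qed (use pos a in auto)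
qed

lemma dmu_dchi_eq:
  assumes adm: "admissible P" and pos: "\<And>\<beta>. \<beta> \<in> {1..species P} \<Longrightarrow> 0 < \<rho> \<beta>"
    and b: "\<beta> \<in> {1..species P}"
  shows "dmu_dchi P \<beta> \<rho> c = deriv (interp P) c * (chem_pot P (bulkL P) \<beta> \<rho> - chem_pot P (bulkV P) \<beta> \<rho>)"
proof -
  have eq: "mu P \<beta> \<rho> c = interp P c * chem_pot P (bulkL P) \<beta> \<rho> + (1 - interp P c) * chem_pot P (bulkV P) \<beta> \<rho>" for c
    by (rule mu_eq[OF adm pos b])
  show ?thesis
    unfolding dmu_dchi_def eq
    by (rule DERIV_imp_deriv)
       (auto intro!: derivative_eq_intros interp_has_derivative[OF adm] simp: algebra_simps)
qed

text \<open>The factor \<open>h'\<close> is what matters: it vanishes at the pure phases, so the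
  free energy exerts no force on the phase field there.\<close>

lemma drf_dchi_eq:
  assumes adm: "admissible P"
  shows "drf_dchi P \<rho> c = deriv (interp P) c * (rho_psi P (bulkL P) \<rho> - rho_psi P (bulkV P) \<rho>)"
  unfolding drf_dchi_def rho_f_def
  by (rule DERIV_imp_deriv)
     (auto intro!: derivative_eq_intros interp_has_derivative[OF adm] simp: algebra_simps)

text \<open>The chain rule behind the Gibbs-Duhem relation: the sum over \<open>mu\<close> times
  \<open>r'\<close> will cancel against half of the product rule for the sum of density times
  potential.\<close>

lemma rho_f_curve_derivative:
  assumes adm: "admissible P"
    and r: "\<And>\<alpha>. \<alpha> \<in> {1..species P} \<Longrightarrow> (r \<alpha> has_real_derivative r' \<alpha>) (at z)"
    and pos: "\<And>\<alpha>. \<alpha> \<in> {1..species P} \<Longrightarrow> 0 < r \<alpha> z"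
    and x: "(x has_real_derivative x') (at z)"
  shows "((\<lambda>y. rho_f P (\<lambda>\<alpha>. r \<alpha> y) (x y)) has_real_derivative
    (\<Sum>\<alpha>=1..species P. mu P \<alpha> (\<lambda>\<alpha>. r \<alpha> z) (x z) * r' \<alpha>) + drf_dchi P (\<lambda>\<alpha>. r \<alpha> z) (x z) * x') (at z)"
proof -
  have *: "((\<lambda>y. rho_psi P K (\<lambda>\<alpha>. r \<alpha> y)) has_real_derivative
      (\<Sum>\<alpha>=1..species P. chem_pot P K \<alpha> (\<lambda>\<alpha>. r \<alpha> z) * r' \<alpha>)) (at z)" for K
    unfolding has_field_derivative_def
    by (rule has_derivative_eq_rhs[OF rho_psi_has_derivative[OF adm, where r' = "\<lambda>\<alpha> h. r' \<alpha> * h"]])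
       (use r pos in \<open>auto simp: has_field_derivative_def sum_distrib_right mult.assoc\<close>)
  have i: "((\<lambda>y. interp P (x y)) has_real_derivative deriv (interp P) (x z) * x') (at z)"
    by (rule DERIV_chain2[OF interp_has_derivative[OF adm] x])
  have "(\<Sum>\<alpha>=1..species P. mu P \<alpha> (\<lambda>\<alpha>. r \<alpha> z) (x z) * r' \<alpha>)
     = interp P (x z) * (\<Sum>\<alpha>=1..species P. chem_pot P (bulkL P) \<alpha> (\<lambda>\<alpha>. r \<alpha> z) * r' \<alpha>)
     + (1 - interp P (x z)) * (\<Sum>\<alpha>=1..species P. chem_pot P (bulkV P) \<alpha> (\<lambda>\<alpha>. r \<alpha> z) * r' \<alpha>)"
    unfolding sum_distrib_left sum.distrib[symmetric]
    by (rule sum.cong[OF refl], subst mu_eq[OF adm pos]) (assumption | simp add: algebra_simps)+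
  then show ?thesis
    unfolding rho_f_def drf_dchi_eq[OF adm]
    by (auto intro!: derivative_eq_intros i * simp: algebra_simps)
qed

section \<open>Regularity of the potentials along inner profiles\<close>

lemma twice_diff_num_density:
  assumes "\<And>\<alpha>. \<alpha> \<in> {1..species P} \<Longrightarrow> twice_diff (r \<alpha>)"
  shows "twice_diff (\<lambda>z. num_density P (\<lambda>\<alpha>. r \<alpha> z))"
  unfolding num_density_def divide_inverse
  by (intro twice_diff_sum twice_diff_mult twice_diff_const assms)

lemma twice_diff_chem_pot:
  assumes adm: "admissible P"
    and r: "\<And>\<alpha>. \<alpha> \<in> {1..species P} \<Longrightarrow> twice_diff (r \<alpha>)"
    and pos: "\<And>\<alpha> z. \<alpha> \<in> {1..species P} \<Longrightarrow> 0 < r \<alpha> z"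
    and b: "\<beta> \<in> {1..species P}"
  shows "twice_diff (\<lambda>z. chem_pot P K \<beta> (\<lambda>\<alpha>. r \<alpha> z))"
    and "\<alpha> \<in> {1..species P} \<Longrightarrow> twice_diff (\<lambda>z. chem_pot_deriv P K \<beta> \<alpha> (\<lambda>\<alpha>. r \<alpha> z))"
proof -
  have n: "twice_diff (\<lambda>z. num_density P (\<lambda>\<alpha>. r \<alpha> z))" by (rule twice_diff_num_density[OF r])
  have np: "0 < num_density P (\<lambda>\<alpha>. r \<alpha> z)" for z
    using num_density_pos[OF adm, of "\<lambda>\<alpha>. r \<alpha> z"] pos by simp
  have m: "0 < mass P \<beta>" "0 < n_ref P" using b adm by (auto simp: admissible_def)
  show "twice_diff (\<lambda>z. chem_pot P K \<beta> (\<lambda>\<alpha>. r \<alpha> z))"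
    unfolding chem_pot_def divide_inverse[of _ "mass P _"] divide_inverse[of _ "n_ref P"]
    using m np pos[OF b]
    by (intro twice_diff_add twice_diff_mult twice_diff_const twice_diff_ln twice_diff_divide n np r[OF b])
       (auto intro!: divide_pos_pos mult_pos_pos)
  assume a: "\<alpha> \<in> {1..species P}"
  have "twice_diff (\<lambda>z. if \<alpha> = \<beta> then 1 / r \<alpha> z else 0)"
    using twice_diff_divide[OF twice_diff_const[of 1] r[OF a] pos[OF a]] by (cases "\<alpha> = \<beta>") simp_all
  then show "twice_diff (\<lambda>z. chem_pot_deriv P K \<beta> \<alpha> (\<lambda>\<alpha>. r \<alpha> z))"
    unfolding chem_pot_deriv_def divide_inverse[of _ "mass P \<beta>"]
    by (intro twice_diff_add twice_diff_diff twice_diff_mult twice_diff_const twice_diff_divide n np)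
qed

lemma twice_diff_mu:
  assumes adm: "admissible P"
    and r: "\<And>\<alpha>. \<alpha> \<in> {1..species P} \<Longrightarrow> twice_diff (r \<alpha>)"
    and pos: "\<And>\<alpha> z. \<alpha> \<in> {1..species P} \<Longrightarrow> 0 < r \<alpha> z"
    and x: "twice_diff x"
    and b: "\<beta> \<in> {1..species P}"
  shows "twice_diff (\<lambda>z. mu P \<beta> (\<lambda>\<alpha>. r \<alpha> z) (x z))"
    and "\<alpha> \<in> {1..species P} \<Longrightarrow> twice_diff (\<lambda>z. dmu_drho P \<beta> \<alpha> (\<lambda>\<alpha>. r \<alpha> z) (x z))"
    and "twice_diff (\<lambda>z. dmu_dchi P \<beta> (\<lambda>\<alpha>. r \<alpha> z) (x z))"
proof -
  have h: "twice_diff (interp P)" "twice_diff (deriv (interp P))"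
    using adm smooth_real_twice_diff by (auto simp: admissible_def)
  have "(\<lambda>z. mu P \<beta> (\<lambda>\<alpha>. r \<alpha> z) (x z)) = (\<lambda>z. interp P (x z) * chem_pot P (bulkL P) \<beta> (\<lambda>\<alpha>. r \<alpha> z)
      + (1 - interp P (x z)) * chem_pot P (bulkV P) \<beta> (\<lambda>\<alpha>. r \<alpha> z))"
    by (rule ext) (rule mu_eq[OF adm pos b])
  then show "twice_diff (\<lambda>z. mu P \<beta> (\<lambda>\<alpha>. r \<alpha> z) (x z))"
    by (auto intro!: twice_diff_add twice_diff_diff twice_diff_mult twice_diff_compose[OF h(1) x] twice_diff_chem_pot adm r pos b)
  have "(\<lambda>z. dmu_dchi P \<beta> (\<lambda>\<alpha>. r \<alpha> z) (x z)) = (\<lambda>z. deriv (interp P) (x z) * (chem_pot P (bulkL P) \<beta> (\<lambda>\<alpha>. r \<alpha> z)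
      - chem_pot P (bulkV P) \<beta> (\<lambda>\<alpha>. r \<alpha> z)))"
    by (rule ext) (rule dmu_dchi_eq[OF adm pos b])
  then show "twice_diff (\<lambda>z. dmu_dchi P \<beta> (\<lambda>\<alpha>. r \<alpha> z) (x z))"
    by (auto intro!: twice_diff_add twice_diff_diff twice_diff_mult twice_diff_compose[OF h(2) x] twice_diff_chem_pot adm r pos b)
  assume a: "\<alpha> \<in> {1..species P}"
  have "(\<lambda>z. dmu_drho P \<beta> \<alpha> (\<lambda>\<alpha>. r \<alpha> z) (x z)) = (\<lambda>z. interp P (x z) * chem_pot_deriv P (bulkL P) \<beta> \<alpha> (\<lambda>\<alpha>. r \<alpha> z)
      + (1 - interp P (x z)) * chem_pot_deriv P (bulkV P) \<beta> \<alpha> (\<lambda>\<alpha>. r \<alpha> z))"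
    by (rule ext) (rule dmu_drho_eq[OF adm pos a b])
  then show "twice_diff (\<lambda>z. dmu_drho P \<beta> \<alpha> (\<lambda>\<alpha>. r \<alpha> z) (x z))"
    using a by (auto intro!: twice_diff_add twice_diff_diff twice_diff_mult twice_diff_compose[OF h(1) x] twice_diff_chem_pot adm r pos b)
qed

section \<open>Limits of the potentials, at infinity and at the interface alike\<close>

lemma tendsto_num_density:
  assumes "\<And>\<alpha>. \<alpha> \<in> {1..species P} \<Longrightarrow> (r \<alpha> \<longlongrightarrow> l \<alpha>) F"
  shows "((\<lambda>y. num_density P (\<lambda>\<alpha>. r \<alpha> y)) \<longlongrightarrow> num_density P l) F"
  unfolding num_density_def divide_inverse by (intro tendsto_intros assms)

lemma tendsto_chem_pot:
  assumes adm: "admissible P"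
    and r: "\<And>\<alpha>. \<alpha> \<in> {1..species P} \<Longrightarrow> (r \<alpha> \<longlongrightarrow> l \<alpha>) F"
    and pos: "\<And>\<alpha>. \<alpha> \<in> {1..species P} \<Longrightarrow> 0 < l \<alpha>"
    and b: "\<beta> \<in> {1..species P}"
  shows "((\<lambda>y. chem_pot P K \<beta> (\<lambda>\<alpha>. r \<alpha> y)) \<longlongrightarrow> chem_pot P K \<beta> l) F"
    and "\<alpha> \<in> {1..species P} \<Longrightarrow> ((\<lambda>y. chem_pot_deriv P K \<beta> \<alpha> (\<lambda>\<alpha>. r \<alpha> y)) \<longlongrightarrow> chem_pot_deriv P K \<beta> \<alpha> l) F"
proof -
  have n: "((\<lambda>y. num_density P (\<lambda>\<alpha>. r \<alpha> y)) \<longlongrightarrow> num_density P l) F" by (rule tendsto_num_density[OF r])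
  have np: "0 < num_density P l"
    using num_density_pos[OF adm] pos by simp
  have m: "0 < mass P \<alpha>" if "\<alpha> \<in> {1..species P}" for \<alpha>
    using that adm by (auto simp: admissible_def)
  have nr: "0 < n_ref P" using adm by (simp add: admissible_def)
  show "((\<lambda>y. chem_pot P K \<beta> (\<lambda>\<alpha>. r \<alpha> y)) \<longlongrightarrow> chem_pot P K \<beta> l) F"
    unfolding chem_pot_def by (intro tendsto_intros n r b) (use np nr m[OF b] pos[OF b] in auto)
  assume a: "\<alpha> \<in> {1..species P}"
  have "((\<lambda>y. if \<alpha> = \<beta> then 1 / r \<alpha> y else 0) \<longlongrightarrow> (if \<alpha> = \<beta> then 1 / l \<alpha> else 0)) F"
    using tendsto_divide[OF tendsto_const[of 1] r[OF a]] pos[OF a] by (cases "\<alpha> = \<beta>") simp_all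
  then show "((\<lambda>y. chem_pot_deriv P K \<beta> \<alpha> (\<lambda>\<alpha>. r \<alpha> y)) \<longlongrightarrow> chem_pot_deriv P K \<beta> \<alpha> l) F"
    unfolding chem_pot_deriv_def by (intro tendsto_intros n) (use np nr m[OF b] m[OF a] in auto)
qed

lemma tendsto_rho_psi:
  assumes adm: "admissible P"
    and r: "\<And>\<alpha>. \<alpha> \<in> {1..species P} \<Longrightarrow> (r \<alpha> \<longlongrightarrow> l \<alpha>) F"
    and pos: "\<And>\<alpha>. \<alpha> \<in> {1..species P} \<Longrightarrow> 0 < l \<alpha>"
  shows "((\<lambda>y. rho_psi P K (\<lambda>\<alpha>. r \<alpha> y)) \<longlongrightarrow> rho_psi P K l) F"
proof -
  have n: "((\<lambda>y. num_density P (\<lambda>\<alpha>. r \<alpha> y)) \<longlongrightarrow> num_density P l) F" by (rule tendsto_num_density[OF r])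
  have np: "0 < num_density P l"
    using num_density_pos[OF adm] pos by simp
  have m: "mass P \<alpha> \<noteq> 0" if "\<alpha> \<in> {1..species P}" for \<alpha>
  proof -
    have "0 < mass P \<alpha>" using that adm by (simp add: admissible_def)
    then show ?thesis by simp
  qed
  have q: "l \<alpha> / mass P \<alpha> / num_density P l \<noteq> 0" if "\<alpha> \<in> {1..species P}" for \<alpha>
    using m[OF that] np pos[OF that] by simp
  have nr: "0 < n_ref P" using adm by (simp add: admissible_def)
  have eq: "rho_psi P K \<rho> = (\<Sum>\<alpha>=1..species P. \<rho> \<alpha> * psi_ref P \<alpha>)
        + (K - p_ref P) * (1 - num_density P \<rho> / n_ref P) + K * (num_density P \<rho> / n_ref P) * ln (num_density P \<rho> / n_ref P)
        + boltz P * temp P * (\<Sum>\<alpha>=1..species P. \<rho> \<alpha> / mass P \<alpha> * ln (\<rho> \<alpha> / mass P \<alpha> / num_density P \<rho>))" for \<rho>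
    by (simp add: rho_psi_def Let_def num_density_def)
  show ?thesis
    unfolding eq by (intro tendsto_intros n r m q) (use np nr in auto)
qed

lemma tendsto_mu:
  assumes adm: "admissible P"
    and r: "\<And>\<alpha>. \<alpha> \<in> {1..species P} \<Longrightarrow> (r \<alpha> \<longlongrightarrow> l \<alpha>) F"
    and pos: "\<And>\<alpha>. \<alpha> \<in> {1..species P} \<Longrightarrow> 0 < l \<alpha>"
    and x: "(x \<longlongrightarrow> c) F"
  shows "((\<lambda>y. rho_f P (\<lambda>\<alpha>. r \<alpha> y) (x y)) \<longlongrightarrow> rho_f P l c) F"
    and "\<beta> \<in> {1..species P} \<Longrightarrow> ((\<lambda>y. mu P \<beta> (\<lambda>\<alpha>. r \<alpha> y) (x y)) \<longlongrightarrow> mu P \<beta> l c) F"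
proof -
  have h: "((\<lambda>y. interp P (x y)) \<longlongrightarrow> interp P c) F"
    by (rule isCont_tendsto_compose[OF DERIV_isCont[OF interp_has_derivative[OF adm]] x])
  show "((\<lambda>y. rho_f P (\<lambda>\<alpha>. r \<alpha> y) (x y)) \<longlongrightarrow> rho_f P l c) F"
    unfolding rho_f_def
    by (intro tendsto_intros h tendsto_rho_psi adm r pos)
  assume b: "\<beta> \<in> {1..species P}"
  \<comment> \<open>Only the limiting densities are assumed positive, but then the densities are
    eventually positive too, and there \<open>mu\<close> agrees with its closed form.\<close>
  have "\<forall>\<^sub>F y in F. \<forall>\<alpha>\<in>{1..species P}. 0 < r \<alpha> y"
    by (intro eventually_ball_finite ballI order_tendstoD(1)[OF r] pos) auto
  then have "\<forall>\<^sub>F y in F. interp P (x y) * chem_pot P (bulkL P) \<beta> (\<lambda>\<alpha>. r \<alpha> y)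
      + (1 - interp P (x y)) * chem_pot P (bulkV P) \<beta> (\<lambda>\<alpha>. r \<alpha> y) = mu P \<beta> (\<lambda>\<alpha>. r \<alpha> y) (x y)"
    by eventually_elim (use mu_eq[OF adm _ b] in auto)
  moreover have "((\<lambda>y. interp P (x y) * chem_pot P (bulkL P) \<beta> (\<lambda>\<alpha>. r \<alpha> y)
      + (1 - interp P (x y)) * chem_pot P (bulkV P) \<beta> (\<lambda>\<alpha>. r \<alpha> y)) \<longlongrightarrow> mu P \<beta> l c) F"
    by (subst mu_eq[OF adm pos b], assumption) (intro tendsto_intros h tendsto_chem_pot(1) adm r pos b)
  ultimately show "((\<lambda>y. mu P \<beta> (\<lambda>\<alpha>. r \<alpha> y) (x y)) \<longlongrightarrow> mu P \<beta> l c) F"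
    by (rule Lim_transform_eventually[rotated])
qed

section \<open>The bulk regions near the interface\<close>

lemma far_neq_bot [simp]: "far \<sigma> \<noteq> bot"
  by (cases \<sigma>) auto

lemma abs_side_sign [simp]: "\<bar>side_sign \<sigma>\<bar> = 1"
  by (cases \<sigma>) auto

locale interface =
  fixes G :: geometry
  assumes geo: "interface_geometry G"
begin

abbreviation nearside :: "side \<Rightarrow> real \<Rightarrow> real^2 \<Rightarrow> (real^3) filter" where
  "nearside \<sigma> t s \<equiv> at (param G t s) within Om G \<sigma> t"

lemma norm_normal: "t \<in> {0..<tfin G} \<Longrightarrow> s \<in> pdom G \<Longrightarrow> norm (normal G t s) = 1"
  using geo by (simp add: interface_geometry_def)

text \<open>A single \<open>\<delta>\<close> bounds both the offset and the displacement of the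
  parameter. This uniformity is what later allows whole curves parallel to the interface to be
  placed in the bulk.\<close>

lemma tube:
  assumes "t \<in> {0..<tfin G}" "s \<in> pdom G"
  obtains \<delta> where "0 < \<delta>"
    "\<And>d q \<sigma>. 0 < d \<Longrightarrow> d < \<delta> \<Longrightarrow> dist q s < \<delta> \<Longrightarrow> param G t q + (side_sign \<sigma> * d) *\<^sub>R normal G t q \<in> Om G \<sigma> t"
proof -
  have "\<forall>\<^sub>F (d, q) in at_right 0 \<times>\<^sub>F nhds s.
      param G t q + d *\<^sub>R normal G t q \<in> Om G Plus t \<and> param G t q - d *\<^sub>R normal G t q \<in> Om G Minus t"
    using geo assms by (simp add: interface_geometry_def)
  then obtain A B where A: "eventually A (at_right (0::real))" and B: "eventually B (nhds s)"
    and AB: "\<And>d q. A d \<Longrightarrow> B q \<Longrightarrow> param G t q + d *\<^sub>R normal G t q \<in> Om G Plus t \<and>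
      param G t q - d *\<^sub>R normal G t q \<in> Om G Minus t"
    by (auto simp: eventually_prod_filter)
  obtain a where a: "0 < a" "\<And>d. 0 < d \<Longrightarrow> d < a \<Longrightarrow> A d"
    using A by (auto simp: eventually_at_right_field)
  obtain b where b: "0 < b" "\<And>q. dist q s < b \<Longrightarrow> B q"
    using B by (auto simp: eventually_nhds_metric)
  show ?thesis
  proof (rule that[of "min a b"])
    fix d q \<sigma> assume "0 < d" "d < min a b" "dist q s < min a b"
    then show "param G t q + (side_sign \<sigma> * d) *\<^sub>R normal G t q \<in> Om G \<sigma> t"
      using AB[of d q] a b by (cases \<sigma>) auto
  qed (use a b in auto)
qed

text \<open>Traces are limits at the interface point within the bulk, and they are unique only if
  this filter is nontrivial. Points on the normal ray supply the approximation.\<close>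

lemma islimpt_Om:
  assumes t: "t \<in> {0..<tfin G}" and s: "s \<in> pdom G"
  shows "param G t s islimpt Om G \<sigma> t"
proof -
  obtain \<delta> where d: "0 < \<delta>"
    "\<And>d q \<sigma>. 0 < d \<Longrightarrow> d < \<delta> \<Longrightarrow> dist q s < \<delta> \<Longrightarrow> param G t q + (side_sign \<sigma> * d) *\<^sub>R normal G t q \<in> Om G \<sigma> t"
    by (rule tube[OF t s]) (rule that)
  show ?thesis
    unfolding islimpt_approachable
  proof (intro allI impI)
    fix e :: real assume e: "0 < e"
    define x where "x = param G t s + (side_sign \<sigma> * (min \<delta> e / 2)) *\<^sub>R normal G t s"
    have "x \<in> Om G \<sigma> t"
      unfolding x_def by (rule d(2)) (use d(1) e in auto)
    moreover have "dist x (param G t s) = min \<delta> e / 2"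
      using d(1) e by (simp add: x_def dist_norm norm_normal[OF t s] abs_mult)
    ultimately show "\<exists>x'\<in>Om G \<sigma> t. x' \<noteq> param G t s \<and> dist x' (param G t s) < e"
      using d(1) e by (intro bexI[of _ x]) auto
  qed
qed

lemma nearside_neq_bot:
  "t \<in> {0..<tfin G} \<Longrightarrow> s \<in> pdom G \<Longrightarrow> nearside \<sigma> t s \<noteq> bot"
  using islimpt_Om trivial_limit_within by blast

lemma tr_eqI:
  assumes "t \<in> {0..<tfin G}" "s \<in> pdom G" "(f \<longlongrightarrow> l) (nearside \<sigma> t s)"
  shows "tr G \<sigma> t s f = l"
  unfolding tr_def using assms nearside_neq_bot tendsto_Lim by blast

lemma tr_tendsto:
  assumes "t \<in> {0..<tfin G}" "s \<in> pdom G" "has_trace G \<sigma> t s f"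
  shows "(f \<longlongrightarrow> tr G \<sigma> t s f) (nearside \<sigma> t s)"
  using assms tr_eqI unfolding has_trace_def by blast

lemma jump_eqI:
  assumes "t \<in> {0..<tfin G}" "s \<in> pdom G" "\<And>\<sigma>. (f \<longlongrightarrow> l \<sigma>) (nearside \<sigma> t s)"
  shows "jump G t s f = l Plus - l Minus"
  unfolding jump_def using tr_eqI assms by metis

lemma open_Om:
  assumes "t \<in> {0..<tfin G}"
  shows "open (Om G \<sigma> t)"
proof -
  have "openin (top_of_set ({0..<tfin G} \<times> UNIV)) (spacetime G \<sigma>)"
    using geo by (simp add: interface_geometry_def)
  then obtain T where T: "open T" "spacetime G \<sigma> = ({0..<tfin G} \<times> UNIV) \<inter> T"
    by (auto simp: openin_open)
  have "x \<in> Om G \<sigma> t \<longleftrightarrow> (t, x) \<in> spacetime G \<sigma>" for x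
    using assms by (simp add: spacetime_def)
  also have "\<dots> x \<longleftrightarrow> (t, x) \<in> T" for x
    using T assms by auto
  finally have "Om G \<sigma> t = Pair t -` T"
    by auto
  moreover have "open (Pair t -` T)"
    by (rule open_vimage[OF T(1)]) (intro continuous_intros)
  ultimately show ?thesis by simp
qed

lemma connected_Om: "t \<in> {0..<tfin G} \<Longrightarrow> connected (Om G \<sigma> t)"
  using geo by (simp add: interface_geometry_def)

lemma eventually_nearside_Om: "\<forall>\<^sub>F x in nearside \<sigma> t s. x \<in> Om G \<sigma> t"
  by (simp add: eventually_at_filter)

text \<open>The slices of the space-time region are connected and it is relatively open, so a field with
  values in a discrete set cannot jump in time either.\<close>

lemma two_valued_constant:
  assumes ne: "pdom G \<noteq> {}"
    and cont: "C0C0 G \<sigma> f" and val: "\<And>t x. (t, x) \<in> spacetime G \<sigma> \<Longrightarrow> f t x \<in> {0, side_sign \<sigma>}"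
    and 0: "t0 \<in> {0..<tfin G}" "x0 \<in> Om G \<sigma> t0"
    and 1: "t1 \<in> {0..<tfin G}" "x1 \<in> Om G \<sigma> t1"
  shows "f t1 x1 = f t0 x0"
proof -
  obtain s where s: "s \<in> pdom G" using ne by blast
  have con: "f t x = f t y" if t: "t \<in> {0..<tfin G}" and xy: "x \<in> Om G \<sigma> t" "y \<in> Om G \<sigma> t" for t x y
  proof -
    have "continuous_on (Om G \<sigma> t) ((\<lambda>(t, x). f t x) \<circ> Pair t)"
      by (rule continuous_on_compose)
         (auto intro!: continuous_intros continuous_on_subset[OF cont[unfolded C0C0_def]] simp: spacetime_def t[simplified])
    then have "continuous_on (Om G \<sigma> t) (f t)" by (simp add: o_def)
    moreover have "finite (f t ` Om G \<sigma> t)"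
      by (rule finite_subset[of _ "{0, side_sign \<sigma>}"]) (use val t in \<open>auto simp: spacetime_def\<close>)
    ultimately have "f t constant_on Om G \<sigma> t"
      using continuous_finite_range_constant connected_Om[OF t] by blast
    then show ?thesis using xy by (auto simp: constant_on_def)
  qed
  have nonempty: "Om G \<sigma> t \<noteq> {}" if "t \<in> {0..<tfin G}" for t
    using islimpt_Om[OF that s] islimpt_EMPTY by metis
  \<comment> \<open>The common value of \<open>f\<close> on the time slice; by connectedness the
    choice of the point is immaterial.\<close>
  define g where "g t = f t (SOME x. x \<in> Om G \<sigma> t)" for t
  have g: "f t x = g t" if "t \<in> {0..<tfin G}" "x \<in> Om G \<sigma> t" for t x
    unfolding g_def by (rule con[OF that]) (use that in \<open>auto intro: someI\<close>)
  have "g constant_on {0..<tfin G}"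
  proof (rule locally_constant_imp_constant)
    show "connected {0..<tfin G}" by (rule connected_Ico)
  next
    fix t assume t: "t \<in> {0..<tfin G}"
    obtain x where x: "x \<in> Om G \<sigma> t" using nonempty[OF t] by blast
    have open1: "openin (top_of_set ({0..<tfin G} \<times> UNIV)) (spacetime G \<sigma>)"
      using geo by (simp add: interface_geometry_def)
    \<comment> \<open>The two admissible values are at distance 1, so an open ball of radius 1 pins
      the value. With \<open>x\<close> frozen, \<open>V\<close> below is the relatively open set of
      times at which \<open>x\<close> lies in the region with a value in this ball, which makes
      \<open>g\<close> locally constant.\<close>
    have open2: "openin (top_of_set ({0..<tfin G} \<times> UNIV))
        (spacetime G \<sigma> \<inter> (\<lambda>(t, x). f t x) -` ball (f t x) 1)"
      by (rule openin_trans[OF continuous_openin_preimage_gen[OF cont[unfolded C0C0_def]] open1]) auto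
    define V where "V = {0..<tfin G} \<inter> (\<lambda>r. (r, x)) -` (spacetime G \<sigma> \<inter> (\<lambda>(t, x). f t x) -` ball (f t x) 1)"
    have "openin (top_of_set {0..<tfin G}) V"
      unfolding V_def
      by (rule continuous_openin_preimage[OF _ _ open2]) (auto intro!: continuous_intros)
    moreover have "t \<in> V" using t x by (auto simp: V_def spacetime_def)
    moreover have "g r = g t" if r: "r \<in> V" for r
    proof -
      have rx: "r \<in> {0..<tfin G}" "x \<in> Om G \<sigma> r" "dist (f t x) (f r x) < 1"
        using r by (auto simp: V_def spacetime_def)
      have "f t x \<in> {0, side_sign \<sigma>}" "f r x \<in> {0, side_sign \<sigma>}"
        using val rx t x by (auto simp: spacetime_def)
      then have "f r x = f t x" using rx(3) by (cases \<sigma>) (auto simp: dist_real_def)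
      then show ?thesis using g rx t x by metis
    qed
    ultimately show "\<exists>T. openin (top_of_set {0..<tfin G}) T \<and> t \<in> T \<and> (\<forall>x\<in>T. g x = g t)" by blast
  qed
  then show ?thesis using g 0 1 unfolding constant_on_def by metis
qed

end

section \<open>The phase field\<close>

lemma deriv_W: "deriv W c = 4 * c^3 - 4 * c" and deriv_deriv_W: "deriv (deriv W) c = 12 * c^2 - 4"
  and W_has_derivative: "(W has_real_derivative 4 * c^3 - 4 * c) (at c)"
proof -
  show D: "(W has_real_derivative 4 * c^3 - 4 * c) (at c)" for c
    unfolding W_def[abs_def]
    by (auto intro!: derivative_eq_intros) (simp add: power2_eq_square power3_eq_cube algebra_simps)
  then have eq: "deriv W = (\<lambda>c. 4 * c^3 - 4 * c)"
    by (auto intro: DERIV_imp_deriv)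
  then show "deriv W c = 4 * c^3 - 4 * c" by simp
  show "deriv (deriv W) c = 12 * c^2 - 4"
    unfolding eq by (rule DERIV_imp_deriv) (auto intro!: derivative_eq_intros)
qed

lemma twice_diff_deriv_W: "twice_diff (deriv W)"
  unfolding deriv_W[abs_def] power3_eq_cube
  by (intro twice_diff_diff twice_diff_mult twice_diff_const twice_diffI[where f' = "\<lambda>_. 1"]) auto

lemma twice_diff_W: "twice_diff W"
  by (rule twice_diffI[where f' = "deriv W"])
     (use W_has_derivative deriv_W twice_diff_deriv_W twice_diffD in auto)

lemma twice_diff_susc:
  assumes "admissible P"
  shows "twice_diff (susc P)"
  unfolding susc_def[abs_def]
  by (intro twice_diff_add twice_diff_mult twice_diff_diff twice_diff_const)
     (use assms smooth_real_twice_diff in \<open>auto simp: admissible_def\<close>)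

locale matched = interface +
  fixes P :: mixture and S :: outer and I :: inner
  assumes adm: "admissible P" and side: "liquid_on_plus_side G S"
    and match: "matching_solution P G S I"
begin

lemma outer_reg:
  "\<alpha> \<in> {1..species P} \<Longrightarrow> C0C2 G \<sigma> (rho S \<alpha>)"
  "\<alpha> \<in> {1..species P} \<Longrightarrow> (t, x) \<in> spacetime G \<sigma> \<Longrightarrow> 0 < rho S \<alpha> t x"
  "C0C2 G \<sigma> (chi0 S)" "C0C2 G \<sigma> (phi0 S)"
  using match unfolding matching_solution_def outer_solution_def outer_regular_def by blast+

lemma traces:
  assumes "t \<in> {0..<tfin G}" "s \<in> pdom G"
  shows "\<alpha> \<in> {1..species P} \<Longrightarrow> (rho S \<alpha> t \<longlongrightarrow> tr G \<sigma> t s (rho S \<alpha> t)) (nearside \<sigma> t s)"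
    and "\<alpha> \<in> {1..species P} \<Longrightarrow> (grad (rho S \<alpha> t) \<longlongrightarrow> tr G \<sigma> t s (grad (rho S \<alpha> t))) (nearside \<sigma> t s)"
    and "\<alpha> \<in> {1..species P} \<Longrightarrow> 0 < tr G \<sigma> t s (rho S \<alpha> t)"
    and "(vel S t \<longlongrightarrow> tr G \<sigma> t s (vel S t)) (nearside \<sigma> t s)"
    and "(phi0 S t \<longlongrightarrow> tr G \<sigma> t s (phi0 S t)) (nearside \<sigma> t s)"
    and "(grad (phi0 S t) \<longlongrightarrow> tr G \<sigma> t s (grad (phi0 S t))) (nearside \<sigma> t s)"
  using match assms unfolding matching_solution_def outer_traces_def
  by (auto intro!: tr_tendsto)

lemma matching:
  assumes "t \<in> {0..<tfin G}" "s \<in> pdom G"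
  shows "\<alpha> \<in> {1..species P} \<Longrightarrow> (R0 I \<alpha> t s \<longlongrightarrow> tr G \<sigma> t s (rho S \<alpha> t)) (far \<sigma>)"
    and "(V0 I t s \<longlongrightarrow> tr G \<sigma> t s (vel S t)) (far \<sigma>)"
    and "(X0 I t s \<longlongrightarrow> tr G \<sigma> t s (chi0 S t)) (far \<sigma>)"
    and "(Phi0 I t s \<longlongrightarrow> tr G \<sigma> t s (phi0 S t)) (far \<sigma>)"
    and "(deriv (X0 I t s) \<longlongrightarrow> 0) (far \<sigma>)"
    and "(deriv (Phi0 I t s) \<longlongrightarrow> 0) (far \<sigma>)"
    and "\<beta> \<in> {1..species P} \<Longrightarrow> (deriv (M0 P I \<beta> t s) \<longlongrightarrow> 0) (far \<sigma>)"
    and "((\<lambda>z. X1 I t s z - tr G \<sigma> t s (chi1 S t) - z * (tr G \<sigma> t s (grad (chi0 S t)) \<bullet> normal G t s)) \<longlongrightarrow> 0) (far \<sigma>)"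
    and "(deriv (X1 I t s) \<longlongrightarrow> tr G \<sigma> t s (grad (chi0 S t)) \<bullet> normal G t s) (far \<sigma>)"
    and "(deriv (Phi1 I t s) \<longlongrightarrow> tr G \<sigma> t s (grad (phi0 S t)) \<bullet> normal G t s) (far \<sigma>)"
    and "\<beta> \<in> {1..species P} \<Longrightarrow> (deriv (M1 P I \<beta> t s) \<longlongrightarrow> tr G \<sigma> t s (grad (mu0 P S \<beta> t)) \<bullet> normal G t s) (far \<sigma>)"
  using match assms unfolding matching_solution_def matching_conditions_def Let_def by blast+

lemma inner_reg:
  assumes "t \<in> {0..<tfin G}" "s \<in> pdom G"
  shows "\<alpha> \<in> {1..species P} \<Longrightarrow> 0 < R0 I \<alpha> t s z"
    and "\<alpha> \<in> {1..species P} \<Longrightarrow> twice_diff (R0 I \<alpha> t s)"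
    and "\<alpha> \<in> {1..species P} \<Longrightarrow> twice_diff (R1 I \<alpha> t s)"
    and "V0 I t s C1_differentiable_on UNIV"
    and "twice_diff (X0 I t s)" "twice_diff (X1 I t s)"
    and "twice_diff (Phi0 I t s)" "twice_diff (Phi1 I t s)"
    and "C1_on (pdom G) (\<lambda>s. X0 I t s z)"
  using match assms unfolding matching_solution_def inner_solution_def inner_regular_def
  by (blast intro: C2_real_twice_diff)+

lemma outer_bulk:
  assumes "(t, x) \<in> spacetime G \<sigma>"
  shows "\<And>\<alpha>. \<alpha> \<in> {1..species P - 1} \<Longrightarrow>
           0 = dt G (rho S \<alpha>) t x + divg (\<lambda>y. rho S \<alpha> t y *\<^sub>R vel S t y) x
               - divg (diff_flux P S \<alpha> t) x - react_rate P S \<alpha> t x"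
    and "0 = dt G (rho_tot P S) t x + divg (\<lambda>y. rho_tot P S t y *\<^sub>R vel S t y) x"
    and "0 = deriv W (chi0 S t x)"
    and "0 = dt G (\<lambda>r y. rho_tot P S r y *\<^sub>R vel S r y) t x
            + div_tensor (\<lambda>y. rho_tot P S t y *\<^sub>R tensor_prod (vel S t y) (vel S t y)) x
            + grad (press0 P S t) x
            - grad (\<lambda>y. deriv W (chi0 S t y) * chi1 S t y) x"
    and "0 = deriv (deriv W) (chi0 S t x) * chi1 S t x
            + drf_dchi P (\<lambda>\<alpha>. rho S \<alpha> t x) (chi0 S t x)"
    and "0 = (\<Sum>\<alpha>=1..species P. charge P \<alpha> / mass P \<alpha> * rho S \<alpha> t x)"
proof -
  have "outer_solution P G S" using match by (simp add: matching_solution_def)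
  note * = bspec[OF spec[OF conjunct2[OF this[unfolded outer_solution_def]], of \<sigma>] assms, unfolded prod.case]
  show "\<And>\<alpha>. \<alpha> \<in> {1..species P - 1} \<Longrightarrow>
           0 = dt G (rho S \<alpha>) t x + divg (\<lambda>y. rho S \<alpha> t y *\<^sub>R vel S t y) x
               - divg (diff_flux P S \<alpha> t) x - react_rate P S \<alpha> t x"
    using * by blast
qed (use match assms in \<open>auto simp: matching_solution_def outer_solution_def\<close>)

text \<open>Of the roots -1, 0, 1 of \<open>W'\<close> the sign convention removes only the wrong
  pure phase. The unstable root 0 survives here and can be excluded only through the inner
  solution.\<close>

lemma chi0_two_valued:
  assumes "(t, x) \<in> spacetime G \<sigma>"
  shows "chi0 S t x \<in> {0, side_sign \<sigma>}"
proof -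
  have "4 * chi0 S t x * (chi0 S t x - 1) * (chi0 S t x + 1) = 0"
    using outer_bulk(3)[OF assms] by (simp add: deriv_W power3_eq_cube algebra_simps)
  moreover have "0 \<le> side_sign \<sigma> * chi0 S t x"
    using side assms unfolding liquid_on_plus_side_def by auto
  ultimately show ?thesis by (cases \<sigma>) auto
qed

lemma inner_eqs:
  assumes "t \<in> {0..<tfin G}" "s \<in> pdom G"
  shows "0 = deriv (J0 P G I t s) z"
    and "0 = deriv (\<lambda>y. (1 + susc P (X0 I t s y)) * deriv (Phi0 I t s) y) z"
    and "\<And>\<alpha>. \<alpha> \<in> {1..species P - 1} \<Longrightarrow>
           0 = deriv (\<lambda>y. \<Sum>\<beta>=1..species P - 1. diff_mob P \<alpha> \<beta> *
                   (deriv (\<lambda>y'. M0 P I \<beta> t s y' - M0 P I (species P) t s y') y + zrel P \<beta> * deriv (Phi0 I t s) y)) z"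
    and "0 = deriv (\<lambda>y. - W (X0 I t s y) + gam P / 2 * (deriv (X0 I t s) y)^2
              - eps0 P / 2 * (1 + susc P (X0 I t s y)) * (deriv (Phi0 I t s) y)^2) z *\<^sub>R normal G t s"
    and "0 = deriv W (X0 I t s z) - gam P * deriv (deriv (X0 I t s)) z
              - eps0 P / 2 * deriv (susc P) (X0 I t s z) * (deriv (Phi0 I t s) z)^2"
    and "0 = J0 P G I t s z *\<^sub>R vector_derivative (V0 I t s) (at z)
              + deriv (\<lambda>y. (\<Sum>\<alpha>=1..species P. R0 I \<alpha> t s y * M0 P I \<alpha> t s y) - RF0 P I t s y
                            - deriv W (X0 I t s y) * X1 I t s y) z *\<^sub>R normal G t s
              + (gam P * (deriv (X0 I t s) z * deriv (deriv (X1 I t s)) z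
                  + deriv (deriv (X0 I t s)) z * deriv (X1 I t s) z
                  - mean_curvature G t s * (deriv (X0 I t s) z)^2)) *\<^sub>R normal G t s
              - surf_grad G t (\<lambda>q. W (X0 I t q z)) s
              + (gam P * deriv (deriv (X0 I t s)) z) *\<^sub>R surf_grad G t (\<lambda>q. X0 I t q z) s"
    and "0 = J0 P G I t s z / tau P * deriv (X0 I t s) z + deriv (deriv W) (X0 I t s z) * X1 I t s z
              - gam P * deriv (deriv (X1 I t s)) z + gam P * mean_curvature G t s * deriv (X0 I t s) z
              + drf_dchi P (\<lambda>\<alpha>. R0 I \<alpha> t s z) (X0 I t s z)"
    and "\<And>\<alpha>. \<alpha> \<in> {1..species P - 1} \<Longrightarrow>
             0 = deriv (\<lambda>y. R0 I \<alpha> t s y * (V0 I t s y \<bullet> normal G t s - normal_velocity G t s)) z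
                 - (\<Sum>\<beta>=1..species P - 1. diff_mob P \<alpha> \<beta> *
                     (deriv (deriv (\<lambda>y. M1 P I \<beta> t s y - M1 P I (species P) t s y)) z
                      - mean_curvature G t s * deriv (\<lambda>y. M0 P I \<beta> t s y - M0 P I (species P) t s y) z
                      + zrel P \<beta> * deriv (deriv (Phi1 I t s)) z
                      - mean_curvature G t s * zrel P \<beta> * deriv (Phi0 I t s) z))"
    and "0 = deriv (\<lambda>y. (1 + susc P (X0 I t s y)) * deriv (Phi1 I t s) y) z
              + (\<Sum>\<alpha>=1..species P. charge P \<alpha> / mass P \<alpha> * R0 I \<alpha> t s z)"
  using match assms unfolding matching_solution_def inner_solution_def Let_def by blast+

text \<open>The electric flux \<open>(1 + s) Phi0_z\<close> is constant and tends to 0, and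
  \<open>1 + s\<close> is positive.\<close>

lemma Phi0_deriv:
  assumes ts: "t \<in> {0..<tfin G}" "s \<in> pdom G"
  shows "deriv (Phi0 I t s) z = 0"
proof -
  let ?F = "\<lambda>y. (1 + susc P (X0 I t s y)) * deriv (Phi0 I t s) y"
  have X: "twice_diff (\<lambda>y. 1 + susc P (X0 I t s y))"
    by (intro twice_diff_add twice_diff_const twice_diff_compose[OF twice_diff_susc] adm inner_reg ts)
  have "isCont (susc P) (tr G Plus t s (chi0 S t))"
    using twice_diffD(1)[OF twice_diff_susc[OF adm]] DERIV_isCont by blast
  then have "((\<lambda>y. susc P (X0 I t s y)) \<longlongrightarrow> susc P (tr G Plus t s (chi0 S t))) (far Plus)"
    by (rule isCont_tendsto_compose) (rule matching(3)[OF ts])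
  from tendsto_mult[OF tendsto_add[OF tendsto_const this] matching(6)[OF ts]]
  have lim: "(?F \<longlongrightarrow> 0) (far Plus)" by simp
  have "?F z = 0"
    by (rule deriv_zero_imp_limit[OF _ _ lim])
       (auto intro!: differentiable_mult twice_diffD(3)[OF X] twice_diffD(4) inner_reg ts inner_eqs(2)[OF ts, symmetric])
  moreover have "0 < 1 + susc P (X0 I t s z)"
    using adm by (simp add: admissible_def add_pos_nonneg)
  ultimately show ?thesis by simp
qed

lemma energy:
  assumes ts: "t \<in> {0..<tfin G}" "s \<in> pdom G"
  shows "gam P / 2 * (deriv (X0 I t s) z)^2 = W (X0 I t s z) - W (tr G \<sigma> t s (chi0 S t))"
proof -
  let ?E = "\<lambda>y. - W (X0 I t s y) + gam P / 2 * (deriv (X0 I t s) y)^2"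
  have "normal G t s \<noteq> 0" using norm_normal[OF ts] by auto
  then have E: "deriv ?E z = 0" for z
    using inner_eqs(4)[OF ts, of z] by (simp add: Phi0_deriv[OF ts])
  have W: "twice_diff (\<lambda>y. W (X0 I t s y))"
    by (intro twice_diff_compose[OF twice_diff_W] inner_reg ts)
  have d: "?E differentiable at y" for y
    unfolding power2_eq_square
    by (intro differentiable_add differentiable_minus differentiable_mult differentiable_const
        twice_diffD(3)[OF W] twice_diffD(4) inner_reg ts)
  have "((\<lambda>y. W (X0 I t s y)) \<longlongrightarrow> W (tr G \<sigma> t s (chi0 S t))) (far \<sigma>)"
    by (rule isCont_tendsto_compose[OF DERIV_isCont[OF W_has_derivative] matching(3)[OF ts]])
  then have "(?E \<longlongrightarrow> - W (tr G \<sigma> t s (chi0 S t)) + gam P / 2 * 0^2) (far \<sigma>)"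
    by (intro tendsto_intros matching(5)[OF ts])
  from deriv_zero_imp_limit[OF d E this, of z] show ?thesis by simp
qed

text \<open>A zero trace would turn the energy identity into \<open>W(X) \<ge> W(0) = 1\<close>
  along the whole profile. Since \<open>W(c) - 1 = c^2 (c^2 - 2)\<close>, a nonzero value of
  \<open>X\<close> then exceeds 1 in modulus, and \<open>X\<close> cannot approach its limit 0
  without crossing modulus 1, where \<open>W\<close> vanishes.\<close>

lemma chi0_trace:
  assumes ts: "t \<in> {0..<tfin G}" "s \<in> pdom G" and z: "X0 I t s z \<noteq> 0"
  shows "tr G \<sigma> t s (chi0 S t) = side_sign \<sigma>"
proof -
  have trc: "tr G \<sigma> t s (chi0 S t) \<in> {0, side_sign \<sigma>}" for \<sigma>
  proof -
    have tend: "(chi0 S t \<longlongrightarrow> tr G \<sigma> t s (chi0 S t)) (nearside \<sigma> t s)"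
      using match ts unfolding matching_solution_def outer_traces_def by (auto intro!: tr_tendsto)
    show ?thesis
    proof (rule Lim_in_closed_set[OF _ _ nearside_neq_bot[OF ts] tend])
      show "\<forall>\<^sub>F x in nearside \<sigma> t s. chi0 S t x \<in> {0, side_sign \<sigma>}"
        using eventually_nearside_Om
        by eventually_elim (use chi0_two_valued ts in \<open>auto simp: spacetime_def\<close>)
    qed (auto intro: finite_imp_closed)
  qed
  have W: "W 0 = 1" "W 1 = 0" "W (-1) = 0" by (auto simp: W_def)
  have "W (tr G Plus t s (chi0 S t)) = W (tr G Minus t s (chi0 S t))"
    using energy[OF ts, of z Plus] energy[OF ts, of z Minus] by simp
  \<comment> \<open>A zero trace on one side and a pure phase on the other would have energies 1 and
    0.\<close>
  then have "(\<forall>\<sigma>. tr G \<sigma> t s (chi0 S t) = 0) \<or> (\<forall>\<sigma>. tr G \<sigma> t s (chi0 S t) = side_sign \<sigma>)"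
    using trc[of Plus] trc[of Minus] W by (auto; metis side.exhaust side_sign.simps)
  moreover have False if 0: "tr G Plus t s (chi0 S t) = 0"
  proof -
    have nonneg: "0 \<le> W (X0 I t s y) - 1" for y
      using energy[OF ts, of y Plus] 0 W adm
      by (smt (verit, best) admissible_def divide_nonneg_nonneg mult_nonneg_nonneg zero_le_power2)
    have no1: "\<bar>X0 I t s y\<bar> \<noteq> 1" for y
    proof
      assume "\<bar>X0 I t s y\<bar> = 1"
      then have "X0 I t s y = 1 \<or> X0 I t s y = -1" by linarith
      then show False using nonneg[of y] W by auto
    qed
    have large: "1 < \<bar>X0 I t s y\<bar>" if "X0 I t s y \<noteq> 0" for y
    proof (rule ccontr)
      assume "\<not> 1 < \<bar>X0 I t s y\<bar>"
      then have "(X0 I t s y)^2 \<le> 1" by (simp add: abs_square_le_1)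
      moreover have "W (X0 I t s y) - 1 = (X0 I t s y)^2 * ((X0 I t s y)^2 - 2)"
        by (simp add: W_def power2_eq_square algebra_simps)
      moreover have "0 < (X0 I t s y)^2" using that by simp
      ultimately show False using nonneg[of y] mult_pos_neg[of "(X0 I t s y)^2" "(X0 I t s y)^2 - 2"] by simp
    qed
    have "\<forall>\<^sub>F y in at_top. \<bar>X0 I t s y\<bar> < 1"
      using tendstoD[OF matching(3)[OF ts, of Plus], of 1] 0 by (simp add: dist_real_def)
    then have "\<forall>\<^sub>F y in at_top. \<bar>X0 I t s y\<bar> < 1 \<and> z \<le> y"
      by (intro eventually_conj eventually_ge_at_top)
    then obtain b where b: "\<bar>X0 I t s b\<bar> < 1" "z \<le> b"
      using eventually_happens'[OF trivial_limit_at_top_linorder] by blast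
    have "isCont (X0 I t s) y" for y
      using twice_diffD(1)[OF inner_reg(5)[OF ts]] DERIV_isCont by blast
    \<comment> \<open>The modulus of \<open>X\<close> is above 1 at \<open>z\<close> and below 1 at
      \<open>b\<close>.\<close>
    then have "\<exists>y. z \<le> y \<and> y \<le> b \<and> \<bar>X0 I t s y\<bar> = 1"
      by (intro IVT2) (use large[OF z] b in \<open>auto intro!: continuous_intros\<close>)
    then show False using no1 by blast
  qed
  ultimately show ?thesis by blast
qed

lemma chi0_bulk:
  assumes "t \<in> {0..<tfin G}" "x \<in> Om G \<sigma> t"
  shows "chi0 S t x = side_sign \<sigma>"
proof -
  obtain t0 s0 z0 where ts: "t0 \<in> {0..<tfin G}" "s0 \<in> pdom G" and z0: "X0 I t0 s0 z0 \<noteq> 0"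
    using match unfolding matching_solution_def inner_solution_def inner_regular_def by blast
  have c: "C0C0 G \<sigma> (chi0 S)"
    using outer_reg(3) by (auto simp: C0C2_def C0C1_def)
  have const: "chi0 S t1 x1 = chi0 S t x" if "t1 \<in> {0..<tfin G}" "x1 \<in> Om G \<sigma> t1" for t1 x1
    by (rule two_valued_constant[OF _ c chi0_two_valued assms that]) (use ts in auto)
  have "(chi0 S t0 \<longlongrightarrow> chi0 S t x) (nearside \<sigma> t0 s0)"
    by (rule tendsto_eventually)
       (use eventually_nearside_Om in eventually_elim, use const ts in auto)
  then show ?thesis
    using tr_eqI[OF ts] chi0_trace[OF ts z0] by metis
qed

text \<open>\<open>chi0_trace\<close> needs a nonzero value of \<open>X0\<close> at the interface
  point in question. Bulk constancy removes this condition and gives the trace at every point and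
  time.\<close>

lemma chi0_tr:
  assumes ts: "t \<in> {0..<tfin G}" "s \<in> pdom G"
  shows "(chi0 S t \<longlongrightarrow> side_sign \<sigma>) (nearside \<sigma> t s)" "tr G \<sigma> t s (chi0 S t) = side_sign \<sigma>"
proof -
  show "(chi0 S t \<longlongrightarrow> side_sign \<sigma>) (nearside \<sigma> t s)"
    by (rule tendsto_eventually)
       (use eventually_nearside_Om in eventually_elim, use chi0_bulk ts in auto)
  then show "tr G \<sigma> t s (chi0 S t) = side_sign \<sigma>" by (rule tr_eqI[OF ts])
qed

lemma interp_deriv_side: "deriv (interp P) (side_sign \<sigma>) = 0"
  using adm by (simp add: admissible_def)

text \<open>At a pure phase \<open>h' = 0\<close>, while \<open>W''\<close> equals 8; the linear
  equation for \<open>chi1\<close> is homogeneous and nondegenerate.\<close>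

lemma chi1_bulk:
  assumes "t \<in> {0..<tfin G}" "x \<in> Om G \<sigma> t"
  shows "chi1 S t x = 0"
proof -
  have "(t, x) \<in> spacetime G \<sigma>" using assms by (simp add: spacetime_def)
  from outer_bulk(5)[OF this] show ?thesis
    by (simp add: chi0_bulk[OF assms] drf_dchi_eq[OF adm] interp_deriv_side deriv_deriv_W)
       (cases \<sigma>; simp)
qed

lemma grad_locally_constant:
  assumes t: "t \<in> {0..<tfin G}" and x: "x \<in> Om G \<sigma> t"
    and f: "\<And>y. y \<in> Om G \<sigma> t \<Longrightarrow> f y = c"
  shows "grad f x = 0"
proof -
  have "(f has_derivative (\<lambda>h. 0)) (at x)"
    by (rule has_derivative_transform_within_open[OF has_derivative_const open_Om[OF t] x])
       (use f in auto)
  then have "frechet_derivative f (at x) = (\<lambda>h. 0)"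
    using frechet_derivative_at by metis
  then show ?thesis by (simp add: grad_def pdiff_def vec_eq_iff)
qed

text \<open>These values turn the matching conditions for \<open>X1\<close> into plain decay of
  \<open>X1\<close> and of its derivative, which removes all boundary terms containing
  \<open>X1\<close>.\<close>

lemma tr_chi1_grad_chi0:
  assumes ts: "t \<in> {0..<tfin G}" "s \<in> pdom G"
  shows "tr G \<sigma> t s (chi1 S t) = 0" "tr G \<sigma> t s (grad (chi0 S t)) = 0"
proof -
  show "tr G \<sigma> t s (chi1 S t) = 0"
    by (rule tr_eqI[OF ts], rule tendsto_eventually)
       (use eventually_nearside_Om in eventually_elim, use chi1_bulk ts in auto)
  show "tr G \<sigma> t s (grad (chi0 S t)) = 0"
    by (rule tr_eqI[OF ts], rule tendsto_eventually)
       (use eventually_nearside_Om in eventually_elim, use grad_locally_constant[OF ts(1)] chi0_bulk ts in blast)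
qed

end

section \<open>Integrability along the profile\<close>

lemma ex_antiderivative_real:
  fixes f :: "real \<Rightarrow> real"
  assumes "\<And>x. isCont f x"
  obtains F where "\<And>x. (F has_real_derivative f x) (at x)"
  using einterval_antiderivative[of "-\<infinity>" "\<infinity>" f] assms
  by (auto simp: has_real_derivative_iff_has_vector_derivative)

lemma mono_bounded_tendsto_at_top:
  fixes F :: "real \<Rightarrow> real"
  assumes "mono F" and B: "\<And>x. F x \<le> B"
  obtains L where "(F \<longlongrightarrow> L) at_top"
proof
  have bdd: "bdd_above (range F)" using B unfolding bdd_above_def by blast
  show "(F \<longlongrightarrow> (SUP x. F x)) at_top"
  proof (rule order_tendstoI)
    fix a assume "a < (SUP x. F x)"
    then obtain x where "a < F x" using less_cSUP_iff[OF _ bdd] by auto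
    then show "\<forall>\<^sub>F x in at_top. a < F x"
      unfolding eventually_at_top_linorder using monoD[OF \<open>mono F\<close>] less_le_trans by blast
  next
    fix a assume "(SUP x. F x) < a"
    then show "\<forall>\<^sub>F x in at_top. F x < a"
      using cSUP_upper[OF _ bdd] by (intro always_eventually allI) (meson UNIV_I le_less_trans)
  qed
qed

lemma mono_bounded_tendsto_at_bot:
  fixes F :: "real \<Rightarrow> real"
  assumes "mono F" and B: "\<And>x. B \<le> F x"
  obtains L where "(F \<longlongrightarrow> L) at_bot"
proof -
  have "mono (\<lambda>x. - F (- x))" using \<open>mono F\<close> by (auto simp: mono_def)
  then obtain L where "((\<lambda>x. - F (- x)) \<longlongrightarrow> L) at_top"
    by (rule mono_bounded_tendsto_at_top[of _ "- B"]) (use B in auto)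
  from tendsto_minus[OF this] have "(F \<longlongrightarrow> - L) at_bot"
    by (simp add: filterlim_at_bot_mirror)
  then show ?thesis by (rule that)
qed

text \<open>Once \<open>X\<close> is close to \<open>1\<close>, the equation \<open>g X'' = W'(X)\<close> gives \<open>(X - 1) X'' \<ge> 0\<close>, hence
  \<open>((X - 1) X')' \<ge> (X')\<^sup>2\<close>, and \<open>(X - 1) X'\<close> is bounded; similarly near \<open>-1\<close>.\<close>

lemma profile_square_integrable:
  fixes X :: "real \<Rightarrow> real"
  assumes td: "twice_diff X" and g: "0 < g"
    and ode: "\<And>z. g * deriv (deriv X) z = deriv W (X z)"
    and lim: "(X \<longlongrightarrow> 1) at_top" "(X \<longlongrightarrow> -1) at_bot"
    and lim': "(deriv X \<longlongrightarrow> 0) at_top" "(deriv X \<longlongrightarrow> 0) at_bot"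
  shows "(\<lambda>z. (deriv X z)^2) integrable_on UNIV"
proof -
  note D = twice_diffD(1,2)[OF td]
  have "isCont (\<lambda>z. (deriv X z)^2) z" for z
    using DERIV_isCont[OF D(2)] by (intro continuous_intros)
  then obtain F where F: "\<And>z. (F has_real_derivative (deriv X z)^2) (at z)"
    by (rule ex_antiderivative_real) (rule that)
  have "mono F"
    by (rule monoI, rule DERIV_nonneg_imp_nondecreasing[where f = F]) (use F in force)+
  define G where "G = (\<lambda>c z. (X z - c) * deriv X z)"
  have G: "((\<lambda>z. G c z - F z) has_real_derivative (X z - c) * deriv (deriv X) z) (at z)" for c z
    unfolding G_def
    by (auto intro!: derivative_eq_intros D F simp: power2_eq_square algebra_simps)
  have X'': "deriv (deriv X) z = 4 * X z * (X z - 1) * (X z + 1) / g" for z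
    using ode[of z] g by (simp add: deriv_W field_simps power3_eq_cube)
  have l: "((\<lambda>z. G 1 z) \<longlongrightarrow> (1 - 1) * 0) at_top" "((\<lambda>z. G (-1) z) \<longlongrightarrow> (- 1 - - 1) * 0) at_bot"
    unfolding G_def by (intro tendsto_intros lim lim')+
  have "\<forall>\<^sub>F z in at_top. G 1 z < 1" "\<forall>\<^sub>F z in at_bot. - 1 < G (-1) z"
    using order_tendstoD(2)[OF l(1), of 1] order_tendstoD(1)[OF l(2), of "-1"] by auto
  moreover have "\<forall>\<^sub>F z in at_top. 0 < X z" "\<forall>\<^sub>F z in at_bot. X z < 0"
    using order_tendstoD(1)[OF lim(1), of 0] order_tendstoD(2)[OF lim(2), of 0] by auto
  ultimately have "\<forall>\<^sub>F z in at_top. G 1 z < 1 \<and> 0 < X z" "\<forall>\<^sub>F z in at_bot. - 1 < G (-1) z \<and> X z < 0"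
    by (auto intro: eventually_conj)
  then obtain a b where b: "\<And>z. z \<ge> b \<Longrightarrow> G 1 z < 1 \<and> 0 < X z" and a: "\<And>z. z \<le> a \<Longrightarrow> - 1 < G (-1) z \<and> X z < 0"
    by (auto simp: eventually_at_top_linorder eventually_at_bot_linorder)
  have upper: "F z \<le> F b - G 1 b + 1" if "z \<ge> b" for z
  proof -
    have "G 1 b - F b \<le> G 1 z - F z"
    proof (rule DERIV_nonneg_imp_nondecreasing[OF that])
      fix x assume "b \<le> x"
      have "(X x - 1) * deriv (deriv X) x = 4 * X x * (X x - 1)^2 * (X x + 1) / g"
        by (simp add: X'' power2_eq_square algebra_simps)
      also have "\<dots> \<ge> 0" using b[OF \<open>b \<le> x\<close>] g by (intro divide_nonneg_pos mult_nonneg_nonneg) auto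
      finally show "\<exists>y. ((\<lambda>z. G 1 z - F z) has_real_derivative y) (at x) \<and> 0 \<le> y"
        using G by blast
    qed
    then show ?thesis using b[OF that] by linarith
  qed
  have lower: "F a - G (-1) a - 1 \<le> F z" if "z \<le> a" for z
  proof -
    have "G (-1) z - F z \<le> G (-1) a - F a"
    proof (rule DERIV_nonneg_imp_nondecreasing[OF that])
      fix x assume "x \<le> a"
      have "(X x - -1) * deriv (deriv X) x = 4 * (- X x) * (X x + 1)^2 * (1 - X x) / g"
        by (simp add: X'' power2_eq_square algebra_simps)
      also have "\<dots> \<ge> 0" using a[OF \<open>x \<le> a\<close>] g by (intro divide_nonneg_pos mult_nonneg_nonneg) auto
      finally show "\<exists>y. ((\<lambda>z. G (-1) z - F z) has_real_derivative y) (at x) \<and> 0 \<le> y"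
        using G by blast
    qed
    then show ?thesis using a[OF that] by linarith
  qed
  have "F z \<le> F b - G 1 b + 1" for z
    using upper[of "max z b"] monoD[OF \<open>mono F\<close>, of z "max z b"] by simp
  from mono_bounded_tendsto_at_top[OF \<open>mono F\<close> this] obtain L1 where L1: "(F \<longlongrightarrow> L1) at_top" .
  have "F a - G (-1) a - 1 \<le> F z" for z
    using lower[of "min z a"] monoD[OF \<open>mono F\<close>, of "min z a" z] by simp
  from mono_bounded_tendsto_at_bot[OF \<open>mono F\<close> this] obtain L2 where L2: "(F \<longlongrightarrow> L2) at_bot" .
  show ?thesis
    using has_integral_UNIV_antiderivative[OF F[unfolded has_real_derivative_iff_has_vector_derivative] L1 L2]
    by blast
qed

lemma bounded_if_limits:
  fixes u :: "real \<Rightarrow> real"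
  assumes c: "\<And>x. isCont u x" and lim: "(u \<longlongrightarrow> A) at_top" "(u \<longlongrightarrow> B) at_bot"
  obtains C where "\<And>x. \<bar>u x\<bar> \<le> C"
proof -
  obtain b where b: "\<And>x. x \<ge> b \<Longrightarrow> \<bar>u x\<bar> < \<bar>A\<bar> + 1"
    using order_tendstoD(2)[OF tendsto_rabs[OF lim(1)], of "\<bar>A\<bar> + 1"] by (auto simp: eventually_at_top_linorder)
  obtain a where a: "\<And>x. x \<le> a \<Longrightarrow> \<bar>u x\<bar> < \<bar>B\<bar> + 1"
    using order_tendstoD(2)[OF tendsto_rabs[OF lim(2)], of "\<bar>B\<bar> + 1"] by (auto simp: eventually_at_bot_linorder)
  have "compact (u ` {a..b})"
    using c by (intro compact_continuous_image continuous_at_imp_continuous_on) auto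
  then obtain M where M: "\<forall>x\<in>{a..b}. \<bar>u x\<bar> \<le> M"
    using compact_imp_bounded[of "u ` {a..b}"] by (auto simp: bounded_iff)
  have "\<bar>u x\<bar> \<le> max M (max (\<bar>A\<bar> + 1) (\<bar>B\<bar> + 1))" for x
    using a[of x] b[of x] bspec[OF M, of x] by (cases "x \<le> a"; cases "b \<le> x") (auto simp: le_max_iff_disj)
  then show ?thesis by (rule that)
qed

text \<open>A continuous factor with limits at both ends is bounded, and a multiple of the
  nonnegative \<open>f\<close> dominates the product.\<close>

lemma integrable_bounded_mult:
  fixes u f :: "real \<Rightarrow> real"
  assumes "\<And>x. isCont u x" "(u \<longlongrightarrow> A) at_top" "(u \<longlongrightarrow> B) at_bot"
    and f: "\<And>x. isCont f x" "\<And>x. 0 \<le> f x" "f integrable_on UNIV"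
  shows "(\<lambda>x. u x * f x) integrable_on UNIV"
proof -
  obtain C where C: "\<And>x. \<bar>u x\<bar> \<le> C"
    using bounded_if_limits[OF assms(1-3)] by blast
  show ?thesis
  proof (rule integrable_on_all_intervals_integrable_bound)
    show "(\<lambda>x. C * f x) integrable_on UNIV"
      using integrable_on_cmult_left[OF f(3), of C] by simp
    show "(\<lambda>x. if x \<in> UNIV then u x * f x else 0) integrable_on cbox a b" for a b
      using assms(1) f(1) by (auto intro!: integrable_continuous_real continuous_at_imp_continuous_on continuous_intros)
    show "norm (u x * f x) \<le> C * f x" for x
      using C[of x] f(2)[of x] by (simp add: abs_mult mult_right_mono)
  qed
qed

section \<open>Gradients of the outer fields\<close>

lemma grad_eqI:
  assumes "(f has_derivative f') (at x)"
  shows "grad f x = (\<chi> i. f' (axis i 1))"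
  using frechet_derivative_at[OF assms] by (simp add: grad_def pdiff_def)

lemma grad_combination:
  assumes "f differentiable at x" "g differentiable at x" "h differentiable at x"
  shows "grad (\<lambda>y. f y - g y + c * h y) x = grad f x - grad g x + c *\<^sub>R grad h x"
proof -
  have D: "(u has_derivative frechet_derivative u (at x)) (at x)" if "u differentiable at x" for u :: "real^3 \<Rightarrow> real"
    using that frechet_derivative_works by blast
  show ?thesis
    by (subst grad_eqI[OF has_derivative_add[OF has_derivative_diff[OF D D] has_derivative_mult_right[OF D]]])
       (use assms in \<open>auto simp: grad_def pdiff_def vec_eq_iff\<close>)
qed

context matched
begin

definition dmu_side :: "side \<Rightarrow> nat \<Rightarrow> nat \<Rightarrow> (nat \<Rightarrow> real) \<Rightarrow> real" where
  "dmu_side \<sigma> \<beta> \<alpha> \<rho> = interp P (side_sign \<sigma>) * chem_pot_deriv P (bulkL P) \<beta> \<alpha> \<rho>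
     + (1 - interp P (side_sign \<sigma>)) * chem_pot_deriv P (bulkV P) \<beta> \<alpha> \<rho>"

lemma rho_differentiable:
  assumes "t \<in> {0..<tfin G}" "x \<in> Om G \<sigma> t" "\<alpha> \<in> {1..species P}"
  shows "rho S \<alpha> t differentiable at x"
  using outer_reg(1)[OF assms(3), of \<sigma>] assms(1,2) by (force simp: C0C2_def C0C1_def spacetime_def)

lemma phi0_differentiable:
  assumes "t \<in> {0..<tfin G}" "x \<in> Om G \<sigma> t"
  shows "phi0 S t differentiable at x"
  using outer_reg(4)[of \<sigma>] assms(1,2) by (force simp: C0C2_def C0C1_def spacetime_def)

text \<open>\<open>chi0\<close> is constant on the open set \<open>Om G \<sigma> t\<close>, so the
  chain rule involves the densities only, with \<open>h\<close> frozen at its value in the pure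
  phase.\<close>

lemma mu0_has_derivative:
  assumes t: "t \<in> {0..<tfin G}" and x: "x \<in> Om G \<sigma> t" and b: "\<beta> \<in> {1..species P}"
  shows "(mu0 P S \<beta> t has_derivative
    (\<lambda>h. \<Sum>\<alpha>=1..species P. dmu_side \<sigma> \<beta> \<alpha> (\<lambda>\<alpha>. rho S \<alpha> t x) * frechet_derivative (rho S \<alpha> t) (at x) h)) (at x)"
proof -
  have D: "(rho S \<alpha> t has_derivative frechet_derivative (rho S \<alpha> t) (at x)) (at x)" if "\<alpha> \<in> {1..species P}" for \<alpha>
    using rho_differentiable[OF t x that] frechet_derivative_works by blast
  have pos: "0 < rho S \<alpha> t y" if "y \<in> Om G \<sigma> t" "\<alpha> \<in> {1..species P}" for \<alpha> y
    using outer_reg(2)[OF that(2), of t y \<sigma>] that t by (simp add: spacetime_def)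
  have cp: "((\<lambda>y. chem_pot P K \<beta> (\<lambda>\<alpha>. rho S \<alpha> t y)) has_derivative
      (\<lambda>h. \<Sum>\<alpha>=1..species P. chem_pot_deriv P K \<beta> \<alpha> (\<lambda>\<alpha>. rho S \<alpha> t x)
         * frechet_derivative (rho S \<alpha> t) (at x) h)) (at x)" for K
    by (rule chem_pot_has_derivative[OF adm D pos[OF x] b])
  let ?h = "interp P (side_sign \<sigma>)"
  have "((\<lambda>y. ?h * chem_pot P (bulkL P) \<beta> (\<lambda>\<alpha>. rho S \<alpha> t y) + (1 - ?h) * chem_pot P (bulkV P) \<beta> (\<lambda>\<alpha>. rho S \<alpha> t y))
      has_derivative (\<lambda>h. \<Sum>\<alpha>=1..species P. dmu_side \<sigma> \<beta> \<alpha> (\<lambda>\<alpha>. rho S \<alpha> t x) * frechet_derivative (rho S \<alpha> t) (at x) h)) (at x)"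
    by (rule has_derivative_eq_rhs[OF has_derivative_add[OF has_derivative_mult_right[OF cp] has_derivative_mult_right[OF cp]]])
       (auto simp: dmu_side_def sum_distrib_left sum.distrib[symmetric] algebra_simps)
  then show ?thesis
  proof (rule has_derivative_transform_within_open[OF _ open_Om[OF t] x])
    fix y assume y: "y \<in> Om G \<sigma> t"
    have "mu P \<beta> (\<lambda>\<alpha>. rho S \<alpha> t y) (chi0 S t y)
        = ?h * chem_pot P (bulkL P) \<beta> (\<lambda>\<alpha>. rho S \<alpha> t y) + (1 - ?h) * chem_pot P (bulkV P) \<beta> (\<lambda>\<alpha>. rho S \<alpha> t y)"
      unfolding chi0_bulk[OF t y] by (rule mu_eq[OF adm pos[OF y] b])
    then show "?h * chem_pot P (bulkL P) \<beta> (\<lambda>\<alpha>. rho S \<alpha> t y) + (1 - ?h) * chem_pot P (bulkV P) \<beta> (\<lambda>\<alpha>. rho S \<alpha> t y)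
        = mu0 P S \<beta> t y" by (simp add: mu0_def)
  qed
qed

lemma mu0_differentiable:
  assumes "t \<in> {0..<tfin G}" "x \<in> Om G \<sigma> t" "\<beta> \<in> {1..species P}"
  shows "mu0 P S \<beta> t differentiable at x"
  using mu0_has_derivative[OF assms] by (auto simp: differentiable_def)

text \<open>The matching condition for \<open>M1\<close> refers to the trace of this gradient,
  whereas existence of traces is postulated only for the densities and their gradients. The explicit
  gradient formula supplies it, so that this trace is a genuine limit and jumps of sums can be
  split.\<close>

lemma tendsto_grad_mu0:
  assumes ts: "t \<in> {0..<tfin G}" "s \<in> pdom G" and b: "\<beta> \<in> {1..species P}"
  shows "(grad (mu0 P S \<beta> t) \<longlongrightarrow> tr G \<sigma> t s (grad (mu0 P S \<beta> t))) (nearside \<sigma> t s)"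
proof -
  have eq: "grad (mu0 P S \<beta> t) x
      = (\<Sum>\<alpha>=1..species P. dmu_side \<sigma> \<beta> \<alpha> (\<lambda>\<alpha>. rho S \<alpha> t x) *\<^sub>R grad (rho S \<alpha> t) x)"
    if "x \<in> Om G \<sigma> t" for x
    by (subst grad_eqI[OF mu0_has_derivative[OF ts(1) that b]])
       (simp add: vec_eq_iff grad_def pdiff_def)
  have "((\<lambda>x. \<Sum>\<alpha>=1..species P. dmu_side \<sigma> \<beta> \<alpha> (\<lambda>\<alpha>. rho S \<alpha> t x) *\<^sub>R grad (rho S \<alpha> t) x) \<longlongrightarrow>
     (\<Sum>\<alpha>=1..species P. dmu_side \<sigma> \<beta> \<alpha> (\<lambda>\<alpha>. tr G \<sigma> t s (rho S \<alpha> t)) *\<^sub>R tr G \<sigma> t s (grad (rho S \<alpha> t)))) (nearside \<sigma> t s)"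
    unfolding dmu_side_def
    by (intro tendsto_intros tendsto_chem_pot(2) adm b traces[OF ts])
  moreover have "\<forall>\<^sub>F x in nearside \<sigma> t s. (\<Sum>\<alpha>=1..species P. dmu_side \<sigma> \<beta> \<alpha> (\<lambda>\<alpha>. rho S \<alpha> t x) *\<^sub>R grad (rho S \<alpha> t) x)
      = grad (mu0 P S \<beta> t) x"
    using eventually_nearside_Om by eventually_elim (simp add: eq)
  ultimately have "has_trace G \<sigma> t s (grad (mu0 P S \<beta> t))"
    unfolding has_trace_def using Lim_transform_eventually by blast
  then show ?thesis by (rule tr_tendsto[OF ts])
qed

end

section \<open>Integrating the inner equations\<close>

locale matched_at = matched +
  fixes t :: real and s :: "real^2"
  assumes ts: "t \<in> {0..<tfin G}" "s \<in> pdom G"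
begin

abbreviation "N \<equiv> species P"
abbreviation "\<nu> \<equiv> normal G t s"
abbreviation "w \<equiv> normal_velocity G t s"
abbreviation "\<kappa> \<equiv> mean_curvature G t s"
abbreviation "X \<equiv> X0 I t s"
abbreviation "rho_tr \<sigma> \<alpha> \<equiv> tr G \<sigma> t s (rho S \<alpha> t)"
abbreviation "vel_tr \<sigma> \<equiv> tr G \<sigma> t s (vel S t)"
abbreviation "mu_tr \<sigma> \<beta> \<equiv> mu P \<beta> (rho_tr \<sigma>) (side_sign \<sigma>)"
abbreviation "tot_tr \<sigma> \<equiv> \<Sum>\<alpha>=1..N. rho_tr \<sigma> \<alpha>"
abbreviation "press_tr \<sigma> \<equiv> (\<Sum>\<alpha>=1..N. rho_tr \<sigma> \<alpha> * mu_tr \<sigma> \<alpha>) - rho_f P (rho_tr \<sigma>) (side_sign \<sigma>)"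
abbreviation "grad_mu_tr \<sigma> \<beta> \<equiv> tr G \<sigma> t s (grad (mu0 P S \<beta> t))"
abbreviation "grad_phi_tr \<sigma> \<equiv> tr G \<sigma> t s (grad (phi0 S t))"

lemma species_pos: "N \<in> {1..N}" and species_less: "\<beta> \<in> {1..N - 1} \<Longrightarrow> \<beta> \<in> {1..N}"
  using adm by (auto simp: admissible_def)

lemma gam_pos: "0 < gam P"
  using adm by (simp add: admissible_def)

lemma normal_unit: "\<nu> \<bullet> \<nu> = 1"
  using norm_normal[OF ts] by (simp add: norm_eq_1)

lemma tot_tr_pos: "0 < tot_tr \<sigma>"
  using adm by (intro sum_pos traces(3)[OF ts]) (auto simp: admissible_def)

lemmas X_twice = inner_reg(5)[OF ts] and X1_twice = inner_reg(6)[OF ts]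
  and R_twice = inner_reg(2)[OF ts] and R_pos = inner_reg(1)[OF ts]

lemma
  shows mu0_lim: "\<beta> \<in> {1..N} \<Longrightarrow> (mu0 P S \<beta> t \<longlongrightarrow> mu_tr \<sigma> \<beta>) (nearside \<sigma> t s)"
    and rho_f_lim: "((\<lambda>x. rho_f P (\<lambda>\<alpha>. rho S \<alpha> t x) (chi0 S t x)) \<longlongrightarrow> rho_f P (rho_tr \<sigma>) (side_sign \<sigma>)) (nearside \<sigma> t s)"
    and rho_tot_lim: "(rho_tot P S t \<longlongrightarrow> tot_tr \<sigma>) (nearside \<sigma> t s)"
  unfolding mu0_def[abs_def] rho_tot_def[abs_def]
  by (intro tendsto_mu tendsto_sum adm traces[OF ts] chi0_tr(1)[OF ts]; assumption)+

lemma X_lim: "(X \<longlongrightarrow> side_sign \<sigma>) (far \<sigma>)"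
  using matching(3)[OF ts, of \<sigma>] by (simp add: chi0_tr(2)[OF ts])

lemma X1_lim: "(X1 I t s \<longlongrightarrow> 0) (far \<sigma>)" "(deriv (X1 I t s) \<longlongrightarrow> 0) (far \<sigma>)"
  using matching(8)[OF ts, of \<sigma>] matching(9)[OF ts, of \<sigma>] by (simp_all add: tr_chi1_grad_chi0[OF ts])

lemma
  shows M0_lim: "\<beta> \<in> {1..N} \<Longrightarrow> (M0 P I \<beta> t s \<longlongrightarrow> mu_tr \<sigma> \<beta>) (far \<sigma>)"
    and RF0_lim: "(RF0 P I t s \<longlongrightarrow> rho_f P (rho_tr \<sigma>) (side_sign \<sigma>)) (far \<sigma>)"
    and Rtot_lim: "(Rtot P I t s \<longlongrightarrow> tot_tr \<sigma>) (far \<sigma>)"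
  unfolding M0_def[abs_def] RF0_def[abs_def] Rtot_def[abs_def]
  by (intro tendsto_mu tendsto_sum adm matching(1)[OF ts] traces(3)[OF ts] X_lim; assumption)+

lemma mass_flux_eq: "mass_flux P G S \<sigma> t s = tot_tr \<sigma> * (vel_tr \<sigma> \<bullet> \<nu> - w)"
  by (simp add: mass_flux_def tr_eqI[OF ts rho_tot_lim])

lemma M0_twice: "\<beta> \<in> {1..N} \<Longrightarrow> twice_diff (M0 P I \<beta> t s)"
  unfolding M0_def[abs_def] by (intro twice_diff_mu adm R_twice R_pos X_twice)

lemma M1_twice: "\<beta> \<in> {1..N} \<Longrightarrow> twice_diff (M1 P I \<beta> t s)"
  unfolding M1_def[abs_def]
  by (intro twice_diff_add twice_diff_sum twice_diff_mult twice_diff_mu adm R_twice R_pos X_twice X1_twice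
      inner_reg(3)[OF ts])

lemma Rtot_twice: "twice_diff (Rtot P I t s)"
  unfolding Rtot_def[abs_def] by (intro twice_diff_sum R_twice)

lemma Rtot_pos: "0 < Rtot P I t s z"
  unfolding Rtot_def using adm by (intro sum_pos R_pos) (auto simp: admissible_def)

lemma V0_vector_derivative:
  "(V0 I t s has_vector_derivative vector_derivative (V0 I t s) (at z)) (at z)"
  using inner_reg(4)[OF ts] vector_derivative_works by (auto simp: C1_differentiable_on_eq)

lemma V0_normal_derivative:
  "((\<lambda>z. V0 I t s z \<bullet> \<nu> - w) has_real_derivative vector_derivative (V0 I t s) (at z) \<bullet> \<nu>) (at z)"
proof -
  have "((\<lambda>z. V0 I t s z \<bullet> \<nu>) has_vector_derivative vector_derivative (V0 I t s) (at z) \<bullet> \<nu>) (at z)"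
    using bounded_linear.has_vector_derivative[OF bounded_linear_inner_left V0_vector_derivative] .
  from has_vector_derivative_diff[OF this has_vector_derivative_const]
  show ?thesis by (simp add: has_real_derivative_iff_has_vector_derivative)
qed

lemma V0_normal_differentiable: "(\<lambda>z. V0 I t s z \<bullet> \<nu> - w) differentiable at z"
  using V0_normal_derivative by (auto simp: real_differentiable_def)

text \<open>The side \<open>\<sigma>\<close> is free, so the inner flux equals the outer one on both
  sides. This makes \<open>j0\<close> unambiguous and lets it be treated as a constant in every
  later integration.\<close>

lemma J0_const: "J0 P G I t s z = mass_flux P G S \<sigma> t s"
  unfolding mass_flux_eq
proof (rule deriv_zero_imp_limit[where f = "J0 P G I t s"])
  show "J0 P G I t s differentiable at z" for z
    unfolding J0_def[abs_def]
    by (intro differentiable_mult V0_normal_differentiable twice_diffD(3) Rtot_twice)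
  show "deriv (J0 P G I t s) z = 0" for z using inner_eqs(1)[OF ts] by simp
  show "(J0 P G I t s \<longlongrightarrow> tot_tr \<sigma> * (vel_tr \<sigma> \<bullet> \<nu> - w)) (far \<sigma>)"
    unfolding J0_def[abs_def] by (intro tendsto_intros Rtot_lim matching(2)[OF ts])
qed simp

lemma mass_flux_indep: "mass_flux P G S \<sigma> t s = mass_flux P G S \<sigma>' t s"
  using J0_const by metis

text \<open>The first-order diffusion equation says \<open>\<Sum>\<^sub>\<beta> M\<^sub>\<alpha>\<^sub>\<beta> g\<^sub>\<beta> = 0\<close> for \<open>g\<^sub>\<beta> = (\<mu>\<^sub>\<beta> - \<mu>\<^sub>N)'\<close>, and
  the mobility matrix is positive definite.\<close>

lemma M0_difference_deriv:
  assumes b: "\<beta> \<in> {1..N - 1}"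
  shows "deriv (\<lambda>y. M0 P I \<beta> t s y - M0 P I N t s y) z = 0"
proof (rule ccontr)
  define g where "g = (\<lambda>\<beta>. deriv (\<lambda>y. M0 P I \<beta> t s y - M0 P I N t s y))"
  assume "deriv (\<lambda>y. M0 P I \<beta> t s y - M0 P I N t s y) z \<noteq> 0"
  then have "g \<beta> z \<noteq> 0" by (simp add: g_def)
  moreover have "\<forall>\<xi>. (\<exists>\<alpha>\<in>{1..N - 1}. \<xi> \<alpha> \<noteq> 0) \<longrightarrow>
      0 < (\<Sum>\<alpha>=1..N - 1. \<Sum>\<beta>=1..N - 1. \<xi> \<alpha> * diff_mob P \<alpha> \<beta> * \<xi> \<beta>)"
    using adm unfolding admissible_def by blast
  ultimately have pos: "0 < (\<Sum>\<alpha>=1..N - 1. \<Sum>\<beta>=1..N - 1. g \<alpha> z * diff_mob P \<alpha> \<beta> * g \<beta> z)"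
    using b spec[of _ "\<lambda>\<alpha>. g \<alpha> z"] by blast
  have td: "twice_diff (\<lambda>y. M0 P I \<beta> t s y - M0 P I N t s y)" if "\<beta> \<in> {1..N - 1}" for \<beta>
    by (intro twice_diff_diff M0_twice species_pos species_less that)
  have geq: "g \<beta> = (\<lambda>z. deriv (M0 P I \<beta> t s) z - deriv (M0 P I N t s) z)" if "\<beta> \<in> {1..N - 1}" for \<beta>
    unfolding g_def
    by (intro ext DERIV_imp_deriv DERIV_diff twice_diffD(1) M0_twice species_pos species_less that)
  have "(\<Sum>\<beta>=1..N - 1. diff_mob P \<alpha> \<beta> * g \<beta> z) = 0" if a: "\<alpha> \<in> {1..N - 1}" for \<alpha>
  proof (rule deriv_zero_imp_limit[where f = "\<lambda>y. \<Sum>\<beta>=1..N - 1. diff_mob P \<alpha> \<beta> * g \<beta> y"])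
    show "(\<lambda>y. \<Sum>\<beta>=1..N - 1. diff_mob P \<alpha> \<beta> * g \<beta> y) differentiable at z" for z
      using td unfolding g_def
      by (intro differentiable_sum ballI differentiable_mult differentiable_const twice_diffD(4)) simp_all
    show "deriv (\<lambda>y. \<Sum>\<beta>=1..N - 1. diff_mob P \<alpha> \<beta> * g \<beta> y) z = 0" for z
      using inner_eqs(3)[OF ts a, of z] by (simp add: g_def Phi0_deriv[OF ts])
    have "((\<lambda>y. \<Sum>\<beta>=1..N - 1. diff_mob P \<alpha> \<beta> * g \<beta> y) \<longlongrightarrow> (\<Sum>\<beta>=1..N - 1. diff_mob P \<alpha> \<beta> * (0 - 0))) (far Plus)"
    proof (intro tendsto_sum tendsto_mult tendsto_const)
      fix \<beta> assume "\<beta> \<in> {1..N - 1}"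
      then show "(g \<beta> \<longlongrightarrow> 0 - 0) (far Plus)"
        unfolding geq[OF \<open>\<beta> \<in> {1..N - 1}\<close>]
        by (intro tendsto_diff matching(7)[OF ts] species_pos species_less)
    qed
    then show "((\<lambda>y. \<Sum>\<beta>=1..N - 1. diff_mob P \<alpha> \<beta> * g \<beta> y) \<longlongrightarrow> 0) (far Plus)" by simp
  qed simp
  then have "(\<Sum>\<alpha>=1..N - 1. g \<alpha> z * (\<Sum>\<beta>=1..N - 1. diff_mob P \<alpha> \<beta> * g \<beta> z)) = 0"
    by (intro sum.neutral) auto
  then show False using pos by (simp add: sum_distrib_left mult.assoc)
qed

text \<open>All potentials share one slope across the layer. In the Gibbs-Duhem sum this collapses
  the density-weighted slopes to the total density times the slope of the last potential.\<close>

lemma M0_deriv_eq: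
  assumes "\<beta> \<in> {1..N}"
  shows "deriv (M0 P I \<beta> t s) z = deriv (M0 P I N t s) z"
proof (cases "\<beta> = N")
  case False
  then have b: "\<beta> \<in> {1..N - 1}" using assms by auto
  have "deriv (\<lambda>y. M0 P I \<beta> t s y - M0 P I N t s y) z = deriv (M0 P I \<beta> t s) z - deriv (M0 P I N t s) z"
    by (intro DERIV_imp_deriv DERIV_diff twice_diffD(1) M0_twice species_pos assms)
  then show ?thesis using M0_difference_deriv[OF b] by simp
qed simp

section \<open>Jump conditions for potentials and fluxes\<close>

lemma mu_difference_jump:
  assumes b: "\<beta> \<in> {1..N - 1}"
  shows "jump G t s (\<lambda>x. mu0 P S \<beta> t x - mu0 P S N t x) = 0"
proof -
  \<comment> \<open>The point \<open>z = 0\<close> is arbitrary: the constant value is compared with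
    its limits on the two sides.\<close>
  have "M0 P I \<beta> t s 0 - M0 P I N t s 0 = mu_tr \<sigma> \<beta> - mu_tr \<sigma> N" for \<sigma>
  proof (rule deriv_zero_imp_limit[where f = "\<lambda>y. M0 P I \<beta> t s y - M0 P I N t s y"])
    show "(\<lambda>y. M0 P I \<beta> t s y - M0 P I N t s y) differentiable at z" for z
      by (intro twice_diffD(3) twice_diff_diff M0_twice species_pos species_less b)
    show "((\<lambda>y. M0 P I \<beta> t s y - M0 P I N t s y) \<longlongrightarrow> mu_tr \<sigma> \<beta> - mu_tr \<sigma> N) (far \<sigma>)"
      by (intro tendsto_diff M0_lim species_pos species_less b)
  qed (use M0_difference_deriv[OF b] in auto)
  from this[of Plus] this[of Minus] show ?thesis
    by (subst jump_eqI[OF ts, of _ "\<lambda>\<sigma>. mu_tr \<sigma> \<beta> - mu_tr \<sigma> N"])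
       (auto intro!: tendsto_diff mu0_lim species_pos species_less[OF b])
qed

lemma mass_flux_jump: "jump G t s (\<lambda>x. rho_tot P S t x * (vel S t x \<bullet> \<nu> - w)) = 0"
proof -
  have "jump G t s (\<lambda>x. rho_tot P S t x * (vel S t x \<bullet> \<nu> - w))
      = tot_tr Plus * (vel_tr Plus \<bullet> \<nu> - w) - tot_tr Minus * (vel_tr Minus \<bullet> \<nu> - w)"
    by (rule jump_eqI[OF ts, of _ "\<lambda>\<sigma>. tot_tr \<sigma> * (vel_tr \<sigma> \<bullet> \<nu> - w)"])
       (intro tendsto_intros rho_tot_lim traces(4)[OF ts])
  then show ?thesis using mass_flux_indep[of Plus Minus] by (simp add: mass_flux_eq)
qed

lemma phi_jump: "jump G t s (phi0 S t) = 0"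
proof -
  have "Phi0 I t s 0 = tr G \<sigma> t s (phi0 S t)" for \<sigma>
    by (rule deriv_zero_imp_limit[OF _ _ matching(4)[OF ts]])
       (auto simp: Phi0_deriv[OF ts] intro: twice_diffD inner_reg[OF ts])
  from this[of Plus] this[of Minus] show ?thesis by (simp add: jump_def)
qed

text \<open>The first-order species equation has the first integral \<open>H\<close>, convective
  minus diffusive flux. Its limits contain the normal components of the outer gradients because
  \<open>M1\<close> and \<open>Phi1\<close> match the normal derivatives of the outer
  fields.\<close>

lemma species_flux_jump:
  assumes a: "\<alpha> \<in> {1..N - 1}"
  shows "jump G t s (\<lambda>x. rho S \<alpha> t x * (vel S t x \<bullet> \<nu> - w))
     - jump G t s (\<lambda>x. \<Sum>\<beta>=1..N - 1. diff_mob P \<alpha> \<beta> *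
         (grad (\<lambda>y. mu0 P S \<beta> t y - mu0 P S N t y + zrel P \<beta> * phi0 S t y) x \<bullet> \<nu>)) = 0"
proof -
  define d where "d = (\<lambda>\<beta> y. M1 P I \<beta> t s y - M1 P I N t s y)"
  define flux where "flux = (\<lambda>\<sigma>. \<Sum>\<beta>=1..N - 1. diff_mob P \<alpha> \<beta> *
      ((grad_mu_tr \<sigma> \<beta> - grad_mu_tr \<sigma> N + zrel P \<beta> *\<^sub>R grad_phi_tr \<sigma>) \<bullet> \<nu>))"
  define H where "H = (\<lambda>y. R0 I \<alpha> t s y * (V0 I t s y \<bullet> \<nu> - w)
      - (\<Sum>\<beta>=1..N - 1. diff_mob P \<alpha> \<beta> * (deriv (d \<beta>) y + zrel P \<beta> * deriv (Phi1 I t s) y)))"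
  have td: "twice_diff (d \<beta>)" if "\<beta> \<in> {1..N - 1}" for \<beta>
    unfolding d_def by (intro twice_diff_diff M1_twice species_pos species_less that)
  have deq: "deriv (d \<beta>) = (\<lambda>z. deriv (M1 P I \<beta> t s) z - deriv (M1 P I N t s) z)" if "\<beta> \<in> {1..N - 1}" for \<beta>
    unfolding d_def
    by (intro ext DERIV_imp_deriv DERIV_diff twice_diffD(1) M1_twice species_pos species_less that)
  have RV: "((\<lambda>y. R0 I \<alpha> t s y * (V0 I t s y \<bullet> \<nu> - w)) has_real_derivative
      deriv (\<lambda>y. R0 I \<alpha> t s y * (V0 I t s y \<bullet> \<nu> - w)) z) (at z)" for z
    unfolding DERIV_deriv_iff_real_differentiable
    by (intro differentiable_mult V0_normal_differentiable twice_diffD(3) R_twice species_less a)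
  have sum': "((\<lambda>y. \<Sum>\<beta>=1..N - 1. diff_mob P \<alpha> \<beta> * (deriv (d \<beta>) y + zrel P \<beta> * deriv (Phi1 I t s) y)) has_real_derivative
      (\<Sum>\<beta>=1..N - 1. diff_mob P \<alpha> \<beta> * (deriv (deriv (d \<beta>)) z + zrel P \<beta> * deriv (deriv (Phi1 I t s)) z))) (at z)" for z
    by (intro DERIV_sum DERIV_cmult DERIV_add twice_diffD(2) td inner_reg(8)[OF ts])
  \<comment> \<open>Both curvature terms drop out: the differences of the leading-order potentials
    and \<open>Phi0\<close> are constant in \<open>z\<close>.\<close>
  have H: "(H has_real_derivative 0) (at z)" for z
    unfolding H_def
    by (rule DERIV_cong[OF DERIV_diff[OF RV sum']])
       (use inner_eqs(8)[OF ts a, of z] in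
        \<open>auto simp: d_def M0_difference_deriv Phi0_deriv[OF ts] intro!: sum.cong\<close>)
  have "H 0 = rho_tr \<sigma> \<alpha> * (vel_tr \<sigma> \<bullet> \<nu> - w) - flux \<sigma>" for \<sigma>
  proof (rule deriv_zero_imp_limit[where f = H])
    show "H differentiable at z" for z using H by (auto simp: real_differentiable_def)
    show "deriv H z = 0" for z using H by (rule DERIV_imp_deriv)
    have "((\<lambda>y. deriv (d \<beta>) y + zrel P \<beta> * deriv (Phi1 I t s) y)
        \<longlongrightarrow> (grad_mu_tr \<sigma> \<beta> - grad_mu_tr \<sigma> N + zrel P \<beta> *\<^sub>R grad_phi_tr \<sigma>) \<bullet> \<nu>) (far \<sigma>)"
      if b: "\<beta> \<in> {1..N - 1}" for \<beta>
      unfolding deq[OF b] inner_add_left inner_diff_left inner_scaleR_left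
      by (intro tendsto_intros matching[OF ts] species_pos species_less[OF b])
    then show "(H \<longlongrightarrow> rho_tr \<sigma> \<alpha> * (vel_tr \<sigma> \<bullet> \<nu> - w) - flux \<sigma>) (far \<sigma>)"
      unfolding H_def flux_def
      by (intro tendsto_intros matching[OF ts] species_less[OF a])
  qed simp
  from this[of Plus] this[of Minus]
  have "rho_tr Plus \<alpha> * (vel_tr Plus \<bullet> \<nu> - w) - rho_tr Minus \<alpha> * (vel_tr Minus \<bullet> \<nu> - w) - (flux Plus - flux Minus) = 0"
    by simp
  moreover have "jump G t s (\<lambda>x. rho S \<alpha> t x * (vel S t x \<bullet> \<nu> - w))
      = rho_tr Plus \<alpha> * (vel_tr Plus \<bullet> \<nu> - w) - rho_tr Minus \<alpha> * (vel_tr Minus \<bullet> \<nu> - w)"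
    by (rule jump_eqI[OF ts, of _ "\<lambda>\<sigma>. rho_tr \<sigma> \<alpha> * (vel_tr \<sigma> \<bullet> \<nu> - w)"])
       (intro tendsto_intros traces[OF ts] species_less[OF a])
  moreover have "jump G t s (\<lambda>x. \<Sum>\<beta>=1..N - 1. diff_mob P \<alpha> \<beta> *
         (grad (\<lambda>y. mu0 P S \<beta> t y - mu0 P S N t y + zrel P \<beta> * phi0 S t y) x \<bullet> \<nu>)) = flux Plus - flux Minus"
  proof (rule jump_eqI[OF ts])
    fix \<sigma>
    have "((\<lambda>x. \<Sum>\<beta>=1..N - 1. diff_mob P \<alpha> \<beta> *
        ((grad (mu0 P S \<beta> t) x - grad (mu0 P S N t) x + zrel P \<beta> *\<^sub>R grad (phi0 S t) x) \<bullet> \<nu>)) \<longlongrightarrow> flux \<sigma>) (nearside \<sigma> t s)"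
      unfolding flux_def
      by (intro tendsto_intros tendsto_grad_mu0[OF ts] traces[OF ts] species_pos species_less)
    \<comment> \<open>The gradient of the combination splits only where all fields are
      differentiable, that is, in the bulk near the interface point.\<close>
    moreover have "\<forall>\<^sub>F x in nearside \<sigma> t s.
        (\<Sum>\<beta>=1..N - 1. diff_mob P \<alpha> \<beta> *
          ((grad (mu0 P S \<beta> t) x - grad (mu0 P S N t) x + zrel P \<beta> *\<^sub>R grad (phi0 S t) x) \<bullet> \<nu>))
        = (\<Sum>\<beta>=1..N - 1. diff_mob P \<alpha> \<beta> *
          (grad (\<lambda>y. mu0 P S \<beta> t y - mu0 P S N t y + zrel P \<beta> * phi0 S t y) x \<bullet> \<nu>))"
      using eventually_nearside_Om
    proof eventually_elim
      case (elim x)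
      show ?case
        by (intro sum.cong refl, subst grad_combination)
           (auto intro!: mu0_differentiable[OF ts(1) elim] phi0_differentiable[OF ts(1) elim] species_pos[simplified]
             dest: species_less[simplified])
    qed
    ultimately show "((\<lambda>x. \<Sum>\<beta>=1..N - 1. diff_mob P \<alpha> \<beta> *
        (grad (\<lambda>y. mu0 P S \<beta> t y - mu0 P S N t y + zrel P \<beta> * phi0 S t y) x \<bullet> \<nu>)) \<longlongrightarrow> flux \<sigma>) (nearside \<sigma> t s)"
      by (rule Lim_transform_eventually)
  qed
  ultimately show ?thesis by simp
qed

text \<open>The charge density is minus the derivative of \<open>K\<close>, which converges at both
  ends, so its integral exists. The integral enters with a plus sign, as the charge density does in
  the inner equation.\<close>

lemma Poisson_jump:
  shows "(\<lambda>z. \<Sum>\<alpha>=1..N. charge P \<alpha> / mass P \<alpha> * R0 I \<alpha> t s z) integrable_on UNIV"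
    and "jump G t s (\<lambda>x. (1 + susc P (chi0 S t x)) * (grad (phi0 S t) x \<bullet> \<nu>))
       + integral UNIV (\<lambda>z. \<Sum>\<alpha>=1..N. charge P \<alpha> / mass P \<alpha> * R0 I \<alpha> t s z) = 0"
proof -
  let ?Q = "\<lambda>z. \<Sum>\<alpha>=1..N. charge P \<alpha> / mass P \<alpha> * R0 I \<alpha> t s z"
  define K where "K = (\<lambda>y. (1 + susc P (X y)) * deriv (Phi1 I t s) y)"
  define L where "L = (\<lambda>\<sigma>. (1 + susc P (side_sign \<sigma>)) * (grad_phi_tr \<sigma> \<bullet> \<nu>))"
  have "twice_diff (\<lambda>y. 1 + susc P (X y))"
    by (intro twice_diff_add twice_diff_const twice_diff_compose[OF twice_diff_susc] adm X_twice)
  then have "K differentiable at z" for z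
    unfolding K_def by (intro differentiable_mult twice_diffD(3) twice_diffD(4) inner_reg(8)[OF ts])
  moreover have "deriv K z = - ?Q z" for z
    using inner_eqs(9)[OF ts, of z] unfolding K_def by linarith
  ultimately have "(K has_real_derivative - ?Q z) (at z)" for z
    using DERIV_deriv_iff_real_differentiable by metis
  moreover have c: "isCont (susc P) a" for a
    using twice_diffD(1)[OF twice_diff_susc[OF adm]] DERIV_isCont by blast
  have "(K \<longlongrightarrow> L \<sigma>) (far \<sigma>)" for \<sigma>
    unfolding K_def L_def by (intro tendsto_intros isCont_tendsto_compose[OF c] X_lim matching[OF ts])
  note this[of Plus] this[of Minus]
  ultimately have "((\<lambda>z. - ?Q z) has_integral L Plus - L Minus) UNIV"
    by (intro has_integral_UNIV_antiderivative[of K])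
       (simp_all add: has_real_derivative_iff_has_vector_derivative)
  from has_integral_neg[OF this] have Q: "(?Q has_integral - (L Plus - L Minus)) UNIV"
    by simp
  have "jump G t s (\<lambda>x. (1 + susc P (chi0 S t x)) * (grad (phi0 S t) x \<bullet> \<nu>)) = L Plus - L Minus"
    by (rule jump_eqI[OF ts], unfold L_def)
       (intro tendsto_intros isCont_tendsto_compose[OF c] chi0_tr[OF ts] traces[OF ts])
  then show "jump G t s (\<lambda>x. (1 + susc P (chi0 S t x)) * (grad (phi0 S t) x \<bullet> \<nu>)) + integral UNIV ?Q = 0"
    using integral_unique[OF Q] by simp
  show "?Q integrable_on UNIV" using Q by blast
qed

section \<open>Profile equation, momentum balance and the jump of the last potential\<close>

lemma profile_equation: "gam P * deriv (deriv X) z = deriv W (X z)"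
  using inner_eqs(5)[OF ts, of z] by (simp add: Phi0_deriv[OF ts])

lemma X_square_integrable: "(\<lambda>z. (deriv X z)^2) integrable_on UNIV"
  using profile_square_integrable[OF X_twice gam_pos profile_equation] X_lim[of Plus] X_lim[of Minus]
    matching(5)[OF ts, of Plus] matching(5)[OF ts, of Minus] by simp

text \<open>The weight stays bounded because \<open>Rtot\<close> is positive and its limits, the
  traces of the total density, are positive too.\<close>

lemma X_weighted_square_integrable: "(\<lambda>z. 1 / Rtot P I t s z * (deriv X z)^2) integrable_on UNIV"
proof (rule integrable_bounded_mult[OF _ _ _ _ _ X_square_integrable])
  show "isCont (\<lambda>z. 1 / Rtot P I t s z) z" for z
    using DERIV_isCont[OF twice_diffD(1)[OF Rtot_twice]] Rtot_pos[of z] by (intro continuous_intros) auto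
  have "((\<lambda>z. 1 / Rtot P I t s z) \<longlongrightarrow> 1 / tot_tr \<sigma>) (far \<sigma>)" for \<sigma>
    using tot_tr_pos[of \<sigma>] by (intro tendsto_intros Rtot_lim) auto
  from this[of Plus] this[of Minus]
  show "((\<lambda>z. 1 / Rtot P I t s z) \<longlongrightarrow> 1 / tot_tr Plus) at_top" "((\<lambda>z. 1 / Rtot P I t s z) \<longlongrightarrow> 1 / tot_tr Minus) at_bot"
    by simp_all
  show "isCont (\<lambda>z. (deriv X z)^2) z" for z
    using DERIV_isCont[OF twice_diffD(2)[OF X_twice]] by (intro continuous_intros)
qed simp

text \<open>Combined with \<open>profile_equation\<close>, this makes the two surface-gradient terms
  of the momentum equation cancel, leaving only the velocity term and multiples of the
  normal.\<close>

lemma surf_grad_W: "surf_grad G t (\<lambda>q. W (X0 I t q z)) s = deriv W (X z) *\<^sub>R surf_grad G t (\<lambda>q. X0 I t q z) s"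
proof -
  have "(\<lambda>q. X0 I t q z) differentiable at s"
    using inner_reg(9)[OF ts, of z] ts unfolding C1_on_def by blast
  then have D: "((\<lambda>q. X0 I t q z) has_derivative frechet_derivative (\<lambda>q. X0 I t q z) (at s)) (at s)"
    using frechet_derivative_works by blast
  have "(W has_derivative (*) (deriv W (X z))) (at (X z))"
    using W_has_derivative[of "X z"] by (simp add: has_field_derivative_def deriv_W)
  from has_derivative_compose[OF D this]
  have "frechet_derivative (\<lambda>q. W (X0 I t q z)) (at s) = (\<lambda>h. deriv W (X z) * frechet_derivative (\<lambda>q. X0 I t q z) (at s) h)"
    using frechet_derivative_at by metis
  then show ?thesis
    by (simp add: surf_grad_def pdiff_def scaleR_sum_right algebra_simps)
qed

text \<open>The pressure inside the layer, corrected by the first-order double-well term; the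
  correction disappears in the limits since \<open>X1\<close> tends to 0.\<close>

definition inner_press :: "real \<Rightarrow> real" where
  "inner_press y = (\<Sum>\<alpha>=1..N. R0 I \<alpha> t s y * M0 P I \<alpha> t s y) - RF0 P I t s y - deriv W (X y) * X1 I t s y"

text \<open>The Gibbs-Duhem relation. The terms with derivatives of the densities cancel between the
  product rule and \<open>RF0\<close>; the remaining sum over potential slopes collapses by
  \<open>M0_deriv_eq\<close>.\<close>

lemma inner_press_derivative:
  "(inner_press has_real_derivative Rtot P I t s z * deriv (M0 P I N t s) z
     - drf_dchi P (\<lambda>\<alpha>. R0 I \<alpha> t s z) (X z) * deriv X z
     - (deriv (deriv W) (X z) * deriv X z * X1 I t s z + deriv W (X z) * deriv (X1 I t s) z)) (at z)"
proof -
  note DR = twice_diffD(1)[OF R_twice] and DX = twice_diffD(1)[OF X_twice] and DX1 = twice_diffD(1)[OF X1_twice]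
  have RF: "(RF0 P I t s has_real_derivative
      (\<Sum>\<alpha>=1..N. M0 P I \<alpha> t s z * deriv (R0 I \<alpha> t s) z) + drf_dchi P (\<lambda>\<alpha>. R0 I \<alpha> t s z) (X z) * deriv X z) (at z)"
    unfolding RF0_def[abs_def] M0_def by (intro rho_f_curve_derivative adm DR R_pos DX)
  have "((\<lambda>y. \<Sum>\<alpha>=1..N. R0 I \<alpha> t s y * M0 P I \<alpha> t s y) has_real_derivative
      (\<Sum>\<alpha>=1..N. deriv (R0 I \<alpha> t s) z * M0 P I \<alpha> t s z + deriv (M0 P I \<alpha> t s) z * R0 I \<alpha> t s z)) (at z)"
    by (intro DERIV_sum DERIV_mult DR twice_diffD(1)[OF M0_twice])
  moreover have "((\<lambda>y. deriv W (X y)) has_real_derivative deriv (deriv W) (X z) * deriv X z) (at z)"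
    by (rule DERIV_chain2[OF twice_diffD(1)[OF twice_diff_deriv_W] DX])
  moreover have "(\<Sum>\<alpha>=1..N. deriv (M0 P I \<alpha> t s) z * R0 I \<alpha> t s z) = Rtot P I t s z * deriv (M0 P I N t s) z"
    unfolding Rtot_def sum_distrib_right by (intro sum.cong refl) (subst M0_deriv_eq; simp)
  ultimately show ?thesis
    unfolding inner_press_def[abs_def]
    by (intro DERIV_cong[OF DERIV_diff[OF DERIV_diff[OF _ RF] DERIV_mult[OF _ DX1]]])
       (assumption | simp add: sum.distrib algebra_simps)+
qed

lemma inner_press_lim: "(inner_press \<longlongrightarrow> press_tr \<sigma>) (far \<sigma>)"
proof -
  have "isCont (deriv W) c" for c
    using DERIV_isCont[OF twice_diffD(1)[OF twice_diff_deriv_W]] .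
  then have "((\<lambda>y. deriv W (X y)) \<longlongrightarrow> deriv W (side_sign \<sigma>)) (far \<sigma>)"
    using isCont_tendsto_compose X_lim by blast
  then have "(inner_press \<longlongrightarrow> press_tr \<sigma> - deriv W (side_sign \<sigma>) * 0) (far \<sigma>)"
    unfolding inner_press_def[abs_def]
    by (intro tendsto_intros matching(1)[OF ts] M0_lim RF0_lim X1_lim)
  then show ?thesis by simp
qed

lemma momentum_equation:
  "J0 P G I t s z *\<^sub>R vector_derivative (V0 I t s) (at z)
     + (deriv inner_press z + gam P * (deriv X z * deriv (deriv (X1 I t s)) z + deriv (deriv X) z * deriv (X1 I t s) z)) *\<^sub>R \<nu>
   = (gam P * \<kappa> * (deriv X z)^2) *\<^sub>R \<nu>"
proof -
  have "deriv (\<lambda>y. (\<Sum>\<alpha>=1..N. R0 I \<alpha> t s y * M0 P I \<alpha> t s y) - RF0 P I t s y - deriv W (X y) * X1 I t s y) z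
      = deriv inner_press z"
    by (simp add: inner_press_def[abs_def])
  then show ?thesis
    using inner_eqs(6)[OF ts, of z] unfolding surf_grad_W profile_equation
    by (simp add: algebra_simps)
qed

text \<open>The two products of derivatives of \<open>X0\<close> and \<open>X1\<close> form the
  exact derivative of \<open>X0_z X1_z\<close>, which vanishes at both ends. Only the curvature term
  has to be integrated.\<close>

lemma momentum_jump:
  "jump G t s (\<lambda>x. mass_flux P G S \<sigma> t s *\<^sub>R vel S t x
      + ((\<Sum>\<alpha>=1..N. rho S \<alpha> t x * mu0 P S \<alpha> t x) - rho_f P (\<lambda>\<alpha>. rho S \<alpha> t x) (chi0 S t x)) *\<^sub>R \<nu>)
    = (gam P * \<kappa> * integral UNIV (\<lambda>z. (deriv X z)^2)) *\<^sub>R \<nu>"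
proof -
  let ?j = "mass_flux P G S \<sigma> t s"
  define K where "K = (\<lambda>y. ?j *\<^sub>R V0 I t s y
      + (inner_press y + gam P * (deriv X y * deriv (X1 I t s) y)) *\<^sub>R \<nu>)"
  define L where "L = (\<lambda>\<sigma>. ?j *\<^sub>R vel_tr \<sigma> + press_tr \<sigma> *\<^sub>R \<nu>)"
  have "(K has_vector_derivative (gam P * \<kappa> * (deriv X z)^2) *\<^sub>R \<nu>) (at z)" for z
  proof -
    have "((\<lambda>y. inner_press y + gam P * (deriv X y * deriv (X1 I t s) y)) has_real_derivative
        deriv inner_press z + gam P * (deriv (deriv X) z * deriv (X1 I t s) z + deriv (deriv (X1 I t s)) z * deriv X z)) (at z)"
      using inner_press_derivative[of z] DERIV_imp_deriv[OF inner_press_derivative[of z]]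
      by (intro DERIV_add DERIV_cmult DERIV_mult twice_diffD(2) X_twice X1_twice) simp
    from has_vector_derivative_add[OF bounded_linear.has_vector_derivative[OF bounded_linear_scaleR_right V0_vector_derivative]
        has_vector_derivative_scaleR[OF this has_vector_derivative_const]]
    have "(K has_vector_derivative ?j *\<^sub>R vector_derivative (V0 I t s) (at z)
        + (deriv inner_press z + gam P * (deriv (deriv X) z * deriv (X1 I t s) z + deriv (deriv (X1 I t s)) z * deriv X z)) *\<^sub>R \<nu>) (at z)"
      unfolding K_def by simp
    then show ?thesis
      using momentum_equation[of z] by (simp add: J0_const[of _ \<sigma>] algebra_simps)
  qed
  moreover have "(K \<longlongrightarrow> L \<sigma>') (far \<sigma>')" for \<sigma>'
  proof -
    have "(K \<longlongrightarrow> ?j *\<^sub>R vel_tr \<sigma>' + (press_tr \<sigma>' + gam P * (0 * 0)) *\<^sub>R \<nu>) (far \<sigma>')"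
      unfolding K_def by (intro tendsto_intros matching(2)[OF ts] inner_press_lim matching(5)[OF ts] X1_lim)
    then show ?thesis by (simp add: L_def)
  qed
  note this[of Plus] this[of Minus]
  ultimately have "((\<lambda>z. (gam P * \<kappa> * (deriv X z)^2) *\<^sub>R \<nu>) has_integral L Plus - L Minus) UNIV"
    by (intro has_integral_UNIV_antiderivative[of K]) simp_all
  moreover have "((\<lambda>z. (gam P * \<kappa> * (deriv X z)^2) *\<^sub>R \<nu>) has_integral
      (gam P * \<kappa> * integral UNIV (\<lambda>z. (deriv X z)^2)) *\<^sub>R \<nu>) UNIV"
    by (intro has_integral_scaleR_left has_integral_mult_right integrable_integral X_square_integrable)
  ultimately have "L Plus - L Minus = (gam P * \<kappa> * integral UNIV (\<lambda>z. (deriv X z)^2)) *\<^sub>R \<nu>"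
    by (rule has_integral_unique)
  moreover have "jump G t s (\<lambda>x. ?j *\<^sub>R vel S t x
      + ((\<Sum>\<alpha>=1..N. rho S \<alpha> t x * mu0 P S \<alpha> t x) - rho_f P (\<lambda>\<alpha>. rho S \<alpha> t x) (chi0 S t x)) *\<^sub>R \<nu>) = L Plus - L Minus"
    by (rule jump_eqI[OF ts], unfold L_def)
       (intro tendsto_intros traces[OF ts] mu0_lim rho_f_lim)
  ultimately show ?thesis by simp
qed

text \<open>The normal momentum equation divided by \<open>R\<close>, in which the phase-field equation times \<open>X'\<close>
  eliminates everything but \<open>\<mu>\<^sub>N\<close>, the kinetic term and the dissipation.\<close>

lemma mu_N_jump:
  "jump G t s (\<lambda>x. (mass_flux P G S \<sigma> t s)^2 / (2 * (rho_tot P S t x)^2) + mu0 P S N t x)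
    + mass_flux P G S \<sigma> t s / tau P * integral UNIV (\<lambda>z. 1 / Rtot P I t s z * (deriv X z)^2) = 0"
proof -
  let ?j = "mass_flux P G S \<sigma> t s"
  let ?R = "Rtot P I t s"
  \<comment> \<open>By constancy of the flux, \<open>V0 \<bullet> \<nu> - w = j / R\<close>. Hence
    \<open>j\<close> times the slope of the normal velocity, divided by \<open>R\<close>, is the
    derivative of \<open>j^2 / (2 R^2)\<close>; this is the origin of the kinetic term.\<close>
  define T where "T = (\<lambda>y. ?j^2 / (2 * (?R y)^2) + M0 P I N t s y)"
  define L where "L = (\<lambda>\<sigma>. ?j^2 / (2 * (tot_tr \<sigma>)^2) + mu_tr \<sigma> N)"
  have DR: "(?R has_real_derivative deriv ?R z) (at z)" for z
    by (rule twice_diffD(1)[OF Rtot_twice])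
  have "(T has_real_derivative - (?j / tau P) * (1 / ?R z * (deriv X z)^2)) (at z)" for z
  proof -
    have R: "0 < ?R z" by (rule Rtot_pos)
    define v where "v = vector_derivative (V0 I t s) (at z) \<bullet> \<nu>"
    have "V0 I t s y \<bullet> \<nu> - w = ?j / ?R y" for y
      using J0_const[of y \<sigma>] Rtot_pos[of y] by (simp add: J0_def field_simps)
    then have "((\<lambda>y. ?j / ?R y) has_real_derivative v) (at z)"
      using V0_normal_derivative[of z] by (simp add: v_def)
    moreover have "((\<lambda>y. ?j / ?R y) has_real_derivative - (?j * deriv ?R z) / (?R z)^2) (at z)"
      using R by (auto intro!: derivative_eq_intros DR simp: power2_eq_square field_simps)
    ultimately have v: "v = - (?j * deriv ?R z) / (?R z)^2"
      by (rule DERIV_unique)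
    have "?j * v + (deriv inner_press z + gam P * (deriv X z * deriv (deriv (X1 I t s)) z
        + deriv (deriv X) z * deriv (X1 I t s) z)) = gam P * \<kappa> * (deriv X z)^2"
      using arg_cong[OF momentum_equation[of z], of "\<lambda>u. u \<bullet> \<nu>"]
      by (simp add: inner_add_left normal_unit v_def J0_const[of _ \<sigma>])
    moreover have "(?j / tau P * deriv X z + deriv (deriv W) (X z) * X1 I t s z
        - gam P * deriv (deriv (X1 I t s)) z + gam P * \<kappa> * deriv X z + drf_dchi P (\<lambda>\<alpha>. R0 I \<alpha> t s z) (X z)) * deriv X z = 0"
      using inner_eqs(7)[OF ts, of z] by (simp add: J0_const[of _ \<sigma>])
    \<comment> \<open>On adding the two equations, the terms with curvature, \<open>W''\<close>,
      \<open>X1_zz\<close> and the free-energy force cancel directly, and those with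
      \<open>X1_z\<close> cancel by the profile equation.\<close>
    ultimately have M: "?R z * deriv (M0 P I N t s) z = - ?j * v - ?j / tau P * (deriv X z)^2"
      unfolding DERIV_imp_deriv[OF inner_press_derivative] profile_equation[symmetric] by (simp add: algebra_simps power2_eq_square)
    have "(T has_real_derivative - (?j^2 * deriv ?R z) / (?R z)^3 + deriv (M0 P I N t s) z) (at z)"
      unfolding T_def using R
      by (auto intro!: derivative_eq_intros DR twice_diffD(1)[OF M0_twice] species_pos
          simp: power2_eq_square power3_eq_cube field_simps)
    moreover have "deriv (M0 P I N t s) z = (- ?j * v - ?j / tau P * (deriv X z)^2) / ?R z"
      using M R by (simp add: field_simps)
    then have "- (?j^2 * deriv ?R z) / (?R z)^3 + deriv (M0 P I N t s) z = - (?j / tau P) * (1 / ?R z * (deriv X z)^2)"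
      using R unfolding v by (simp add: field_simps power2_eq_square power3_eq_cube)
    ultimately show ?thesis by simp
  qed
  moreover have "(T \<longlongrightarrow> L \<sigma>') (far \<sigma>')" for \<sigma>'
    unfolding T_def L_def
    using tot_tr_pos[of \<sigma>'] by (intro tendsto_intros Rtot_lim M0_lim species_pos) auto
  note this[of Plus] this[of Minus]
  ultimately have "((\<lambda>z. - (?j / tau P) * (1 / ?R z * (deriv X z)^2)) has_integral L Plus - L Minus) UNIV"
    by (intro has_integral_UNIV_antiderivative[of T])
       (simp_all add: has_real_derivative_iff_has_vector_derivative)
  moreover have "((\<lambda>z. - (?j / tau P) * (1 / ?R z * (deriv X z)^2)) has_integral
      - (?j / tau P) * integral UNIV (\<lambda>z. 1 / ?R z * (deriv X z)^2)) UNIV"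
    by (intro has_integral_mult_right integrable_integral X_weighted_square_integrable)
  ultimately have "L Plus - L Minus = - (?j / tau P) * integral UNIV (\<lambda>z. 1 / ?R z * (deriv X z)^2)"
    by (rule has_integral_unique)
  moreover have "jump G t s (\<lambda>x. ?j^2 / (2 * (rho_tot P S t x)^2) + mu0 P S N t x) = L Plus - L Minus"
  proof (rule jump_eqI[OF ts])
    show "((\<lambda>x. ?j^2 / (2 * (rho_tot P S t x)^2) + mu0 P S N t x) \<longlongrightarrow> L \<sigma>') (nearside \<sigma>' t s)" for \<sigma>'
      unfolding L_def using tot_tr_pos[of \<sigma>'] by (intro tendsto_intros rho_tot_lim mu0_lim species_pos) auto
  qed
  ultimately show ?thesis by simp
qed

end

section \<open>Tangential derivatives of traces\<close>

lemma has_derivative_grad: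
  assumes "f differentiable at x"
  shows "(f has_derivative (\<lambda>h. grad f x \<bullet> h)) (at x)"
proof -
  define f' where "f' = frechet_derivative f (at x)"
  have D: "(f has_derivative f') (at x)"
    unfolding f'_def using assms frechet_derivative_works by blast
  then interpret f': linear f' by (rule has_derivative_linear)
  have "f' h = grad f x \<bullet> h" for h
  proof -
    have "f' h = f' (\<Sum>i\<in>UNIV. h $ i *\<^sub>R axis i 1)"
      by (simp add: basis_expansion[of h, unfolded scalar_mult_eq_scaleR])
    also have "\<dots> = (\<Sum>i\<in>UNIV. h $ i * f' (axis i 1))"
      by (simp add: f'.sum f'.scale)
    also have "\<dots> = grad f x \<bullet> h"
      by (simp add: grad_def pdiff_def f'_def inner_vec_def mult.commute)
    finally show ?thesis .
  qed
  then have "f' = (\<lambda>h. grad f x \<bullet> h)" by blast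
  then show ?thesis using D by simp
qed

lemma pdiff_line:
  assumes "F differentiable at (s + r *\<^sub>R axis i 1)"
  shows "((\<lambda>r. F (s + r *\<^sub>R axis i 1)) has_vector_derivative pdiff i F (s + r *\<^sub>R axis i 1)) (at r)"
proof -
  let ?F' = "frechet_derivative F (at (s + r *\<^sub>R axis i 1))"
  have F: "(F has_derivative ?F') (at (s + r *\<^sub>R axis i 1))"
    using assms frechet_derivative_works by blast
  have "((\<lambda>r. s + r *\<^sub>R axis i 1) has_derivative (\<lambda>h. h *\<^sub>R axis i 1)) (at r)"
    by (auto intro!: derivative_eq_intros)
  from has_derivative_compose[OF this F]
  have "((\<lambda>r. F (s + r *\<^sub>R axis i 1)) has_derivative (\<lambda>h. ?F' (h *\<^sub>R axis i 1))) (at r)" .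
  moreover have "?F' (h *\<^sub>R axis i 1) = h *\<^sub>R pdiff i F (s + r *\<^sub>R axis i 1)" for h
    unfolding pdiff_def by (rule linear_cmul[OF has_derivative_linear[OF F]])
  ultimately show ?thesis by (simp add: has_vector_derivative_def)
qed

context interface
begin

definition shifted :: "side \<Rightarrow> real \<Rightarrow> real \<Rightarrow> real^2 \<Rightarrow> real^3" where
  "shifted \<sigma> t d q = param G t q + (side_sign \<sigma> * d) *\<^sub>R normal G t q"

text \<open>The filter is arbitrary because two regimes occur: offset and parameter varying
  independently, for uniform gradient estimates, and the offset alone, for recovering the trace at a
  fixed parameter.\<close>

lemma shifted_tendsto:
  assumes t: "t \<in> {0..<tfin G}" and s: "s \<in> pdom G"
    and d: "(d \<longlongrightarrow> 0) F" "\<forall>\<^sub>F y in F. 0 < d y" and q: "(q \<longlongrightarrow> s) F"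
  shows "filterlim (\<lambda>y. shifted \<sigma> t (d y) (q y)) (nearside \<sigma> t s) F"
    and "\<forall>\<^sub>F y in F. shifted \<sigma> t (d y) (q y) \<in> Om G \<sigma> t"
proof -
  obtain \<delta> where \<delta>: "0 < \<delta>"
    "\<And>d q \<sigma>. 0 < d \<Longrightarrow> d < \<delta> \<Longrightarrow> dist q s < \<delta> \<Longrightarrow> param G t q + (side_sign \<sigma> * d) *\<^sub>R normal G t q \<in> Om G \<sigma> t"
    by (rule tube[OF t s]) (rule that)
  show Om: "\<forall>\<^sub>F y in F. shifted \<sigma> t (d y) (q y) \<in> Om G \<sigma> t"
    using d(2) order_tendstoD(2)[OF d(1) \<delta>(1)] tendstoD[OF q \<delta>(1)]
    by eventually_elim (simp add: shifted_def \<delta>(2))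
  have diff: "param G t differentiable at s" "normal G t differentiable at s"
    using geo t s by (auto simp: interface_geometry_def C1_on_def)
  have "isCont (param G t) s" "isCont (normal G t) s"
    using diff differentiable_imp_continuous_within by blast+
  then have "((\<lambda>y. shifted \<sigma> t (d y) (q y)) \<longlongrightarrow> param G t s + (side_sign \<sigma> * 0) *\<^sub>R normal G t s) F"
    unfolding shifted_def by (intro tendsto_intros d(1) isCont_tendsto_compose[OF _ q])
  moreover have "param G t s \<notin> Om G \<sigma> t"
    using geo t s unfolding interface_geometry_def by blast
  with Om have "\<forall>\<^sub>F y in F. shifted \<sigma> t (d y) (q y) \<in> Om G \<sigma> t \<and> shifted \<sigma> t (d y) (q y) \<noteq> param G t s"
    by (auto elim: eventually_mono)
  ultimately show "filterlim (\<lambda>y. shifted \<sigma> t (d y) (q y)) (nearside \<sigma> t s) F"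
    by (simp add: filterlim_at)
qed

text \<open>The mean value theorem along curves parallel to the interface, inside the bulk region; the
  distance to the interface tends to zero at the end.\<close>

lemma trace_increment:
  fixes f :: "real^3 \<Rightarrow> real"
  assumes t: "t \<in> {0..<tfin G}" and s: "s \<in> pdom G"
    and diff: "\<And>x. x \<in> Om G \<sigma> t \<Longrightarrow> f differentiable at x"
    and trf: "\<And>q. q \<in> pdom G \<Longrightarrow> (f \<longlongrightarrow> tr G \<sigma> t q f) (nearside \<sigma> t q)"
    and trg: "(grad f \<longlongrightarrow> l) (nearside \<sigma> t s)"
    and \<eta>: "0 < \<eta>"
  shows "\<forall>\<^sub>F h in at_right 0.
    \<bar>tr G \<sigma> t (s + h *\<^sub>R axis i 1) f - tr G \<sigma> t s f - h * (l \<bullet> pdiff i (param G t) s)\<bar> \<le> \<eta> * h"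
proof -
  define line where "line r = s + r *\<^sub>R axis i (1::real)" for r
  define c where "c d r = shifted \<sigma> t d (line r)" for d r
  define c' where "c' d r = pdiff i (param G t) (line r) + (side_sign \<sigma> * d) *\<^sub>R pdiff i (normal G t) (line r)" for d r
  define m where "m = l \<bullet> pdiff i (param G t) s"
  have C1: "C1_on (pdom G) (param G t)" "C1_on (pdom G) (normal G t)" and op: "open (pdom G)"
    using geo t by (auto simp: interface_geometry_def)
  have pc: "isCont (pdiff i (param G t)) s" "isCont (pdiff i (normal G t)) s"
    using C1 op s by (auto simp: C1_on_def continuous_on_eq_continuous_at)
  have line_lim: "(line \<longlongrightarrow> line r) (nhds r)" for r
    unfolding line_def by (intro tendsto_intros filterlim_ident)
  \<comment> \<open>The product filter keeps offset and parameter independent. The estimate then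
    holds on a parameter range that does not shrink with the offset, so the offset can go to 0 while
    \<open>h\<close> stays fixed.\<close>
  let ?F = "at_right (0::real) \<times>\<^sub>F nhds (0::real)"
  have fst0: "(fst \<longlongrightarrow> (0::real)) ?F" "\<forall>\<^sub>F y in ?F. 0 < fst y"
    using filterlim_fst[of "at_right (0::real)" "nhds (0::real)"]
    by (auto simp: filterlim_at elim: eventually_mono)
  have snd0: "((\<lambda>y. line (snd y)) \<longlongrightarrow> s) ?F"
    using filterlim_compose[OF line_lim[of 0] filterlim_snd] by (simp add: line_def)
  have near: "filterlim (\<lambda>y. c (fst y) (snd y)) (nearside \<sigma> t s) ?F" and inOm: "\<forall>\<^sub>F y in ?F. c (fst y) (snd y) \<in> Om G \<sigma> t"
    unfolding c_def by (rule shifted_tendsto[OF t s fst0 snd0])+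
  have "((\<lambda>y. grad f (c (fst y) (snd y)) \<bullet> c' (fst y) (snd y)) \<longlongrightarrow>
      l \<bullet> (pdiff i (param G t) s + (side_sign \<sigma> * 0) *\<^sub>R pdiff i (normal G t) s)) ?F"
    unfolding c'_def
    by (intro tendsto_intros filterlim_compose[OF trg near] fst0(1)
        isCont_tendsto_compose[OF pc(1) snd0] isCont_tendsto_compose[OF pc(2) snd0])
  then have "((\<lambda>y. grad f (c (fst y) (snd y)) \<bullet> c' (fst y) (snd y)) \<longlongrightarrow> m) ?F"
    by (simp add: m_def)
  from tendstoD[OF this \<eta>] inOm topological_tendstoD[OF snd0 op s]
  have "\<forall>\<^sub>F y in ?F. dist (grad f (c (fst y) (snd y)) \<bullet> c' (fst y) (snd y)) m < \<eta>
      \<and> c (fst y) (snd y) \<in> Om G \<sigma> t \<and> line (snd y) \<in> pdom G"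
    by eventually_elim simp
  then obtain A B where A: "eventually A (at_right (0::real))" and B: "eventually B (nhds (0::real))"
    and AB: "\<And>d r. A d \<Longrightarrow> B r \<Longrightarrow> dist (grad f (c d r) \<bullet> c' d r) m < \<eta> \<and> c d r \<in> Om G \<sigma> t \<and> line r \<in> pdom G"
    unfolding eventually_prod_filter by auto
  obtain b where b: "0 < b" "\<And>r. \<bar>r\<bar> < b \<Longrightarrow> B r"
    using B by (auto simp: eventually_nhds_metric dist_real_def)
  \<comment> \<open>One admissible offset is enough to see that the coordinate line stays in the
    parameter domain for all small \<open>r\<close>.\<close>
  obtain d0 where "A d0" using eventually_happens'[OF _ A] by auto
  have pdom: "line r \<in> pdom G" if "\<bar>r\<bar> < b" for r
    using AB[OF \<open>A d0\<close> b(2)[OF that]] by blast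
  have deriv: "((\<lambda>r. f (c d r)) has_real_derivative grad f (c d r) \<bullet> c' d r) (at r)" if "A d" "\<bar>r\<bar> < b" for d r
  proof -
    have "param G t differentiable at (line r)" "normal G t differentiable at (line r)"
      using C1 pdom[OF that(2)] by (auto simp: C1_on_def)
    from pdiff_line[OF this(1)[unfolded line_def]] pdiff_line[OF this(2)[unfolded line_def]]
    have "(c d has_vector_derivative c' d r) (at r)"
      unfolding c_def c'_def shifted_def line_def
      by (intro has_vector_derivative_add bounded_linear.has_vector_derivative[OF bounded_linear_scaleR_right])
    then have "(c d has_derivative (\<lambda>h. h *\<^sub>R c' d r)) (at r)"
      by (simp add: has_vector_derivative_def)
    from has_derivative_compose[OF this has_derivative_grad[OF diff]] AB[OF that(1) b(2)[OF that(2)]]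
    show ?thesis by (simp add: has_field_derivative_def mult_commute_abs)
  qed
  have bound: "\<bar>tr G \<sigma> t (line h) f - tr G \<sigma> t (line 0) f - h * m\<bar> \<le> \<eta> * h" if h: "0 < h" "h < b" for h
  proof (rule tendsto_upperbound)
    have "((\<lambda>d. f (c d r)) \<longlongrightarrow> tr G \<sigma> t (line r) f) (at_right 0)" if "\<bar>r\<bar> < b" for r
      unfolding c_def
      by (rule filterlim_compose[OF trf[OF pdom[OF that]] shifted_tendsto(1)[OF t pdom[OF that]]])
         (auto intro: tendsto_ident_at simp: eventually_at_right_less)
    from this[of h] this[of 0] h
    show "((\<lambda>d. \<bar>f (c d h) - f (c d 0) - h * m\<bar>) \<longlongrightarrow> \<bar>tr G \<sigma> t (line h) f - tr G \<sigma> t (line 0) f - h * m\<bar>) (at_right 0)"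
      by (intro tendsto_intros) auto
    show "\<forall>\<^sub>F d in at_right 0. \<bar>f (c d h) - f (c d 0) - h * m\<bar> \<le> \<eta> * h"
      using A
    proof eventually_elim
      case (elim d)
      obtain z where z: "0 < z" "z < h" "f (c d h) - f (c d 0) = (h - 0) * (grad f (c d z) \<bullet> c' d z)"
        using MVT2[of 0 h "\<lambda>r. f (c d r)" "\<lambda>r. grad f (c d r) \<bullet> c' d r"] deriv[OF elim] h by auto
      have "\<bar>grad f (c d z) \<bullet> c' d z - m\<bar> < \<eta>"
        using AB[OF elim b(2)[of z]] z h by (simp add: dist_real_def)
      then have "h * \<bar>grad f (c d z) \<bullet> c' d z - m\<bar> \<le> h * \<eta>"
        using h by (intro mult_left_mono) auto
      moreover have "f (c d h) - f (c d 0) - h * m = h * (grad f (c d z) \<bullet> c' d z - m)"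
        using z(3) by (simp add: algebra_simps)
      ultimately show ?case using h by (simp add: abs_mult mult.commute)
    qed
  qed simp
  show ?thesis
    using eventually_at_right_less[of 0] eventually_at_right_real[OF b(1)]
    by eventually_elim (use bound in \<open>auto simp: line_def m_def\<close>)
qed

text \<open>Let \<open>n\<close> be the nonzero cross product of the tangent vectors. By the
  Lagrange identity, both the tangential part \<open>u\<close> of \<open>v\<close> and the unit
  normal have zero cross product with \<open>n\<close>, so both are parallel to it. As
  \<open>u\<close> is also orthogonal to the normal, it vanishes.\<close>

lemma tangential_zero:
  assumes t: "t \<in> {0..<tfin G}" and s: "s \<in> pdom G"
    and v: "\<And>i. v \<bullet> pdiff i (param G t) s = 0"
  shows "v - (v \<bullet> normal G t s) *\<^sub>R normal G t s = 0"
proof -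
  let ?a = "pdiff 1 (param G t) s" and ?b = "pdiff 2 (param G t) s" and ?n = "normal G t s"
  define n where "n = cross3 ?a ?b"
  define u where "u = v - (v \<bullet> ?n) *\<^sub>R ?n"
  have n0: "n \<noteq> 0" and nu: "?n \<bullet> ?n = 1" and ortho: "?n \<bullet> pdiff i (param G t) s = 0" for i
    using geo t s by (auto simp: interface_geometry_def n_def norm_eq_1 inner_commute)
  have un: "u \<bullet> ?n = 0" by (simp add: u_def inner_diff_left nu)
  have "u \<bullet> pdiff i (param G t) s = 0" for i
    by (simp add: u_def inner_diff_left v ortho)
  then have "cross3 u n = 0" "cross3 ?n n = 0"
    by (simp_all add: n_def Lagrange ortho)
  moreover have "cross3 n ?n = 0"
    using \<open>cross3 ?n n = 0\<close> cross_skew[of n ?n] by simp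
  then have "(u \<bullet> ?n) *\<^sub>R n - (u \<bullet> n) *\<^sub>R ?n = 0"
    using Lagrange[of u n ?n] by simp
  then have "u \<bullet> n = 0" using un nu by auto
  moreover have "(n \<bullet> n) *\<^sub>R u - (n \<bullet> u) *\<^sub>R n = 0"
    using Lagrange[of n u n] \<open>cross3 u n = 0\<close> by simp
  ultimately have "u = 0" using n0 by (simp add: inner_commute)
  then show ?thesis by (simp add: u_def)
qed

end

context matched
begin

text \<open>The two traces agree at all nearby interface points, hence have equal increments along
  each coordinate line. \<open>trace_increment\<close> reads the tangential components of both
  gradients off these increments.\<close>

lemma tangential_gradient_jump:
  assumes t: "t \<in> {0..<tfin G}" and s: "s \<in> pdom G"
    and zero: "\<And>q. q \<in> pdom G \<Longrightarrow> jump G t q (phi0 S t) = 0"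
  shows "jump G t s (\<lambda>x. grad (phi0 S t) x - (grad (phi0 S t) x \<bullet> normal G t s) *\<^sub>R normal G t s) = 0"
proof -
  let ?l = "\<lambda>\<sigma>. tr G \<sigma> t s (grad (phi0 S t))"
  have op: "open (pdom G)" using geo by (simp add: interface_geometry_def)
  have "(?l Plus - ?l Minus) \<bullet> pdiff i (param G t) s = 0" for i
  proof -
    let ?m = "\<lambda>\<sigma>. ?l \<sigma> \<bullet> pdiff i (param G t) s"
    have "\<bar>?m Plus - ?m Minus\<bar> \<le> 0 + e" if e: "0 < e" for e
    proof -
      \<comment> \<open>Each side may contribute an error \<open>e / 2\<close>, relative to
        \<open>h\<close>.\<close>
      have incr: "\<forall>\<^sub>F h in at_right 0.
          \<bar>tr G \<sigma> t (s + h *\<^sub>R axis i 1) (phi0 S t) - tr G \<sigma> t s (phi0 S t) - h * ?m \<sigma>\<bar> \<le> e / 2 * h" for \<sigma>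
        by (rule trace_increment[OF t s phi0_differentiable[OF t] traces(5)[OF t] traces(6)[OF t s]]) (use e in auto)
      have "((\<lambda>h. s + h *\<^sub>R axis i 1) \<longlongrightarrow> s + 0 *\<^sub>R axis i 1) (at_right 0)"
        by (intro tendsto_intros)
      then have "\<forall>\<^sub>F h in at_right 0. s + h *\<^sub>R axis i 1 \<in> pdom G"
        using topological_tendstoD[OF _ op] s by simp
      then have "\<forall>\<^sub>F h in at_right (0::real). \<bar>?m Plus - ?m Minus\<bar> \<le> e"
        using incr[of Plus] incr[of Minus] eventually_at_right_less[of 0]
      proof eventually_elim
        case (elim h)
        have "tr G Plus t (s + h *\<^sub>R axis i 1) (phi0 S t) = tr G Minus t (s + h *\<^sub>R axis i 1) (phi0 S t)"
          "tr G Plus t s (phi0 S t) = tr G Minus t s (phi0 S t)"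
          using zero[OF elim(1)] zero[OF s] by (auto simp: jump_def)
        then have "\<bar>h * ?m Plus - h * ?m Minus\<bar> \<le> e * h"
          using elim(2,3) by linarith
        then have "h * \<bar>?m Plus - ?m Minus\<bar> \<le> h * e"
          using elim(4) by (simp add: abs_mult mult.commute flip: right_diff_distrib)
        then show ?case using elim(4) by simp
      qed
      then show ?thesis by (simp add: eventually_const_iff trivial_limit_at_right_real)
    qed
    then have "\<bar>?m Plus - ?m Minus\<bar> \<le> 0" by (rule field_le_epsilon)
    then show ?thesis by (simp add: inner_diff_left)
  qed
  from tangential_zero[OF t s this]
  show ?thesis
    by (subst jump_eqI[OF t s, of _ "\<lambda>\<sigma>. ?l \<sigma> - (?l \<sigma> \<bullet> normal G t s) *\<^sub>R normal G t s"])
       (auto intro!: tendsto_intros traces(6)[OF t s] simp: inner_diff_left algebra_simps)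
qed

lemma grad_W_chi_zero:
  assumes "t \<in> {0..<tfin G}" "x \<in> Om G \<sigma> t"
  shows "grad (\<lambda>y. deriv W (chi0 S t y) * chi1 S t y) x = 0"
  by (rule grad_locally_constant[OF assms]) (simp add: chi1_bulk[OF assms(1)])

end

section \<open>Bulk equations and interface conditions together\<close>

theorem theorem6p1:
  fixes P :: mixture and G :: geometry and S :: outer and I :: inner
  assumes "admissible P"
    and "interface_geometry G"
    and "liquid_on_plus_side G S"
    and "matching_solution P G S I"
  shows
    "(\<forall>\<sigma>. \<forall>t\<in>{0..<tfin G}. \<forall>x\<in>Om G \<sigma> t.
        chi0 S t x = side_sign \<sigma> \<and>
        chi1 S t x = 0 \<and>
        (\<forall>\<alpha>\<in>{1..species P - 1}.
           0 = dt G (rho S \<alpha>) t x + divg (\<lambda>y. rho S \<alpha> t y *\<^sub>R vel S t y) x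
               - divg (\<lambda>y. \<Sum>\<beta>=1..species P - 1. diff_mob P \<alpha> \<beta> *\<^sub>R
                   grad (\<lambda>y'. mu0 P S \<beta> t y' - mu0 P S (species P) t y'
                     + (charge P \<beta> / mass P \<beta> - charge P (species P) / mass P (species P))
                       * phi0 S t y') y) x
               - (\<Sum>i=1..reactions P. mass P \<alpha> * stoich P i \<alpha> * react_mob P i *
                   (1 - exp (\<Sum>\<beta>=1..species P. mass P \<beta> * stoich P i \<beta> * mu0 P S \<beta> t x)))) \<and>
        0 = dt G (rho_tot P S) t x + divg (\<lambda>y. rho_tot P S t y *\<^sub>R vel S t y) x \<and>
        0 = dt G (\<lambda>r y. rho_tot P S r y *\<^sub>R vel S r y) t x
            + div_tensor (\<lambda>y. rho_tot P S t y *\<^sub>R tensor_prod (vel S t y) (vel S t y)) x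
            + grad (\<lambda>y. (\<Sum>\<alpha>=1..species P. rho S \<alpha> t y * mu0 P S \<alpha> t y)
                - rho_f P (\<lambda>\<alpha>. rho S \<alpha> t y) (chi0 S t y)) x \<and>
        0 = (\<Sum>\<alpha>=1..species P. charge P \<alpha> / mass P \<alpha> * rho S \<alpha> t x)) \<and>
     (\<forall>t\<in>{0..<tfin G}. \<forall>s\<in>pdom G. \<forall>\<sigma>.
        (let \<nu> = normal G t s; w = normal_velocity G t s; \<kappa> = mean_curvature G t s;
             N = species P; j0 = mass_flux P G S \<sigma> t s; X0z = deriv (X0 I t s)
         in
          (\<forall>\<alpha>\<in>{1..N - 1}. 0 = jump G t s (\<lambda>x. mu0 P S \<alpha> t x - mu0 P S N t x)) \<and>
          0 = jump G t s (\<lambda>x. rho_tot P S t x * (vel S t x \<bullet> \<nu> - w)) \<and>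
          (\<forall>\<alpha>\<in>{1..N - 1}.
             0 = jump G t s (\<lambda>x. rho S \<alpha> t x * (vel S t x \<bullet> \<nu> - w))
                 - jump G t s (\<lambda>x. \<Sum>\<beta>=1..N - 1. diff_mob P \<alpha> \<beta> *
                     (grad (\<lambda>y. mu0 P S \<beta> t y - mu0 P S N t y
                       + (charge P \<beta> / mass P \<beta> - charge P N / mass P N) * phi0 S t y) x \<bullet> \<nu>))) \<and>
          (\<lambda>z. (X0z z)^2) integrable_on UNIV \<and>
          0 = jump G t s (\<lambda>x. j0 *\<^sub>R vel S t x
                + ((\<Sum>\<alpha>=1..N. rho S \<alpha> t x * mu0 P S \<alpha> t x)
                   - rho_f P (\<lambda>\<alpha>. rho S \<alpha> t x) (chi0 S t x)) *\<^sub>R \<nu>)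
              - (gam P * \<kappa> * integral UNIV (\<lambda>z. (X0z z)^2)) *\<^sub>R \<nu> \<and>
          (\<lambda>z. 1 / Rtot P I t s z * (X0z z)^2) integrable_on UNIV \<and>
          0 = jump G t s (\<lambda>x. j0^2 / (2 * (rho_tot P S t x)^2) + mu0 P S N t x)
              + j0 / tau P * integral UNIV (\<lambda>z. 1 / Rtot P I t s z * (X0z z)^2) \<and>
          (\<lambda>z. \<Sum>\<alpha>=1..N. charge P \<alpha> / mass P \<alpha> * R0 I \<alpha> t s z) integrable_on UNIV \<and>
          0 = jump G t s (\<lambda>x. (1 + susc P (chi0 S t x)) * (grad (phi0 S t) x \<bullet> \<nu>))
              + integral UNIV (\<lambda>z. \<Sum>\<alpha>=1..N. charge P \<alpha> / mass P \<alpha> * R0 I \<alpha> t s z) \<and>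
          0 = jump G t s (phi0 S t))) \<and>
     (\<forall>t\<in>{0..<tfin G}.
        (\<forall>s\<in>pdom G. jump G t s (phi0 S t) = 0) \<longrightarrow>
        (\<forall>s\<in>pdom G. jump G t s (\<lambda>x. grad (phi0 S t) x
            - (grad (phi0 S t) x \<bullet> normal G t s) *\<^sub>R normal G t s) = 0))"
proof -
  interpret matched G P S I
    using assms by unfold_locales
  have at: "matched_at G P S I t s" if "t \<in> {0..<tfin G}" "s \<in> pdom G" for t s
    using that by unfold_locales
  show ?thesis
  proof (intro conjI allI ballI impI, goal_cases)
    case (1 \<sigma> t x) then show ?case by (rule chi0_bulk)
  next
    case (2 \<sigma> t x) then show ?case by (rule chi1_bulk)
  next
    case (3 \<sigma> t x \<alpha>)
    then have "(t, x) \<in> spacetime G \<sigma>" by (simp add: spacetime_def)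
    from outer_bulk(1)[OF this 3(3)] show ?case
      unfolding diff_flux_def[abs_def] react_rate_def zrel_def .
  next
    case (4 \<sigma> t x)
    then have "(t, x) \<in> spacetime G \<sigma>" by (simp add: spacetime_def)
    then show ?case by (rule outer_bulk)
  next
    case (5 \<sigma> t x)
    then have "(t, x) \<in> spacetime G \<sigma>" by (simp add: spacetime_def)
    from outer_bulk(4)[OF this] show ?case
      unfolding grad_W_chi_zero[OF 5] press0_def[abs_def] by simp
  next
    case (6 \<sigma> t x)
    then have "(t, x) \<in> spacetime G \<sigma>" by (simp add: spacetime_def)
    then show ?case by (rule outer_bulk)
  next
    case (7 t s \<sigma>)
    interpret matched_at G P S I t s by (rule at[OF 7])
    show ?case
      unfolding Let_def
      using mu_difference_jump mass_flux_jump species_flux_jump[unfolded zrel_def] X_square_integrable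
        momentum_jump[of \<sigma>] X_weighted_square_integrable mu_N_jump[of \<sigma>] Poisson_jump phi_jump
      by (intro conjI ballI) (simp_all only: diff_self)
  next
    case (8 t s)
    then show ?case by (intro tangential_gradient_jump) auto
  qed
qed

end
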